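(* Under the standing assumptions of the context, including the stability condition $\rho<1$, let $\{u_H^n\}_{n=0}^{N_T}\subset V_H^{(m)}$ be the solution of the localized coarse-grid scheme given in the context. Then there exists a constant $C>0$, independent of $h$, $H$, $m$, $\tau$, $n$ (it may depend on $\rho$), such that for every $1\le n\le N_T-1$, $$\left\|\pi\left(\frac{u_H^{n+1}-u_H^n}{\tau}\right)\right\|_{L^2(\Omega)}^2+a_{DG}\left(\frac{u_H^{n+1}+u_H^n}{2},\frac{u_H^{n+1}+u_H^n}{2}\right)\le C\left(E^{\frac12}(u_H)+\tau^2\left(\sum_{k=1}^n\|\pi(f^k)\|_{L^2(\Omega)}\right)^2\right).$$
   Context: Grids. $\Omega\subset\mathbb{R}^d$ is a bounded domain ($d=2$), $\kappa$ is a coefficient field on $\Omega$ with $0<\kappa_0\le\kappa\le\kappa_1$. $\mathcal{T}^H=\{K_1,\dots,K_N\}$ is a usual finite element partition of $\Omega$ (coarse grid, mesh size $H$), $\mathcal{E}^H$ is the set of all coarse edges (including those on $\partial\Omega$), and $\mathcal{T}^h$ is a refinement of $\mathcal{T}^H$ (fine grid, mesh size $h$). $V_h(K_i)$ is the space of conforming bilinear elements on the fine grid in $K_i$, and $V_h=\oplus_{i=1}^N V_h(K_i)$ (functions continuous inside coarse blocks, possibly discontinuous across coarse edges). IPDG form. For $E\in\mathcal{E}^H$ let $n_E$ be a fixed unit normal. On an interior edge shared by $K^+,K^-$, with $n_E$ pointing from $K^+$ to $K^-$, $\{G\}=\frac12(G^++G^-)$, $\llbracket G\rrbracket=G^+-G^-$,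 where $G^\pm=G|_{K^\pm}$, and $\overline\kappa=(\kappa_{K^+}+\kappa_{K^-})/2$ with $\kappa_{K}$ the maximum of $\kappa$ over $K$. On a boundary edge of a coarse element $K$, $\{G\}=\llbracket G\rrbracket=G$, $\overline\kappa=\kappa_K$, and $n_E$ points out of $\Omega$. For $v,w\in V_h$, $$a_{DG}(v,w)=\sum_{K\in\mathcal{T}^H}\int_K\kappa\nabla v\cdot\nabla w\,dx-\sum_{E\in\mathcal{E}^H}\int_E\{\kappa\nabla v\cdot n_E\}\llbracket w\rrbracket\,d\sigma-\sum_{E\in\mathcal{E}^H}\int_E\{\kappa\nabla w\cdot n_E\}\llbracket v\rrbracket\,d\sigma+\frac{\gamma}{h}\sum_{E\in\mathcal{E}^H}\int_E\overline\kappa\llbracket v\rrbracket\llbracket w\rrbracket\,d\sigma,$$ $$\|w\|_a^2=\sum_{K\in\mathcal{T}^H}\int_K\kappa|\nabla w|^2\,dx+\frac{\gamma}{h}\sum_{E\in\mathcal{E}^H}\int_E\overline\kappa\llbracket w\rrbracket^2\,d\sigma .$$ Test space. On each $K_i$, $(\lambda_j^{(i)},\phi_j^{(i)})$ are the eigenpairs, $\phi_j^{(i)}\in V_h(K_i)$, of $\int_{K_i}\kappa\nabla\phi_j^{(i)}\cdot\nabla w\,dx=\frac{\lambda_j^{(i)}}{H^2}(\phi_j^{(i)},w)_{L^2(K_i)}$ for all $w\in V_h(K_i)$, with eigenvalues in ascending order in $j$ and eigenfunctions $L^2(K_i)$-orthonormal. The first $L_i$ eigenfunctions span $W_H^{(i)}$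 (extended by zero outside $K_i$); $W_H=\oplus_iW_H^{(i)}$. $\pi$ is the $L^2(\Omega)$-orthogonal projection onto $W_H$: $\pi(v)=\sum_{i}\sum_{j\le L_i}(v,\phi_j^{(i)})_{L^2(K_i)}\phi_j^{(i)}$ (used for any $v\in L^2(\Omega)$). $\Lambda=\min_{1\le i\le N}\lambda^{(i)}_{L_i+1}$ (positive). $b(v,w)=(\pi(v),\pi(w))_{L^2(\Omega)}$. Localized trial space. $K_{i,m}$ is the union of $K_i$ and $m\ge1$ layers of coarse elements around it; $V_h(K_{i,m})=\oplus_{K_{i'}\subset K_{i,m}}V_h(K_{i'})$, regarded as a subspace of $V_h$ by extension by zero. For $1\le j\le L_i$, $\psi_{j,m}^{(i)}$ is the minimizer of $a_{DG}(\psi,\psi)$ over $\psi\in V_h(K_{i,m})$ with $\pi(\psi)=\phi_j^{(i)}$. $V_H^{(m)}=\mathrm{span}\{\psi_{j,m}^{(i)}:1\le j\le L_i,\ 1\le i\le N\}$. Scheme. $T>0$, $N_T$ is the number of time steps, $\tau=T/N_T$, $t_n=n\tau$. $f$ is a source term with $f^n=f(\cdot,t_n)\in L^2(\Omega)$; $u_0,v_0$ are initial displacement and velocity, and $u_h^0\in V_h$ is the $L^2(\Omega)$-projection of $u_0$ onto $V_h$. The localized coarse-grid scheme is: for $1\le n\le N_T-1$, $u_H^{n+1}\in V_H^{(m)}$ satisfies $$b\left(\frac{u_H^{n+1}-2u_H^n+u_H^{n-1}}{\tau^2},w\right)+a_{DG}(u_H^n,w)=b(f^n,w)\quad\text{for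 all }w\in V_H^{(m)},$$ with $u_H^0,u_H^1\in V_H^{(m)}$ determined by $(u_H^0,w)_{L^2(\Omega)}=(u_0,w)_{L^2(\Omega)}$ and $(u_H^1,w)_{L^2(\Omega)}=(u_0+\tau v_0+\frac{\tau^2}{2}f^0,w)_{L^2(\Omega)}-\frac{\tau^2}{2}a_{DG}(u_h^0,w)$ for all $w\in V_H^{(m)}$. Energy. For $v=\{v^n\}_{n=0}^{N_T}$, $$E^{n+\frac12}(v)=\frac12\left\|\pi\left(\frac{v^{n+1}-v^n}{\tau}\right)\right\|_{L^2(\Omega)}^2-\frac{\tau^2}{8}a_{DG}\left(\frac{v^{n+1}-v^n}{\tau},\frac{v^{n+1}-v^n}{\tau}\right)+\frac12a_{DG}\left(\frac{v^{n+1}+v^n}{2},\frac{v^{n+1}+v^n}{2}\right).$$ Standing assumptions. $\gamma$ is sufficiently large that $|a_{DG}(v,w)|\le2\|v\|_a\|w\|_a$ and $a_{DG}(v,v)\ge\frac12\|v\|_a^2$ for all $v,w\in V_h$. $h$ is sufficiently small that there is a constant $D>0$, independent of $h,H,m$, such that for every $w_H\in W_H$ there is $v\in C^0(\Omega)\cap V_h$ with $\pi(v)=w_H$, $\|v\|_a^2\le D\kappa_1H^{-2}\|w_H\|_{L^2(\Omega)}^2$ and $\mathrm{supp}(v)\subseteq\mathrm{supp}(w_H)$. $\beta>0$ is a constant, independent of $h,H,m$, with $\|\pi(v)\|_{L^2(\Omega)}^2\ge\beta\kappa_1^{-1}H^2a_{DG}(v,v)$ for all $v\in V_H^{(m)}$.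 The stability condition is $\rho=\dfrac{\kappa_1^{1/2}\tau}{2\beta^{1/2}H}<1$. *)

theory Defs
  imports "HOL-Analysis.Analysis"
begin

section \<open>Grids\<close>

definition bounded_domain :: "(real^2) set \<Rightarrow> bool" where
  "bounded_domain \<Omega> \<longleftrightarrow> \<Omega> \<noteq> {} \<and> open \<Omega> \<and> connected \<Omega> \<and> bounded \<Omega>"

text \<open>Conforming partition into closed convex polygons: two elements meet, if at all, in a
  common vertex or in a common full edge.\<close>

definition fe_partition :: "(real^2) set \<Rightarrow> (real^2) set set \<Rightarrow> bool" where
  "fe_partition \<Omega> \<T> \<longleftrightarrow>
     finite \<T> \<and> \<Union>\<T> = closure \<Omega> \<and>
     (\<forall>K\<in>\<T>. polytope K \<and> interior K \<noteq> {} \<and> interior K \<subseteq> \<Omega>) \<and>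
     (\<forall>K\<in>\<T>. \<forall>K'\<in>\<T>. (K \<inter> K') face_of K \<and> (K \<inter> K') face_of K')"

definition mesh_size :: "(real^2) set set \<Rightarrow> real" where
  "mesh_size \<T> = Max (diameter ` \<T>)"

text \<open>A nondegenerate convex quadrilateral with its vertices listed in cyclic order.\<close>

definition quadrilateral ::
  "(real^2) set \<Rightarrow> real^2 \<Rightarrow> real^2 \<Rightarrow> real^2 \<Rightarrow> real^2 \<Rightarrow> bool" where
  "quadrilateral c p q r s \<longleftrightarrow>
     card {p, q, r, s} = 4 \<and> c = convex hull {p, q, r, s} \<and>
     closed_segment p q facet_of c \<and> closed_segment q r facet_of c \<and>
     closed_segment r s facet_of c \<and> closed_segment s p facet_of c"

definition fine_grid :: "(real^2) set \<Rightarrow> (real^2) set set \<Rightarrow> (real^2) set set \<Rightarrow> bool" where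
  "fine_grid \<Omega> \<T>H \<T>h \<longleftrightarrow>
     fe_partition \<Omega> \<T>h \<and>
     (\<forall>c\<in>\<T>h. (\<exists>p q r s. quadrilateral c p q r s) \<and> (\<exists>K\<in>\<T>H. c \<subseteq> K))"

text \<open>The elements of a coarse element together with \<open>m\<close> layers around it; an element belongs to
  the next layer if it touches the current patch, possibly only in a vertex.\<close>

fun patch :: "(real^2) set set \<Rightarrow> (real^2) set \<Rightarrow> nat \<Rightarrow> (real^2) set set" where
  "patch \<T> K 0 = {K}"
| "patch \<T> K (Suc m) = {K'\<in>\<T>. \<exists>K''\<in>patch \<T> K m. K' \<inter> K'' \<noteq> {}}"

section \<open>Square-integrable functions\<close>

definition square_integrable :: "(real^2) set \<Rightarrow> (real^2 \<Rightarrow> real) \<Rightarrow> bool" where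
  "square_integrable S v \<longleftrightarrow>
     v \<in> borel_measurable (lebesgue_on S) \<and> integrable (lebesgue_on S) (\<lambda>x. (v x)\<^sup>2)"

definition L2_inner :: "(real^2) set \<Rightarrow> (real^2 \<Rightarrow> real) \<Rightarrow> (real^2 \<Rightarrow> real) \<Rightarrow> real" where
  "L2_inner S v w = integral\<^sup>L (lebesgue_on S) (\<lambda>x. v x * w x)"

definition L2_norm :: "(real^2) set \<Rightarrow> (real^2 \<Rightarrow> real) \<Rightarrow> real" where
  "L2_norm S v = sqrt (L2_inner S v v)"

section \<open>Discontinuous finite element space\<close>

text \<open>Bilinear elements on a quadrilateral, i.e. bilinear in the reference coordinates
  \<open>(a, b)\<close> of the unit square. On a rectangle this is the span of \<open>1, x, y, x * y\<close> in coordinates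
  along its sides.\<close>

definition bilinear_elem :: "(real^2) set \<Rightarrow> (real^2 \<Rightarrow> real) \<Rightarrow> bool" where
  "bilinear_elem c v \<longleftrightarrow>
     (\<exists>p q r s \<alpha> \<beta> \<gamma> \<delta>. quadrilateral c p q r s \<and>
       (\<forall>a\<in>{0..1}. \<forall>b\<in>{0..1}.
          v (((1 - a) * (1 - b)) *\<^sub>R p + (a * (1 - b)) *\<^sub>R q + (a * b) *\<^sub>R r + ((1 - a) * b) *\<^sub>R s)
            = (1 - a) * (1 - b) * \<alpha> + a * (1 - b) * \<beta> + a * b * \<gamma> + (1 - a) * b * \<delta>))"

definition Vh_elem :: "(real^2) set set \<Rightarrow> (real^2) set \<Rightarrow> (real^2 \<Rightarrow> real) set" where
  "Vh_elem \<T>h K =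
     {v. continuous_on K v \<and> (\<forall>c\<in>\<T>h. c \<subseteq> K \<longrightarrow> bilinear_elem c v) \<and> (\<forall>x. x \<notin> K \<longrightarrow> v x = 0)}"

text \<open>The direct sum over a set of coarse elements, each summand being extended by zero. On a
  coarse edge the sum adds the values of the two adjacent summands; this is immaterial, since
  below only integrals over elements and limits from the interior of elements are formed.\<close>

definition Vh :: "(real^2) set set \<Rightarrow> (real^2) set set \<Rightarrow> (real^2 \<Rightarrow> real) set" where
  "Vh \<T>h \<S> = {\<lambda>x. \<Sum>K\<in>\<S>. w K x | w. \<forall>K\<in>\<S>. w K \<in> Vh_elem \<T>h K}"

text \<open>Membership in \<open>C\<^sup>0(\<Omega>)\<close> for such a function: its element-wise values fit together to a
  continuous function.\<close>

definition C0_across :: "(real^2) set \<Rightarrow> (real^2) set set \<Rightarrow> (real^2 \<Rightarrow> real) \<Rightarrow> bool" where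
  "C0_across \<Omega> \<T>H v \<longleftrightarrow>
     (\<exists>g. continuous_on \<Omega> g \<and> (\<forall>K\<in>\<T>H. \<forall>x\<in>interior K. v x = g x))"

definition supp :: "(real^2 \<Rightarrow> real) \<Rightarrow> (real^2) set" where
  "supp v = closure {x. v x \<noteq> 0}"

section \<open>Coarse edges\<close>

definition coarse_edges :: "(real^2) set set \<Rightarrow> (real^2) set set" where
  "coarse_edges \<T>H = {E. \<exists>K\<in>\<T>H. E facet_of K}"

definition edge_ends :: "(real^2) set \<Rightarrow> (real^2) \<times> (real^2)" where
  "edge_ends E = (SOME (a, b). E = closed_segment a b)"

definition edge_point :: "(real^2) set \<Rightarrow> real \<Rightarrow> real^2" where
  "edge_point E t = (1 - t) *\<^sub>R fst (edge_ends E) + t *\<^sub>R snd (edge_ends E)"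

text \<open>Integral over a segment with respect to arc length.\<close>

definition edge_integral :: "(real^2) set \<Rightarrow> (real^2 \<Rightarrow> real) \<Rightarrow> real" where
  "edge_integral E g =
     dist (fst (edge_ends E)) (snd (edge_ends E)) *
     integral\<^sup>L (lebesgue_on {0..1}) (\<lambda>t. g (edge_point E t))"

definition outward_normal :: "(real^2) set \<Rightarrow> (real^2) set \<Rightarrow> real^2" where
  "outward_normal K E = (THE n. norm n = 1 \<and> (\<forall>x\<in>E. \<forall>y\<in>K. n \<bullet> (y - x) \<le> 0))"

text \<open>An orientation \<open>pl\<close> selects for every edge \<open>E\<close> the element \<open>K\<^sup>+ = pl E\<close>. The fixed normal of
  \<open>E\<close> is the outward normal of \<open>K\<^sup>+\<close>; on a boundary edge \<open>K\<^sup>+\<close> is the only adjacent element.\<close>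

definition edge_orientation ::
  "(real^2) set set \<Rightarrow> ((real^2) set \<Rightarrow> (real^2) set) \<Rightarrow> bool" where
  "edge_orientation \<T>H pl \<longleftrightarrow> (\<forall>E\<in>coarse_edges \<T>H. pl E \<in> \<T>H \<and> E facet_of pl E)"

definition interior_edge :: "(real^2) set set \<Rightarrow> (real^2) set \<Rightarrow> bool" where
  "interior_edge \<T>H E \<longleftrightarrow> card {K\<in>\<T>H. E facet_of K} = 2"

definition minus_elem ::
  "(real^2) set set \<Rightarrow> ((real^2) set \<Rightarrow> (real^2) set) \<Rightarrow> (real^2) set \<Rightarrow> (real^2) set" where
  "minus_elem \<T>H pl E = (THE K. K \<in> \<T>H \<and> E facet_of K \<and> K \<noteq> pl E)"

definition one_sided :: "(real^2) set \<Rightarrow> (real^2 \<Rightarrow> real) \<Rightarrow> real^2 \<Rightarrow> real" where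
  "one_sided K G x = Lim (at x within interior K) G"

definition avg ::
  "(real^2) set set \<Rightarrow> ((real^2) set \<Rightarrow> (real^2) set) \<Rightarrow> (real^2) set \<Rightarrow>
     (real^2 \<Rightarrow> real) \<Rightarrow> real^2 \<Rightarrow> real" where
  "avg \<T>H pl E G x =
     (if interior_edge \<T>H E
      then (one_sided (pl E) G x + one_sided (minus_elem \<T>H pl E) G x) / 2
      else one_sided (pl E) G x)"

definition jump ::
  "(real^2) set set \<Rightarrow> ((real^2) set \<Rightarrow> (real^2) set) \<Rightarrow> (real^2) set \<Rightarrow>
     (real^2 \<Rightarrow> real) \<Rightarrow> real^2 \<Rightarrow> real" where
  "jump \<T>H pl E G x =
     (if interior_edge \<T>H E
      then one_sided (pl E) G x - one_sided (minus_elem \<T>H pl E) G x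
      else one_sided (pl E) G x)"

section \<open>Coefficient and IPDG form\<close>

definition coefficient_field ::
  "(real^2) set \<Rightarrow> (real^2 \<Rightarrow> real) \<Rightarrow> real \<Rightarrow> real \<Rightarrow> bool" where
  "coefficient_field \<Omega> \<kappa> \<kappa>0 \<kappa>1 \<longleftrightarrow>
     \<kappa> \<in> borel_measurable (lebesgue_on \<Omega>) \<and> 0 < \<kappa>0 \<and> (\<forall>x\<in>\<Omega>. \<kappa>0 \<le> \<kappa> x \<and> \<kappa> x \<le> \<kappa>1)"

text \<open>The form \<open>a_DG\<close> contains restrictions of \<open>\<kappa>\<close> to edges from either side, so these must exist
  almost everywhere on each edge; \<open>\<kappa>\<close> may jump across it.\<close>

definition has_edge_values :: "(real^2) set set \<Rightarrow> (real^2 \<Rightarrow> real) \<Rightarrow> bool" where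
  "has_edge_values \<T>H \<kappa> \<longleftrightarrow>
     (\<forall>K\<in>\<T>H. \<forall>E. E facet_of K \<longrightarrow>
        (AE t in lebesgue_on {0..1}. \<exists>l. (\<kappa> \<longlongrightarrow> l) (at (edge_point E t) within interior K)))"

text \<open>The maximum of \<open>\<kappa>\<close> over \<open>K\<close>; values of \<open>\<kappa>\<close> on the boundary of \<open>K\<close>, where \<open>\<kappa>\<close> may jump or be
  undefined, are ignored.\<close>

definition coeff_max :: "(real^2 \<Rightarrow> real) \<Rightarrow> (real^2) set \<Rightarrow> real" where
  "coeff_max \<kappa> K = (SUP x\<in>interior K. \<kappa> x)"

definition coeff_avg ::
  "(real^2 \<Rightarrow> real) \<Rightarrow> (real^2) set set \<Rightarrow> ((real^2) set \<Rightarrow> (real^2) set) \<Rightarrow> (real^2) set \<Rightarrow> real" where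
  "coeff_avg \<kappa> \<T>H pl E =
     (if interior_edge \<T>H E
      then (coeff_max \<kappa> (pl E) + coeff_max \<kappa> (minus_elem \<T>H pl E)) / 2
      else coeff_max \<kappa> (pl E))"

definition grad :: "(real^2 \<Rightarrow> real) \<Rightarrow> real^2 \<Rightarrow> real^2" where
  "grad v x = (\<chi> i. frechet_derivative v (at x) (axis i 1))"

definition elem_energy ::
  "(real^2 \<Rightarrow> real) \<Rightarrow> (real^2) set \<Rightarrow> (real^2 \<Rightarrow> real) \<Rightarrow> (real^2 \<Rightarrow> real) \<Rightarrow> real" where
  "elem_energy \<kappa> K v w = integral\<^sup>L (lebesgue_on K) (\<lambda>x. \<kappa> x * (grad v x \<bullet> grad w x))"

definition normal_flux ::
  "(real^2 \<Rightarrow> real) \<Rightarrow> ((real^2) set \<Rightarrow> (real^2) set) \<Rightarrow> (real^2) set \<Rightarrow>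
     (real^2 \<Rightarrow> real) \<Rightarrow> real^2 \<Rightarrow> real" where
  "normal_flux \<kappa> pl E v x = \<kappa> x * (grad v x \<bullet> outward_normal (pl E) E)"

definition a_DG ::
  "(real^2 \<Rightarrow> real) \<Rightarrow> real \<Rightarrow> (real^2) set set \<Rightarrow> (real^2) set set \<Rightarrow>
     ((real^2) set \<Rightarrow> (real^2) set) \<Rightarrow> (real^2 \<Rightarrow> real) \<Rightarrow> (real^2 \<Rightarrow> real) \<Rightarrow> real" where
  "a_DG \<kappa> \<gamma> \<T>H \<T>h pl v w =
     (\<Sum>K\<in>\<T>H. elem_energy \<kappa> K v w)
     - (\<Sum>E\<in>coarse_edges \<T>H.
          edge_integral E (\<lambda>x. avg \<T>H pl E (normal_flux \<kappa> pl E v) x * jump \<T>H pl E w x))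
     - (\<Sum>E\<in>coarse_edges \<T>H.
          edge_integral E (\<lambda>x. avg \<T>H pl E (normal_flux \<kappa> pl E w) x * jump \<T>H pl E v x))
     + \<gamma> / mesh_size \<T>h *
       (\<Sum>E\<in>coarse_edges \<T>H.
          edge_integral E (\<lambda>x. coeff_avg \<kappa> \<T>H pl E * jump \<T>H pl E v x * jump \<T>H pl E w x))"

definition norm_a ::
  "(real^2 \<Rightarrow> real) \<Rightarrow> real \<Rightarrow> (real^2) set set \<Rightarrow> (real^2) set set \<Rightarrow>
     ((real^2) set \<Rightarrow> (real^2) set) \<Rightarrow> (real^2 \<Rightarrow> real) \<Rightarrow> real" where
  "norm_a \<kappa> \<gamma> \<T>H \<T>h pl w =
     sqrt ((\<Sum>K\<in>\<T>H. integral\<^sup>L (lebesgue_on K) (\<lambda>x. \<kappa> x * (norm (grad w x))\<^sup>2))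
           + \<gamma> / mesh_size \<T>h *
             (\<Sum>E\<in>coarse_edges \<T>H.
                edge_integral E (\<lambda>x. coeff_avg \<kappa> \<T>H pl E * (jump \<T>H pl E w x)\<^sup>2)))"

text \<open>The requirement that the penalty parameter be large enough.\<close>

definition bounded_coercive ::
  "(real^2 \<Rightarrow> real) \<Rightarrow> real \<Rightarrow> (real^2) set set \<Rightarrow> (real^2) set set \<Rightarrow>
     ((real^2) set \<Rightarrow> (real^2) set) \<Rightarrow> bool" where
  "bounded_coercive \<kappa> \<gamma> \<T>H \<T>h pl \<longleftrightarrow>
     (\<forall>v\<in>Vh \<T>h \<T>H. \<forall>w\<in>Vh \<T>h \<T>H.
        \<bar>a_DG \<kappa> \<gamma> \<T>H \<T>h pl v w\<bar> \<le> 2 * norm_a \<kappa> \<gamma> \<T>H \<T>h pl v * norm_a \<kappa> \<gamma> \<T>H \<T>h pl w) \<and>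
     (\<forall>v\<in>Vh \<T>h \<T>H. a_DG \<kappa> \<gamma> \<T>H \<T>h pl v v \<ge> 1/2 * (norm_a \<kappa> \<gamma> \<T>H \<T>h pl v)\<^sup>2)"

section \<open>Test space\<close>

text \<open>Local quantities are indexed by the coarse element \<open>K\<close> and by \<open>j \<ge> 1\<close>. The last conjunct
  says that \<open>\<phi> 1, \<dots>, \<phi> M\<close> is the complete list of eigenfunctions, with \<open>M = dim V\<^sub>h(K)\<close>.\<close>

definition eigenpairs ::
  "(real^2 \<Rightarrow> real) \<Rightarrow> real \<Rightarrow> (real^2) set set \<Rightarrow> (real^2) set \<Rightarrow> nat \<Rightarrow>
     (nat \<Rightarrow> real) \<Rightarrow> (nat \<Rightarrow> real^2 \<Rightarrow> real) \<Rightarrow> bool" where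
  "eigenpairs \<kappa> H \<T>h K M lam \<phi> \<longleftrightarrow>
     (\<forall>j\<in>{1..M}. \<phi> j \<in> Vh_elem \<T>h K \<and>
        (\<forall>w\<in>Vh_elem \<T>h K. elem_energy \<kappa> K (\<phi> j) w = lam j / H\<^sup>2 * L2_inner K (\<phi> j) w)) \<and>
     (\<forall>i\<in>{1..M}. \<forall>j\<in>{1..M}. i \<le> j \<longrightarrow> lam i \<le> lam j) \<and>
     (\<forall>i\<in>{1..M}. \<forall>j\<in>{1..M}. L2_inner K (\<phi> i) (\<phi> j) = (if i = j then 1 else 0)) \<and>
     (\<forall>v\<in>Vh_elem \<T>h K. \<exists>c. v = (\<lambda>x. \<Sum>j=1..M. c j * \<phi> j x))"

text \<open>The span of the functions \<open>g K j\<close> with \<open>K \<in> \<T>H\<close> and \<open>1 \<le> j \<le> L K\<close>; it gives both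
  \<open>W\<^sub>H\<close> and the localized trial space.\<close>

definition span_of ::
  "(real^2) set set \<Rightarrow> ((real^2) set \<Rightarrow> nat) \<Rightarrow> ((real^2) set \<Rightarrow> nat \<Rightarrow> real^2 \<Rightarrow> real) \<Rightarrow>
     (real^2 \<Rightarrow> real) set" where
  "span_of \<T>H L g = {\<lambda>x. \<Sum>K\<in>\<T>H. \<Sum>j=1..L K. c K j * g K j x | c. True}"

definition pi_proj ::
  "(real^2) set set \<Rightarrow> ((real^2) set \<Rightarrow> nat) \<Rightarrow> ((real^2) set \<Rightarrow> nat \<Rightarrow> real^2 \<Rightarrow> real) \<Rightarrow>
     (real^2 \<Rightarrow> real) \<Rightarrow> real^2 \<Rightarrow> real" where
  "pi_proj \<T>H L \<phi> v = (\<lambda>x. \<Sum>K\<in>\<T>H. \<Sum>j=1..L K. L2_inner K v (\<phi> K j) * \<phi> K j x)"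

definition Lambda ::
  "(real^2) set set \<Rightarrow> ((real^2) set \<Rightarrow> nat) \<Rightarrow> ((real^2) set \<Rightarrow> nat \<Rightarrow> real) \<Rightarrow> real" where
  "Lambda \<T>H L lam = Min ((\<lambda>K. lam K (L K + 1)) ` \<T>H)"

definition spectral_test_space ::
  "(real^2 \<Rightarrow> real) \<Rightarrow> (real^2) set set \<Rightarrow> (real^2) set set \<Rightarrow> ((real^2) set \<Rightarrow> nat) \<Rightarrow>
     ((real^2) set \<Rightarrow> nat \<Rightarrow> real) \<Rightarrow> ((real^2) set \<Rightarrow> nat \<Rightarrow> real^2 \<Rightarrow> real) \<Rightarrow> bool" where
  "spectral_test_space \<kappa> \<T>H \<T>h L lam \<phi> \<longleftrightarrow>
     (\<forall>K\<in>\<T>H. \<exists>M. L K + 1 \<le> M \<and> eigenpairs \<kappa> (mesh_size \<T>H) \<T>h K M (lam K) (\<phi> K)) \<and>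
     0 < Lambda \<T>H L lam"

text \<open>The requirement that \<open>h\<close> be small enough, with constant \<open>D\<close>.\<close>

definition stable_lifting ::
  "(real^2) set \<Rightarrow> (real^2 \<Rightarrow> real) \<Rightarrow> real \<Rightarrow> real \<Rightarrow> real \<Rightarrow> (real^2) set set \<Rightarrow> (real^2) set set \<Rightarrow>
     ((real^2) set \<Rightarrow> (real^2) set) \<Rightarrow> ((real^2) set \<Rightarrow> nat) \<Rightarrow>
     ((real^2) set \<Rightarrow> nat \<Rightarrow> real^2 \<Rightarrow> real) \<Rightarrow> bool" where
  "stable_lifting \<Omega> \<kappa> \<kappa>1 \<gamma> D \<T>H \<T>h pl L \<phi> \<longleftrightarrow>
     (\<forall>wH\<in>span_of \<T>H L \<phi>. \<exists>v\<in>Vh \<T>h \<T>H. C0_across \<Omega> \<T>H v \<and> pi_proj \<T>H L \<phi> v = wH \<and>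
        (norm_a \<kappa> \<gamma> \<T>H \<T>h pl v)\<^sup>2 \<le> D * \<kappa>1 / (mesh_size \<T>H)\<^sup>2 * (L2_norm \<Omega> wH)\<^sup>2 \<and>
        supp v \<subseteq> supp wH)"

section \<open>Localized trial space\<close>

definition constrained_minimizer ::
  "((real^2 \<Rightarrow> real) \<Rightarrow> (real^2 \<Rightarrow> real) \<Rightarrow> real) \<Rightarrow> ((real^2 \<Rightarrow> real) \<Rightarrow> (real^2 \<Rightarrow> real)) \<Rightarrow>
     (real^2 \<Rightarrow> real) set \<Rightarrow> (real^2 \<Rightarrow> real) \<Rightarrow> (real^2 \<Rightarrow> real) \<Rightarrow> bool" where
  "constrained_minimizer a P V \<phi> \<psi> \<longleftrightarrow>
     \<psi> \<in> V \<and> P \<psi> = \<phi> \<and> (\<forall>\<eta>\<in>V. P \<eta> = \<phi> \<longrightarrow> a \<psi> \<psi> \<le> a \<eta> \<eta>)"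

definition localized_basis ::
  "(real^2 \<Rightarrow> real) \<Rightarrow> real \<Rightarrow> (real^2) set set \<Rightarrow> (real^2) set set \<Rightarrow>
     ((real^2) set \<Rightarrow> (real^2) set) \<Rightarrow> ((real^2) set \<Rightarrow> nat) \<Rightarrow>
     ((real^2) set \<Rightarrow> nat \<Rightarrow> real^2 \<Rightarrow> real) \<Rightarrow> nat \<Rightarrow>
     ((real^2) set \<Rightarrow> nat \<Rightarrow> real^2 \<Rightarrow> real) \<Rightarrow> bool" where
  "localized_basis \<kappa> \<gamma> \<T>H \<T>h pl L \<phi> m \<psi> \<longleftrightarrow>
     (\<forall>K\<in>\<T>H. \<forall>j\<in>{1..L K}.
        constrained_minimizer (a_DG \<kappa> \<gamma> \<T>H \<T>h pl) (pi_proj \<T>H L \<phi>)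
          (Vh \<T>h (patch \<T>H K m)) (\<phi> K j) (\<psi> K j))"

section \<open>Scheme and energy\<close>

text \<open>In this section \<open>a\<close> is the energy form, \<open>P\<close> the projection onto the test space, \<open>V\<close> the
  trial space and \<open>\<tau>\<close> the time step.\<close>

definition b_form ::
  "(real^2) set \<Rightarrow> ((real^2 \<Rightarrow> real) \<Rightarrow> (real^2 \<Rightarrow> real)) \<Rightarrow>
     (real^2 \<Rightarrow> real) \<Rightarrow> (real^2 \<Rightarrow> real) \<Rightarrow> real" where
  "b_form \<Omega> P v w = L2_inner \<Omega> (P v) (P w)"

definition L2_projection ::
  "(real^2) set \<Rightarrow> (real^2 \<Rightarrow> real) set \<Rightarrow> (real^2 \<Rightarrow> real) \<Rightarrow> (real^2 \<Rightarrow> real) \<Rightarrow> bool" where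
  "L2_projection \<Omega> V v p \<longleftrightarrow> p \<in> V \<and> (\<forall>w\<in>V. L2_inner \<Omega> p w = L2_inner \<Omega> v w)"

definition scheme_solution ::
  "(real^2) set \<Rightarrow> ((real^2 \<Rightarrow> real) \<Rightarrow> (real^2 \<Rightarrow> real) \<Rightarrow> real) \<Rightarrow>
     ((real^2 \<Rightarrow> real) \<Rightarrow> (real^2 \<Rightarrow> real)) \<Rightarrow> (real^2 \<Rightarrow> real) set \<Rightarrow> real \<Rightarrow> nat \<Rightarrow>
     (real \<Rightarrow> real^2 \<Rightarrow> real) \<Rightarrow> (real^2 \<Rightarrow> real) \<Rightarrow> (real^2 \<Rightarrow> real) \<Rightarrow> (real^2 \<Rightarrow> real) \<Rightarrow>
     (nat \<Rightarrow> real^2 \<Rightarrow> real) \<Rightarrow> bool" where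
  "scheme_solution \<Omega> a P V \<tau> NT f u0 v0 uh0 u \<longleftrightarrow>
     (\<forall>n\<le>NT. u n \<in> V) \<and>
     (\<forall>w\<in>V. L2_inner \<Omega> (u 0) w = L2_inner \<Omega> u0 w) \<and>
     (\<forall>w\<in>V. L2_inner \<Omega> (u 1) w =
        L2_inner \<Omega> (\<lambda>x. u0 x + \<tau> * v0 x + \<tau>\<^sup>2 / 2 * f 0 x) w - \<tau>\<^sup>2 / 2 * a uh0 w) \<and>
     (\<forall>n\<in>{1..NT - 1}. \<forall>w\<in>V.
        b_form \<Omega> P (\<lambda>x. (u (n + 1) x - 2 * u n x + u (n - 1) x) / \<tau>\<^sup>2) w + a (u n) w
          = b_form \<Omega> P (f (real n * \<tau>)) w)"

text \<open>\<open>energy \<Omega> a P \<tau> v n\<close> is the energy at the half step \<open>n + 1/2\<close>.\<close>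

definition energy ::
  "(real^2) set \<Rightarrow> ((real^2 \<Rightarrow> real) \<Rightarrow> (real^2 \<Rightarrow> real) \<Rightarrow> real) \<Rightarrow>
     ((real^2 \<Rightarrow> real) \<Rightarrow> (real^2 \<Rightarrow> real)) \<Rightarrow> real \<Rightarrow> (nat \<Rightarrow> real^2 \<Rightarrow> real) \<Rightarrow> nat \<Rightarrow> real" where
  "energy \<Omega> a P \<tau> v n =
     1/2 * (L2_norm \<Omega> (P (\<lambda>x. (v (n + 1) x - v n x) / \<tau>)))\<^sup>2
     - \<tau>\<^sup>2 / 8 * a (\<lambda>x. (v (n + 1) x - v n x) / \<tau>) (\<lambda>x. (v (n + 1) x - v n x) / \<tau>)
     + 1/2 * a (\<lambda>x. (v (n + 1) x + v n x) / 2) (\<lambda>x. (v (n + 1) x + v n x) / 2)"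

end

(*
  With d^n = (u^(n+1) - u^n) / tau, the polarization identity turns the energy at the half step into
  E^(n+1/2) = b(d^n, d^n) / 2 + a(u^(n+1), u^n) / 2. Testing the scheme with d^n + d^(n-1) gives
  E^(n+1/2) - E^(n-1/2) = tau / 2 * b(f^n, d^n + d^(n-1)), while the inverse inequality and rho < 1
  give E^(n+1/2) >= (1 - rho^2) / 2 * b(d^n, d^n) + a(m^n, m^n) / 2 with m^n = (u^(n+1) + u^n) / 2.
  Bounding all |pi d^k| by their maximum and absorbing it yields C = 4 / (1 - rho^2)^2.

  The analytic substance is that a_DG, built from Lebesgue integrals, gradients and one-sided limits
  that are all total functions, is really bilinear on V_h. The bilinear reference map is a
  homeomorphism of the unit square onto a convex quadrilateral with positive Jacobian, so an element
  function has a gradient inside each fine cell that extends continuously to the closed cell. Almost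
  every point of a coarse edge lies in exactly one fine cell of each adjacent coarse element, hence
  the one-sided fluxes exist there; as limits they depend continuously on the point, so they are
  measurable and bounded.
*)
theory Submission
  imports Defs
begin

section \<open>Convex quadrilaterals and the bilinear reference map\<close>

text \<open>The obstacle is that every ingredient of \<open>a_DG\<close> is total, so linearity has
  to be won pointwise: a gradient is meaningful only inside a fine cell, a trace only where the
  limit exists, and an integral is additive only over integrable functions. Statements are therefore
  made up to null sets and about interior values, since on a coarse edge a function of
  \<open>Vh\<close> adds up the values of adjacent summands. Essential boundedness, which survives
  products, then settles integrability. A second obstacle is that \<open>bilinear_elem\<close>
  chooses a vertex labelling for each function separately. Sums stay bilinear because two labellings
  of one quadrilateral differ by a symmetry of the reference square. In the constant, with s = 1 -
  \<rho>^2, one factor 1/s comes from absorbing the largest projected velocity by Young's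
  inequality, the other from dividing the lower bound of the energy by s. Comparing with the maximum
  avoids a Gronwall factor that grows exponentially in time.\<close>

definition cross2 :: "real^2 \<Rightarrow> real^2 \<Rightarrow> real" where
  "cross2 x y = x$1 * y$2 - x$2 * y$1"

text \<open>Twice the signed area of the triangle, positive when \<open>p\<close>, \<open>q\<close>,
  \<open>r\<close> run counterclockwise. For \<open>p \<noteq> q\<close> it is an affine function of
  \<open>r\<close> whose zero set is the line through \<open>p\<close> and \<open>q\<close>.\<close>

definition area :: "real^2 \<Rightarrow> real^2 \<Rightarrow> real^2 \<Rightarrow> real" where
  "area p q r = cross2 (q - p) (r - p)"

lemma inner_real2: "(x::real^2) \<bullet> y = x$1 * y$1 + x$2 * y$2"
  by (simp add: inner_vec_def sum_2)

lemma vec2_eq_iff: "(x::real^2) = y \<longleftrightarrow> x$1 = y$1 \<and> x$2 = y$2"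
  by (simp add: vec_eq_iff forall_2)

text \<open>In the plane the vectors orthogonal to \<open>d\<close> form a line, spanned by the
  quarter turn of \<open>d\<close>, and \<open>cross2 d\<close> is the inner product with that turn.
  So any normal of a side can be traded for a multiple of \<open>area\<close>.\<close>

lemma orthogonal_real2:
  assumes "(a::real^2) \<bullet> d = 0" "d \<noteq> 0"
  shows "\<exists>k. \<forall>h. a \<bullet> h = k * cross2 d h"
proof (cases "d$1 = 0")
  case True
  then have "d$2 \<noteq> 0" using assms(2) by (auto simp: vec2_eq_iff)
  then have "a$2 = 0" using assms(1) True by (auto simp: inner_real2)
  then have "\<forall>h. a \<bullet> h = (- (a$1 / d$2)) * cross2 d h"
    using True \<open>d$2 \<noteq> 0\<close> by (auto simp: inner_real2 cross2_def)
  then show ?thesis by blast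
next
  case False
  have "a$1 = - (a$2 * d$2 / d$1)"
    using assms(1) False by (simp add: inner_real2 field_simps add_eq_0_iff)
  then have "\<forall>h. a \<bullet> h = (a$2 / d$1) * cross2 d h"
    using False by (auto simp: inner_real2 cross2_def field_simps)
  then show ?thesis by blast
qed

lemma cross2_eq_0_imp_parallel:
  assumes "cross2 x y = 0" "x \<noteq> 0"
  shows "\<exists>b. y = b *\<^sub>R x"
proof (cases "x$1 = 0")
  case True
  then have "x$2 \<noteq> 0" using assms(2) by (auto simp: vec2_eq_iff)
  then have "y = (y$2 / x$2) *\<^sub>R x"
    using True assms(1) by (auto simp: vec2_eq_iff cross2_def)
  then show ?thesis by blast
next
  case False
  then have "y = (y$1 / x$1) *\<^sub>R x"
    using assms(1) by (auto simp: vec2_eq_iff cross2_def field_simps)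
  then show ?thesis by blast
qed

text \<open>A face of a polyhedron is exposed, hence cut out by a supporting line whose normal is
  orthogonal to \<open>q - p\<close>. The sign of \<open>k\<close> stays open because it is not
  known on which side of the directed segment the set lies.\<close>

lemma face_segment_line:
  assumes "polyhedron c" "closed_segment p q face_of c" "p \<noteq> q"
  shows "\<exists>k. (\<forall>x\<in>c. 0 \<le> k * area p q x) \<and>
             (\<forall>x\<in>c. k * area p q x = 0 \<longrightarrow> x \<in> closed_segment p q)"
proof -
  have "closed_segment p q exposed_face_of c"
    using assms exposed_face_of_polyhedron by blast
  then obtain a b where ab: "c \<subseteq> {x. a \<bullet> x \<le> b}"
      "closed_segment p q = c \<inter> {x. a \<bullet> x = b}"
    by (auto simp: exposed_face_of_def)
  have pq: "a \<bullet> p = b" "a \<bullet> q = b"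
    using ab(2) ends_in_segment[of p q] by blast+
  then have "(- a) \<bullet> (q - p) = 0" by (simp add: inner_diff_right)
  then obtain k where k: "\<And>h. (- a) \<bullet> h = k * cross2 (q - p) h"
    using orthogonal_real2[of "-a" "q - p"] assms(3) by auto
  have eq: "k * area p q x = b - a \<bullet> x" for x
    using k[of "x - p"] pq by (simp add: area_def inner_diff_right)
  have "\<forall>x\<in>c. 0 \<le> k * area p q x" using ab(1) eq by auto
  moreover have "\<forall>x\<in>c. k * area p q x = 0 \<longrightarrow> x \<in> closed_segment p q" using ab(2) eq by auto
  ultimately show ?thesis by blast
qed

lemma quadrilateral_distinct:
  assumes "quadrilateral c p q r s"
  shows "p \<noteq> q" "p \<noteq> r" "p \<noteq> s" "q \<noteq> r" "q \<noteq> s" "r \<noteq> s"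
proof -
  have "card {p, q, r, s} = 4" using assms by (simp add: quadrilateral_def)
  then show "p \<noteq> q" "p \<noteq> r" "p \<noteq> s" "q \<noteq> r" "q \<noteq> s" "r \<noteq> s"
    by (auto simp: card_insert_if split: if_splits)
qed

lemma quadrilateral_polytope: "quadrilateral c p q r s \<Longrightarrow> polytope c"
  unfolding quadrilateral_def polytope_def by (intro exI[of _ "{p, q, r, s}"]) auto

lemma segment_face_ends_extreme:
  "closed_segment p q face_of (c :: (real^2) set) \<Longrightarrow> p extreme_point_of c \<and> q extreme_point_of c"
  using extreme_point_of_face[of "closed_segment p q" c] extreme_point_of_segment[of _ p q] by auto

text \<open>Makes the vertex set a function of \<open>c\<close> alone, so that two labellings of the
  same quadrilateral can be compared.\<close>

lemma quadrilateral_extreme_points: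
  assumes "quadrilateral c p q r s"
  shows "{x. x extreme_point_of c} = {p, q, r, s}"
proof
  show "{x. x extreme_point_of c} \<subseteq> {p, q, r, s}"
    using assms extreme_points_of_convex_hull[of "{p,q,r,s}"] by (simp add: quadrilateral_def)
  show "{p, q, r, s} \<subseteq> {x. x extreme_point_of c}"
    using assms segment_face_ends_extreme[of p q c] segment_face_ends_extreme[of r s c]
    by (auto simp: quadrilateral_def facet_of_imp_face_of)
qed

lemma face_segment_other_vertex:
  assumes "closed_segment p q face_of (c :: (real^2) set)" "x extreme_point_of c" "x \<noteq> p" "x \<noteq> q"
  shows "x \<notin> closed_segment p q"
  using assms extreme_point_of_face[of "closed_segment p q" c x] extreme_point_of_segment[of x p q]
  by blast

text \<open>Multiplying the two inequalities of \<open>face_segment_line\<close> turns the unknown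
  factor \<open>k\<close> into a square, which leaves a statement free of it.\<close>

lemma face_segment_same_side:
  assumes "polytope c" "closed_segment p q face_of c" "p \<noteq> q"
    and "x extreme_point_of c" "x \<noteq> p" "x \<noteq> q" and "y extreme_point_of c" "y \<noteq> p" "y \<noteq> q"
  shows "0 < area p q x * area p q y"
proof -
  obtain k where k: "\<forall>x\<in>c. 0 \<le> k * area p q x"
      "\<forall>x\<in>c. k * area p q x = 0 \<longrightarrow> x \<in> closed_segment p q"
    using face_segment_line[of c p q] assms(1-3) polytope_imp_polyhedron by blast
  have "x \<in> c" "y \<in> c" using assms(4,7) by (auto simp: extreme_point_of_def)
  moreover have "x \<notin> closed_segment p q" "y \<notin> closed_segment p q"
    using face_segment_other_vertex assms by blast+
  ultimately have "0 < k * area p q x" "0 < k * area p q y"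
    using k by (metis order_le_less)+
  then have "0 < (k * area p q x) * (k * area p q y)" by simp
  also have "\<dots> = k\<^sup>2 * (area p q x * area p q y)" by (simp add: power2_eq_square)
  finally show ?thesis
    by (meson zero_less_mult_pos zero_le_power2 mult_nonneg_nonpos not_le zero_less_mult_iff)
qed

text \<open>The four numbers are the Jacobian determinants of the bilinear reference map at the
  corners (1,0), (1,1), (0,1), (0,0) of the unit square.\<close>

definition ccw_quad :: "real^2 \<Rightarrow> real^2 \<Rightarrow> real^2 \<Rightarrow> real^2 \<Rightarrow> bool" where
  "ccw_quad p q r s \<longleftrightarrow> 0 < area p q r \<and> 0 < area q r s \<and> 0 < area r s p \<and> 0 < area s p q"

lemma area_rotate: "area p q r = area q r p"
  by (simp add: area_def cross2_def algebra_simps)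

text \<open>Along each side the two remaining vertices lie on the same side, so two neighbouring
  corner triangles have the same orientation. Three sides link all four triangles; if the common
  sign is negative, listing the vertices backwards reverses it.\<close>

lemma quadrilateral_ccw:
  assumes "quadrilateral c p q r s"
  shows "ccw_quad p q r s \<or> ccw_quad p s r q"
proof -
  note d = quadrilateral_distinct[OF assms]
  note pt = quadrilateral_polytope[OF assms]
  have ex: "p extreme_point_of c" "q extreme_point_of c" "r extreme_point_of c" "s extreme_point_of c"
    using quadrilateral_extreme_points[OF assms] by auto
  have f: "closed_segment p q face_of c" "closed_segment q r face_of c"
      "closed_segment r s face_of c" "closed_segment s p face_of c"
    using assms by (auto simp: quadrilateral_def facet_of_imp_face_of)
  have 1: "0 < area p q r * area p q s"
    by (rule face_segment_same_side[OF pt f(1)]) (use d ex in auto)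
  have 2: "0 < area q r s * area q r p"
    by (rule face_segment_same_side[OF pt f(2)]) (use d ex in auto)
  have 3: "0 < area r s p * area r s q"
    by (rule face_segment_same_side[OF pt f(3)]) (use d ex in auto)
  have e: "area p q s = area s p q" "area q r p = area p q r" "area r s q = area q r s"
    using area_rotate by metis+
  have sg: "0 < x * y \<Longrightarrow> (0 < x \<and> 0 < y) \<or> (x < 0 \<and> y < 0)" for x y :: real
    by (simp add: zero_less_mult_iff)
  have "(0 < area p q r \<and> 0 < area q r s \<and> 0 < area r s p \<and> 0 < area s p q) \<or>
    (area p q r < 0 \<and> area q r s < 0 \<and> area r s p < 0 \<and> area s p q < 0)"
    using sg[OF 1] sg[OF 2] sg[OF 3] unfolding e by linarith
  moreover have "area p s r = - area r s p" "area s r q = - area q r s" "area r q p = - area p q r"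
      "area q p s = - area s p q"
    by (simp_all add: area_def cross2_def algebra_simps)
  ultimately show ?thesis unfolding ccw_quad_def by linarith
qed

section \<open>The bilinear reference map\<close>

definition bil :: "'v::real_vector \<Rightarrow> 'v \<Rightarrow> 'v \<Rightarrow> 'v \<Rightarrow> real \<times> real \<Rightarrow> 'v" where
  "bil p q r s = (\<lambda>(a, b). ((1 - a) * (1 - b)) *\<^sub>R p + (a * (1 - b)) *\<^sub>R q + (a * b) *\<^sub>R r
     + ((1 - a) * b) *\<^sub>R s)"

abbreviation unit_square :: "(real \<times> real) set" where
  "unit_square \<equiv> {0..1} \<times> {0..1}"

lemma bil_flip: "bil p q r s (a, b) = bil p s r q (b, a)"
  by (simp add: bil_def mult.commute)

text \<open>Partial derivative in the first reference coordinate. As the map is affine in each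
  coordinate, it depends on the second coordinate only; \<open>bil_db\<close> is its
  counterpart.\<close>

definition bil_da :: "'v::real_vector \<Rightarrow> 'v \<Rightarrow> 'v \<Rightarrow> 'v \<Rightarrow> real \<Rightarrow> 'v" where
  "bil_da p q r s b = (1 - b) *\<^sub>R (q - p) + b *\<^sub>R (r - s)"

definition bil_db :: "'v::real_vector \<Rightarrow> 'v \<Rightarrow> 'v \<Rightarrow> 'v \<Rightarrow> real \<Rightarrow> 'v" where
  "bil_db p q r s a = (1 - a) *\<^sub>R (s - p) + a *\<^sub>R (r - q)"

text \<open>Exact, without remainder: move the first coordinate at height \<open>b'\<close>, then
  the second one at the fixed \<open>a\<close>; both moves are affine.\<close>

lemma bil_diff:
  fixes p q r s :: "'v::real_vector"
  shows "bil p q r s (a', b') - bil p q r s (a, b)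
    = (a' - a) *\<^sub>R bil_da p q r s b' + (b' - b) *\<^sub>R bil_db p q r s a"
  by (simp add: bil_def bil_da_def bil_db_def algebra_simps)

lemma convex_combination_pos:
  fixes x y t :: real
  assumes "0 \<le> t" "t \<le> 1" "0 < x" "0 < y"
  shows "0 < (1 - t) * x + t * y"
proof (cases "t = 0")
  case False
  then have "0 < t * y" "0 \<le> (1 - t) * x" using assms by auto
  then show ?thesis by linarith
qed (use assms in simp)

text \<open>The determinant is the bilinear interpolation of its corner values, which are the
  positive areas of \<open>ccw_quad\<close>.\<close>

lemma jacobian_pos:
  assumes "ccw_quad p q r s" "a \<in> {0..1}" "b \<in> {0..1}"
  shows "0 < cross2 (bil_da p q r s b) (bil_db p q r s a)"
proof -
  have "cross2 (bil_da p q r s b) (bil_db p q r s a)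
     = (1 - b) * ((1 - a) * area s p q + a * area p q r) + b * ((1 - a) * area r s p + a * area q r s)"
    by (simp add: bil_da_def bil_db_def cross2_def area_def algebra_simps)
  also have "0 < \<dots>"
    using assms by (intro convex_combination_pos) (auto simp: ccw_quad_def)
  finally show ?thesis .
qed

lemma cross2_add_scale: 
  "cross2 (x *\<^sub>R u + y *\<^sub>R v) v = x * cross2 u v" "cross2 u (x *\<^sub>R u + y *\<^sub>R v) = y * cross2 u v"
  by (simp_all add: cross2_def algebra_simps)

text \<open>Equal images make a combination of \<open>bil_da\<close> at \<open>b'\<close> and
  \<open>bil_db\<close> at \<open>a\<close> vanish. The mixed point \<open>(a, b')\<close> lies in
  the square again, so these two vectors are independent there.\<close>

lemma bil_inj:
  assumes "ccw_quad p q r s"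
  shows "inj_on (bil p q r s) unit_square"
proof (rule inj_onI, clarify)
  fix a b a' b' :: real
  assume ab: "a \<in> {0..1}" "b \<in> {0..1}" "a' \<in> {0..1}" "b' \<in> {0..1}"
    and eq: "bil p q r s (a, b) = bil p q r s (a', b')"
  let ?u = "bil_da p q r s b'" and ?v = "bil_db p q r s a"
  have z: "(a' - a) *\<^sub>R ?u + (b' - b) *\<^sub>R ?v = 0"
    using bil_diff[of p q r s a' b' a b] eq by simp
  have J: "0 < cross2 ?u ?v" using jacobian_pos[OF assms] ab by blast
  have "(a' - a) * cross2 ?u ?v = 0" "(b' - b) * cross2 ?u ?v = 0"
    using cross2_add_scale(1)[of "a' - a" ?u "b' - b" ?v] z
      cross2_add_scale(2)[of ?u "a' - a" "b' - b" ?v] by (simp_all add: cross2_def)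
  then show "a = a' \<and> b = b'" using J by auto
qed

lemma area_convex_nonneg: "convex {x. 0 \<le> area p q x}"
proof -
  have "{x. 0 \<le> area p q x} = {x. (vector [(q-p)$2, - ((q-p)$1)] :: real^2) \<bullet> x
      \<le> (q-p)$2 * p$1 - (q-p)$1 * p$2}"
    by (auto simp: area_def cross2_def inner_real2 vector_2 algebra_simps)
  then show ?thesis by (simp add: convex_halfspace_le)
qed

lemma ccw_quad_hull_area:
  assumes "ccw_quad p q r s"
  shows "convex hull {p, q, r, s} \<subseteq> {x. 0 \<le> area p q x}"
    "convex hull {p, q, r, s} \<subseteq> {x. 0 \<le> area q r x}"
    "convex hull {p, q, r, s} \<subseteq> {x. 0 \<le> area r s x}"
    "convex hull {p, q, r, s} \<subseteq> {x. 0 \<le> area s p x}"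
proof -
  have e: "area p q s = area s p q" "area q r p = area p q r" "area r s q = area q r s"
     "area s p r = area r s p"
    using area_rotate by metis+
  have z: "area x y x = 0" "area x y y = 0" for x y by (auto simp: area_def cross2_def)
  show "convex hull {p, q, r, s} \<subseteq> {x. 0 \<le> area p q x}"
    "convex hull {p, q, r, s} \<subseteq> {x. 0 \<le> area q r x}"
    "convex hull {p, q, r, s} \<subseteq> {x. 0 \<le> area r s x}"
    "convex hull {p, q, r, s} \<subseteq> {x. 0 \<le> area s p x}"
    by (rule hull_minimal; use area_convex_nonneg assms in \<open>auto simp: ccw_quad_def e z\<close>)+
qed

text \<open>For surjectivity, the segments joining points of equal parameter on the sides
  \<open>p q\<close> and \<open>s r\<close> sweep the quadrilateral. The first coordinate is found
  by the intermediate value theorem; that the second one lies in the unit interval follows from the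
  position of \<open>x\<close> relative to the lines \<open>p q\<close> and
  \<open>r s\<close>.\<close>

lemma bil_surj:
  assumes Q: "ccw_quad p q r s"
  shows "bil p q r s ` unit_square = convex hull {p, q, r, s}"
proof
  have "bil p q r s (a, b) \<in> convex hull {p, q, r, s}" if "a \<in> {0..1}" "b \<in> {0..1}" for a b
  proof -
    have C: "convex (convex hull {p, q, r, s})" by simp
    have m: "p \<in> convex hull {p, q, r, s}" "q \<in> convex hull {p, q, r, s}"
      "r \<in> convex hull {p, q, r, s}" "s \<in> convex hull {p, q, r, s}"
      by (simp_all add: hull_inc)
    have "(1 - a) *\<^sub>R p + a *\<^sub>R q \<in> convex hull {p, q, r, s}"
        "(1 - a) *\<^sub>R s + a *\<^sub>R r \<in> convex hull {p, q, r, s}"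
      using that m by (simp_all add: convexD[OF C])
    then have "(1 - b) *\<^sub>R ((1 - a) *\<^sub>R p + a *\<^sub>R q) + b *\<^sub>R ((1 - a) *\<^sub>R s + a *\<^sub>R r)
        \<in> convex hull {p, q, r, s}"
      using that by (simp add: convexD[OF C])
    then show ?thesis by (simp add: bil_def algebra_simps)
  qed
  then show "bil p q r s ` unit_square \<subseteq> convex hull {p, q, r, s}" by auto
next
  show "convex hull {p, q, r, s} \<subseteq> bil p q r s ` unit_square"
  proof
    fix x assume x: "x \<in> convex hull {p, q, r, s}"
    have ar: "0 \<le> area p q x" "0 \<le> area q r x" "0 \<le> area r s x" "0 \<le> area s p x"
      using x ccw_quad_hull_area[OF Q] by auto
    \<comment> \<open>\<open>f a = 0\<close> says that \<open>x\<close> lies on the line through the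
      points of parameter \<open>a\<close> on the sides \<open>p q\<close> and \<open>s r\<close>.
      The end values of \<open>f\<close> are, up to sign, the areas that \<open>x\<close> spans with
      the other two sides.\<close>
    define f where "f a = cross2 (bil_db p q r s a) (x - (p + a *\<^sub>R (q - p)))" for a
    have "f 0 = - area s p x" "f 1 = area q r x"
      by (simp_all add: f_def bil_db_def area_def cross2_def algebra_simps)
    moreover have "continuous_on {0..1} f"
      unfolding f_def cross2_def bil_db_def by (intro continuous_intros)
    ultimately obtain a where a: "a \<in> {0..1}" "f a = 0"
      using IVT'[of f 0 0 1] ar by auto
    let ?v = "bil_db p q r s a"
    have J0: "0 < cross2 (bil_da p q r s 0) ?v" and J1: "0 < cross2 (bil_da p q r s 1) ?v"
      using jacobian_pos[OF Q a(1)] by simp_all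
    then have "?v \<noteq> 0" by (auto simp: cross2_def)
    then obtain b where b: "x - (p + a *\<^sub>R (q - p)) = b *\<^sub>R ?v"
      using cross2_eq_0_imp_parallel a(2) unfolding f_def by blast
    then have xe: "x = p + a *\<^sub>R (q - p) + b *\<^sub>R ?v" by (simp add: algebra_simps)
    have "area p q x = b * cross2 (bil_da p q r s 0) ?v"
      unfolding xe by (simp add: area_def cross2_def bil_da_def algebra_simps)
    then have "0 \<le> b" using ar(1) J0 by (simp add: zero_le_mult_iff)
    have "area r s x = (1 - b) * cross2 (bil_da p q r s 1) ?v"
      unfolding xe by (simp add: area_def cross2_def bil_da_def bil_db_def algebra_simps)
    then have "b \<le> 1" using ar(3) J1 by (simp add: zero_le_mult_iff)
    have "x = bil p q r s (a, b)"
      unfolding xe by (simp add: bil_def bil_db_def algebra_simps)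
    then show "x \<in> bil p q r s ` unit_square"
      using a(1) \<open>0 \<le> b\<close> \<open>b \<le> 1\<close> by auto
  qed
qed

text \<open>Holds in any normed space, since it is applied both to the map into the plane and to the
  interpolation of the four nodal values.\<close>

lemma bil_has_derivative:
  fixes p q r s :: "'v::real_normed_vector"
  shows "(bil p q r s has_derivative
     (\<lambda>(h, k). h *\<^sub>R bil_da p q r s (snd z) + k *\<^sub>R bil_db p q r s (fst z))) (at z)"
proof -
  have "bil p q r s = (\<lambda>z. ((1 - fst z) * (1 - snd z)) *\<^sub>R p + (fst z * (1 - snd z)) *\<^sub>R q
     + (fst z * snd z) *\<^sub>R r + ((1 - fst z) * snd z) *\<^sub>R s)"
    by (auto simp: bil_def)
  then show ?thesis
    by (auto intro!: derivative_eq_intros simp: bil_da_def bil_db_def algebra_simps case_prod_beta)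
qed

lemma bil_lincomb:
  "x * bil \<alpha> \<beta> \<gamma> \<delta> z + y * bil \<alpha>' \<beta>' \<gamma>' \<delta>' z
    = bil (x * \<alpha> + y * \<alpha>') (x * \<beta> + y * \<beta>') (x * \<gamma> + y * \<gamma>') (x * \<delta> + y * \<delta>') z"
  for x y :: real
  by (cases z) (simp add: bil_def algebra_simps)

text \<open>On the cell, \<open>v\<close> is the nodal interpolation composed with the inverse
  \<open>R\<close> of the reference map. Compactness makes \<open>R\<close> continuous, so the
  inverse function rule applies inside the cell. The resulting gradient is a quotient in reference
  coordinates whose denominator is the Jacobian; this is positive on the closed square, so the
  gradient extends continuously to the boundary.\<close>

lemma ccw_quad_C1:
  assumes Q: "ccw_quad p q r s" and c: "c = convex hull {p, q, r, s}"
    and v: "\<And>z. z \<in> unit_square \<Longrightarrow> v (bil p q r s z) = bil \<alpha> \<beta> \<gamma> \<delta> z"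
  shows "\<exists>G. continuous_on c G \<and> (\<forall>x\<in>interior c. (v has_derivative (\<lambda>h. G x \<bullet> h)) (at x))"
proof -
  define F where "F = bil p q r s"
  define R where "R = inv_into unit_square F"
  define Fa where "Fa = bil_da p q r s"
  define Fb where "Fb = bil_db p q r s"
  define Ba where "Ba = bil_da \<alpha> \<beta> \<gamma> \<delta>"
  define Bb where "Bb = bil_db \<alpha> \<beta> \<gamma> \<delta>"
  define J where "J z = cross2 (Fa (snd z)) (Fb (fst z))" for z :: "real \<times> real"
  \<comment> \<open>Cramer's rule for the gradient: \<open>g z\<close> is the vector with inner
    products \<open>Ba (snd z)\<close> and \<open>Bb (fst z)\<close> with the two tangent vectors
    \<open>Fa (snd z)\<close> and \<open>Fb (fst z)\<close>.\<close>
  define g where "g z = ((\<chi> i. if i = 1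
      then (Fb (fst z) $ 2 * Ba (snd z) - Fa (snd z) $ 2 * Bb (fst z)) / J z
      else (Fa (snd z) $ 1 * Bb (fst z) - Fb (fst z) $ 1 * Ba (snd z)) / J z) :: real^2)" for z
  have g12: "g z $ 1 = (Fb (fst z) $ 2 * Ba (snd z) - Fa (snd z) $ 2 * Bb (fst z)) / J z"
     "g z $ 2 = (Fa (snd z) $ 1 * Bb (fst z) - Fb (fst z) $ 1 * Ba (snd z)) / J z" for z
    by (simp_all add: g_def)
  have Fc: "F ` unit_square = c" and inj: "inj_on F unit_square"
    using bil_surj[OF Q] bil_inj[OF Q] by (simp_all add: F_def c)
  have FR: "F (R x) = x" and RS: "R x \<in> unit_square" if "x \<in> c" for x
    using that Fc unfolding R_def by (auto intro: f_inv_into_f inv_into_into)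
  have RF: "R (F z) = z" if "z \<in> unit_square" for z
    using inj that unfolding R_def by (rule inv_into_f_f)
  have contF: "continuous_on unit_square F"
    unfolding F_def using bil_has_derivative has_derivative_continuous
    by (metis continuous_at_imp_continuous_on)
  have "compact unit_square" by (intro compact_Times compact_Icc)
  then have contR: "continuous_on c R"
    using continuous_on_inv[OF contF] RF Fc by auto
  have J: "0 < J z" if "z \<in> unit_square" for z
    using jacobian_pos[OF Q] that unfolding J_def Fa_def Fb_def by auto
  have contg: "continuous_on unit_square g"
  proof -
    have "continuous_on unit_square (\<lambda>z. g z $ 1)" "continuous_on unit_square (\<lambda>z. g z $ 2)"
      using J unfolding g12 J_def cross2_def Fa_def Fb_def Ba_def Bb_def bil_da_def bil_db_def
      by (force intro!: continuous_intros)+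
    then have "continuous_on unit_square (\<lambda>z. g z $ i)" for i
      using exhaust_2[of i] by auto
    then have "continuous_on unit_square (\<lambda>z. \<chi> i. g z $ i)"
      by (intro continuous_on_vec_lambda)
    then show ?thesis by simp
  qed
  have "continuous_on c (\<lambda>x. g (R x))"
    by (rule continuous_on_compose2[OF contg contR]) (use RS in blast)
  moreover have "(v has_derivative (\<lambda>h. g (R x) \<bullet> h)) (at x)" if x: "x \<in> interior c" for x
  proof -
    let ?a = "Fa (snd (R x))" and ?b = "Fb (fst (R x))"
    have xc: "x \<in> c" using x interior_subset by blast
    have J0: "J (R x) = cross2 ?a ?b" "0 < cross2 ?a ?b" using J[OF RS[OF xc]] by (simp_all add: J_def)
    \<comment> \<open>Again Cramer's rule, now for the coordinates of \<open>h\<close> in the basis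
      formed by the two tangent vectors.\<close>
    define R' where "R' h = (cross2 h ?b / J (R x), cross2 ?a h / J (R x))" for h
    have "linear R'"
      by (rule linearI)
         (simp_all add: R'_def cross2_def algebra_simps add_divide_distrib diff_divide_distrib)
    then have bl: "bounded_linear R'" by (simp add: linear_conv_bounded_linear)
    have dF: "(F has_derivative (\<lambda>(h, k). h *\<^sub>R ?a + k *\<^sub>R ?b)) (at (R x))"
      using bil_has_derivative unfolding F_def Fa_def Fb_def by blast
    have inv: "R' \<circ> (\<lambda>(h, k). h *\<^sub>R ?a + k *\<^sub>R ?b) = id"
      using J0 by (auto simp: R'_def fun_eq_iff cross2_add_scale)
    have "isCont R x"
      using contR x continuous_on_interior by blast
    then have dR: "(R has_derivative R') (at x)"
      using has_derivative_inverse_basic[of F "\<lambda>(h, k). h *\<^sub>R ?a + k *\<^sub>R ?b" R x R' "interior c"]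
        dF bl inv x FR interior_subset by blast
    have "(bil \<alpha> \<beta> \<gamma> \<delta> has_derivative (\<lambda>(h, k). h *\<^sub>R Ba (snd (R x)) + k *\<^sub>R Bb (fst (R x)))) (at (R x))"
      using bil_has_derivative unfolding Ba_def Bb_def by blast
    from has_derivative_compose[OF dR this]
    have "((\<lambda>x. bil \<alpha> \<beta> \<gamma> \<delta> (R x)) has_derivative
        (\<lambda>h. fst (R' h) * Ba (snd (R x)) + snd (R' h) * Bb (fst (R x)))) (at x)"
      by (simp add: case_prod_beta)
    moreover have "(\<lambda>h. fst (R' h) * Ba (snd (R x)) + snd (R' h) * Bb (fst (R x))) = (\<lambda>h. g (R x) \<bullet> h)"
      using J0 by (auto simp: R'_def inner_real2 g12 cross2_def field_simps)
    ultimately have "((\<lambda>x. bil \<alpha> \<beta> \<gamma> \<delta> (R x)) has_derivative (\<lambda>h. g (R x) \<bullet> h)) (at x)" by simp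
    moreover have "bil \<alpha> \<beta> \<gamma> \<delta> (R y) = v y" if "y \<in> interior c" for y
      using v[OF RS] FR that interior_subset unfolding F_def by (metis subsetD)
    ultimately show ?thesis
      using has_derivative_transform_within_open[OF _ open_interior x] by blast
  qed
  ultimately show ?thesis by blast
qed

section \<open>Independence of the vertex labelling\<close>

definition bilinear_rep :: "(real^2 \<Rightarrow> real) \<Rightarrow> real^2 \<Rightarrow> real^2 \<Rightarrow> real^2 \<Rightarrow> real^2 \<Rightarrow> bool" where
  "bilinear_rep v p q r s \<longleftrightarrow> (\<exists>\<alpha> \<beta> \<gamma> \<delta>. \<forall>z\<in>unit_square. v (bil p q r s z) = bil \<alpha> \<beta> \<gamma> \<delta> z)"

lemma bilinear_elem_iff:
  "bilinear_elem c v \<longleftrightarrow> (\<exists>p q r s. quadrilateral c p q r s \<and> bilinear_rep v p q r s)"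
  unfolding bilinear_elem_def bilinear_rep_def bil_def by (simp add: Ball_def) blast

lemma bilinear_rep_rotate:
  assumes "bilinear_rep v p q r s"
  shows "bilinear_rep v q r s p"
proof -
  obtain \<alpha> \<beta> \<gamma> \<delta> where v: "\<And>z. z \<in> unit_square \<Longrightarrow> v (bil p q r s z) = bil \<alpha> \<beta> \<gamma> \<delta> z"
    using assms by (auto simp: bilinear_rep_def)
  \<comment> \<open>A quarter turn of the unit square carries one labelling into the next.\<close>
  have e: "bil x1 x2 x3 x4 (a, b) = bil x4 x1 x2 x3 (1 - b, a)"
    for x1 x2 x3 x4 :: "'v::real_vector" and a b
    by (simp add: bil_def algebra_simps)
  have "v (bil q r s p (a, b)) = bil \<beta> \<gamma> \<delta> \<alpha> (a, b)" if "(a, b) \<in> unit_square" for a b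
    using v[of "(1 - b, a)"] that e[of q r s p a b] e[of \<beta> \<gamma> \<delta> \<alpha> a b] by simp
  then show ?thesis unfolding bilinear_rep_def by (metis surj_pair)
qed

lemma bilinear_rep_flip:
  assumes "bilinear_rep v p q r s"
  shows "bilinear_rep v p s r q"
proof -
  obtain \<alpha> \<beta> \<gamma> \<delta> where v: "\<And>z. z \<in> unit_square \<Longrightarrow> v (bil p q r s z) = bil \<alpha> \<beta> \<gamma> \<delta> z"
    using assms by (auto simp: bilinear_rep_def)
  have "v (bil p s r q (a, b)) = bil \<alpha> \<delta> \<gamma> \<beta> (a, b)" if "(a, b) \<in> unit_square" for a b
    using v[of "(b, a)"] that bil_flip[of p s r q a b] bil_flip[of \<alpha> \<delta> \<gamma> \<beta> a b] by auto
  then show ?thesis unfolding bilinear_rep_def by (metis surj_pair)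
qed

lemma bilinear_rep_lincomb:
  assumes "bilinear_rep v p q r s" "bilinear_rep w p q r s"
  shows "bilinear_rep (\<lambda>x. \<alpha> * v x + \<beta> * w x) p q r s"
proof -
  obtain a b c d where 1: "\<forall>z\<in>unit_square. v (bil p q r s z) = bil a b c d z"
    using assms(1) by (auto simp: bilinear_rep_def)
  obtain a' b' c' d' where 2: "\<forall>z\<in>unit_square. w (bil p q r s z) = bil a' b' c' d' z"
    using assms(2) by (auto simp: bilinear_rep_def)
  have "\<forall>z\<in>unit_square. \<alpha> * v (bil p q r s z) + \<beta> * w (bil p q r s z) = 
     bil (\<alpha> * a + \<beta> * a') (\<alpha> * b + \<beta> * b') (\<alpha> * c + \<beta> * c') (\<alpha> * d + \<beta> * d') z"
    using 1 2 bil_lincomb by metis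
  then show ?thesis unfolding bilinear_rep_def by blast
qed

lemma quadrilateral_rotate: "quadrilateral c p q r s \<Longrightarrow> quadrilateral c q r s p"
proof -
  have e: "{q, r, s, p} = {p, q, r, s}" by blast
  show "quadrilateral c p q r s \<Longrightarrow> quadrilateral c q r s p"
    unfolding quadrilateral_def e by blast
qed

lemma quadrilateral_flip: "quadrilateral c p q r s \<Longrightarrow> quadrilateral c p s r q"
proof -
  have e: "{p, s, r, q} = {p, q, r, s}" by blast
  show "quadrilateral c p q r s \<Longrightarrow> quadrilateral c p s r q"
    unfolding quadrilateral_def e
    using closed_segment_commute[of p s] closed_segment_commute[of s r]
      closed_segment_commute[of r q] closed_segment_commute[of q p] by metis
qed

text \<open>If the diagonal were a face, \<open>q\<close> and \<open>s\<close> would lie on the same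
  side of it. The equally oriented triangles \<open>p q r\<close> and \<open>r s p\<close> put them
  on opposite sides.\<close>

lemma diagonal_not_face:
  assumes Q: "quadrilateral c p q r s"
  shows "\<not> closed_segment p r face_of c"
proof
  assume f: "closed_segment p r face_of c"
  note d = quadrilateral_distinct[OF Q]
  have ex: "q extreme_point_of c" "s extreme_point_of c"
    using quadrilateral_extreme_points[OF Q] by auto
  have "0 < area p r q * area p r s"
    by (rule face_segment_same_side[OF quadrilateral_polytope[OF Q] f]) (use d ex in auto)
  moreover have "area p r q = - area p q r" "area p r s = area r s p"
      "area p s r = - area r s p" "area r q p = - area p q r"
    by (simp_all add: area_def cross2_def algebra_simps)
  ultimately have "area p q r * area r s p < 0" by simp
  moreover have "0 < area p q r * area r s p"
    using quadrilateral_ccw[OF Q] \<open>area p s r = - area r s p\<close> \<open>area r q p = - area p q r\<close>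
    by (auto simp: ccw_quad_def mult_neg_neg)
  ultimately show False by simp
qed

text \<open>Needed because two functions may satisfy \<open>bilinear_elem\<close> with different
  labellings and can only be added in a common one. Rotations make the first vertices agree. The
  neighbours of that vertex span sides with it, and a diagonal is not a face, so the opposite
  vertices agree too; the other two are then equal or swapped, and a flip handles the swap.\<close>

lemma bilinear_rep_relabel:
  assumes Q: "quadrilateral c p q r s" and Q': "quadrilateral c p' q' r' s'"
    and v: "bilinear_rep v p q r s"
  shows "bilinear_rep v p' q' r' s'"
proof -
  have *: "bilinear_rep v p' q' r' s'"
    if Q: "quadrilateral c p' q r s" and v: "bilinear_rep v p' q r s" for q r s
  proof -
    note d = quadrilateral_distinct[OF Q] quadrilateral_distinct[OF Q']
    have S: "{p', q, r, s} = {p', q', r', s'}"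
      using quadrilateral_extreme_points[OF Q] quadrilateral_extreme_points[OF Q'] by simp
    have "closed_segment p' q' face_of c" "closed_segment p' s' face_of c"
      using Q' by (auto simp: quadrilateral_def closed_segment_commute dest: facet_of_imp_face_of)
    then have "q' \<noteq> r" "s' \<noteq> r" using diagonal_not_face[OF Q] by auto
    moreover have "r \<in> {p', q', r', s'}" "q' \<in> {p', q, r, s}" "s' \<in> {p', q, r, s}"
      using S by blast+
    ultimately have "r' = r \<and> (q' = q \<and> s' = s \<or> q' = s \<and> s' = q)"
      using d by auto
    then show ?thesis using v bilinear_rep_flip by auto
  qed
  have "p' \<in> {p, q, r, s}"
    using quadrilateral_extreme_points[OF Q] quadrilateral_extreme_points[OF Q'] by blast
  then consider "p' = p" | "p' = q" | "p' = r" | "p' = s" by blast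
  then show ?thesis
  proof cases
    case 1 then show ?thesis using * Q v by blast
  next
    case 2 then show ?thesis using * Q v quadrilateral_rotate bilinear_rep_rotate by blast
  next
    case 3
    have "quadrilateral c r s p q" "bilinear_rep v r s p q"
      using Q v by (simp_all add: quadrilateral_rotate bilinear_rep_rotate)
    then show ?thesis using * 3 by simp
  next
    case 4
    have "quadrilateral c s p q r" "bilinear_rep v s p q r"
      using Q v by (simp_all add: quadrilateral_rotate bilinear_rep_rotate)
    then show ?thesis using * 4 by simp
  qed
qed

lemma bilinear_elem_lincomb:
  assumes "bilinear_elem c v" "bilinear_elem c w"
  shows "bilinear_elem c (\<lambda>x. \<alpha> * v x + \<beta> * w x)"
  using assms bilinear_rep_relabel bilinear_rep_lincomb unfolding bilinear_elem_iff by metis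

lemma bilinear_elem_zero:
  assumes "quadrilateral c p q r s"
  shows "bilinear_elem c (\<lambda>x. 0)"
proof -
  have "\<forall>z\<in>unit_square. (0::real) = bil 0 0 0 0 z" by (auto simp: bil_def)
  then show ?thesis using assms unfolding bilinear_elem_iff bilinear_rep_def by blast
qed

lemma bilinear_elem_C1:
  assumes "bilinear_elem c v"
  shows "\<exists>G. continuous_on c G \<and> (\<forall>x\<in>interior c. (v has_derivative (\<lambda>h. G x \<bullet> h)) (at x))"
proof -
  have *: ?thesis if Q: "ccw_quad p q r s" "c = convex hull {p, q, r, s}" and v: "bilinear_rep v p q r s"
    for p q r s
    using ccw_quad_C1[OF Q] v unfolding bilinear_rep_def by blast
  obtain p q r s where Q: "quadrilateral c p q r s" and v: "bilinear_rep v p q r s"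
    using assms by (auto simp: bilinear_elem_iff)
  have "c = convex hull {p, q, r, s}" "c = convex hull {p, s, r, q}"
    using Q quadrilateral_flip[OF Q] by (simp_all add: quadrilateral_def)
  then show ?thesis
    using quadrilateral_ccw[OF Q] * v bilinear_rep_flip by blast
qed

section \<open>Fine cells inside a coarse element\<close>

lemma fe_partition_elem:
  assumes "fe_partition \<Omega> \<T>" "K \<in> \<T>"
  shows "polytope K" "interior K \<noteq> {}" "interior K \<subseteq> \<Omega>" "convex K" "compact K" "closed K"
    "closure (interior K) = K"
proof -
  show 1: "polytope K" "interior K \<noteq> {}" "interior K \<subseteq> \<Omega>"
    using assms by (auto simp: fe_partition_def)
  show 2: "convex K" "compact K" "closed K"
    using 1(1) by (auto intro: polytope_imp_convex polytope_imp_compact polytope_imp_closed)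
  show "closure (interior K) = K"
    using convex_closure_interior[OF 2(1) 1(2)] 2(3) by simp
qed

text \<open>The intersection is a face of \<open>K'\<close> that contains an interior point of
  \<open>K'\<close>, so it is all of \<open>K'\<close>. Then \<open>x\<close> is interior to
  \<open>K\<close> as well, and the same argument applies with the roles exchanged.\<close>

lemma fe_partition_interior_disjoint:
  assumes T: "fe_partition \<Omega> \<T>" "K \<in> \<T>" "K' \<in> \<T>" "x \<in> K" "x \<in> interior K'"
  shows "K = K'"
proof -
  have f: "(K \<inter> K') face_of K" "(K \<inter> K') face_of K'" using T by (auto simp: fe_partition_def)
  have "x \<in> K'" using T(5) interior_subset by blast
  then have eq: "K \<inter> K' = K'" using face_of_disjoint_interior[OF f(2)] T(4,5) by blast
  then have "x \<in> interior K" using T(5) interior_mono[of K' K] by blast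
  then have "K \<inter> K' = K" using face_of_disjoint_interior[OF f(1)] \<open>x \<in> K'\<close> T(4) by blast
  then show ?thesis using eq by simp
qed

text \<open>A fine cell through an interior point of \<open>K\<close> lies in some coarse element,
  which can only be \<open>K\<close>. The boundary follows by closure, since a finite union of
  closed cells is closed and \<open>K\<close> is the closure of its interior.\<close>

lemma fine_cells_cover:
  assumes H: "fe_partition \<Omega> \<T>H" and h: "fine_grid \<Omega> \<T>H \<T>h" and K: "K \<in> \<T>H"
  shows "K = \<Union>{c\<in>\<T>h. c \<subseteq> K}"
proof
  have hp: "fe_partition \<Omega> \<T>h" using h by (simp add: fine_grid_def)
  have "closed (\<Union>{c\<in>\<T>h. c \<subseteq> K})"
    using hp fe_partition_elem(6)[OF hp] by (auto simp: fe_partition_def)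
  moreover have "interior K \<subseteq> \<Union>{c\<in>\<T>h. c \<subseteq> K}"
  proof
    fix x assume x: "x \<in> interior K"
    then have "x \<in> \<Union>\<T>h"
      using hp fe_partition_elem(3)[OF H K] closure_subset by (auto simp: fe_partition_def)
    then obtain c K' where "c \<in> \<T>h" "x \<in> c" "K' \<in> \<T>H" "c \<subseteq> K'"
      using h by (auto simp: fine_grid_def)
    moreover from this have "K' = K" using fe_partition_interior_disjoint[OF H _ K _ x] by blast
    ultimately show "x \<in> \<Union>{c\<in>\<T>h. c \<subseteq> K}" by blast
  qed
  ultimately have "closure (interior K) \<subseteq> \<Union>{c\<in>\<T>h. c \<subseteq> K}"
    by (rule closure_minimal[rotated])
  then show "K \<subseteq> \<Union>{c\<in>\<T>h. c \<subseteq> K}" using fe_partition_elem(7)[OF H K] by simp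
qed auto

lemma negligible_fine_skeleton:
  assumes H: "fe_partition \<Omega> \<T>H" and h: "fine_grid \<Omega> \<T>H \<T>h" and K: "K \<in> \<T>H"
  shows "negligible (K - \<Union>(interior ` {c\<in>\<T>h. c \<subseteq> K}))"
proof -
  have hp: "fe_partition \<Omega> \<T>h" using h by (simp add: fine_grid_def)
  have "K - \<Union>(interior ` {c\<in>\<T>h. c \<subseteq> K}) \<subseteq> (\<Union>c\<in>{c\<in>\<T>h. c \<subseteq> K}. frontier c)"
  proof
    fix x assume x: "x \<in> K - \<Union>(interior ` {c\<in>\<T>h. c \<subseteq> K})"
    then obtain c where c: "c \<in> \<T>h" "c \<subseteq> K" "x \<in> c" using fine_cells_cover[OF H h K] by blast
    then have "x \<in> frontier c" using x closure_subset by (auto simp: frontier_def)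
    then show "x \<in> (\<Union>c\<in>{c\<in>\<T>h. c \<subseteq> K}. frontier c)" using c by blast
  qed
  moreover have "negligible (\<Union>c\<in>{c\<in>\<T>h. c \<subseteq> K}. frontier c)"
    using hp fe_partition_elem(4)[OF hp] negligible_convex_frontier
    by (intro negligible_Union) (auto simp: fe_partition_def)
  ultimately show ?thesis by (rule negligible_subset[rotated])
qed

text \<open>From the midpoint \<open>z\<close> of the shared segment, move a little towards
  \<open>w\<close> in \<open>c\<close> and towards \<open>w'\<close> in \<open>c'\<close>. Scaling
  by \<open>\<beta>\<close> makes the components normal to the segment equal, so the two moves
  differ by a vector along the segment. That difference is compensated by starting in
  \<open>c'\<close> from a shifted point \<open>z'\<close> of the same segment.\<close>

lemma convex_sharing_boundary_segment:
  fixes a :: "real^2"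
  assumes "convex c" "convex c'" "w \<in> interior c" "w' \<in> interior c'" "x \<noteq> y"
    and m: "x \<in> c" "x \<in> c'" "y \<in> c" "y \<in> c'"
    and ab: "a \<bullet> x = b" "a \<bullet> y = b" "a \<bullet> w < b" "a \<bullet> w' < b"
  shows "interior c \<inter> interior c' \<noteq> {}"
proof -
  define z where "z = (1/2) *\<^sub>R x + (1/2) *\<^sub>R y"
  define \<beta> where "\<beta> = (a \<bullet> (w - z)) / (a \<bullet> (w' - z))"
  define u where "u = w - z - \<beta> *\<^sub>R (w' - z)"
  have az: "a \<bullet> z = b" using ab by (simp add: z_def inner_add_right)
  have neg: "a \<bullet> (w - z) < 0" "a \<bullet> (w' - z) < 0" using ab az by (simp_all add: inner_diff_right)
  then have "0 < \<beta>" by (simp add: \<beta>_def divide_neg_neg)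
  have "a \<bullet> u = 0"
    using neg by (simp only: u_def inner_diff_right[of a "w - z"]) (simp add: \<beta>_def)
  moreover have "a \<bullet> (y - x) = 0" "y - x \<noteq> 0" using ab assms(5) by (simp_all add: inner_diff_right)
  then obtain k where k: "\<And>h. a \<bullet> h = k * cross2 (y - x) h"
    using orthogonal_real2 by blast
  moreover have "k \<noteq> 0" using k neg by force
  ultimately have "cross2 (y - x) u = 0" by auto
  then obtain \<alpha> where \<alpha>: "u = \<alpha> *\<^sub>R (y - x)"
    using cross2_eq_0_imp_parallel \<open>y - x \<noteq> 0\<close> by blast
  \<comment> \<open>Small enough for two purposes: \<open>\<epsilon> * \<beta> < 1\<close>, so that
    the second move stops before \<open>w'\<close>, and \<open>2 * \<epsilon> * \<bar>\<alpha>\<bar>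
    \<le> 1 - \<epsilon> * \<beta>\<close>, so that the shift stays within the segment.\<close>
  define \<epsilon> where "\<epsilon> = 1 / (1 + \<beta> + 2 * \<bar>\<alpha>\<bar>)"
  have \<epsilon>: "0 < \<epsilon>" "\<epsilon> \<le> 1" using \<open>0 < \<beta>\<close> by (simp_all add: \<epsilon>_def add_pos_nonneg)
  have \<epsilon>1: "\<epsilon> + \<epsilon> * \<beta> + 2 * (\<epsilon> * \<bar>\<alpha>\<bar>) = 1"
  proof -
    have "\<epsilon> * (1 + \<beta> + 2 * \<bar>\<alpha>\<bar>) = 1" using \<open>0 < \<beta>\<close> unfolding \<epsilon>_def by (simp add: add_pos_nonneg)
    then show ?thesis by (simp add: algebra_simps)
  qed
  have pos: "0 < \<epsilon> * \<beta>" "0 \<le> \<epsilon> * \<bar>\<alpha>\<bar>" using \<epsilon> \<open>0 < \<beta>\<close> by simp_all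
  then have lt: "\<epsilon> * \<beta> < 1" using \<epsilon> \<epsilon>1 by linarith
  \<comment> \<open>The shift along the segment. Moving towards \<open>w'\<close> shrinks it by
    \<open>1 - \<epsilon> * \<beta>\<close>, and what remains has to equal the tangential offset
    \<open>\<epsilon> * \<alpha>\<close>.\<close>
  define \<theta> where "\<theta> = \<epsilon> * \<alpha> / (1 - \<epsilon> * \<beta>)"
  have aux: "A \<le> 1/2 * (1 - B)" if "e + B + 2 * A = 1" "0 < e" for A B e :: real
    using that by (simp add: field_simps)
  have "\<bar>\<theta>\<bar> = \<epsilon> * \<bar>\<alpha>\<bar> / (1 - \<epsilon> * \<beta>)" using lt \<epsilon> by (simp add: \<theta>_def abs_mult)
  also have "\<dots> \<le> 1/2" using lt aux[OF \<epsilon>1 \<epsilon>(1)] by (subst pos_divide_le_eq) simp_all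
  finally have \<theta>: "\<bar>\<theta>\<bar> \<le> 1/2" .
  define z' where "z' = (1/2 - \<theta>) *\<^sub>R x + (1/2 + \<theta>) *\<^sub>R y"
  have zc: "z \<in> c" unfolding z_def using m by (intro convexD[OF assms(1)]) auto
  have zc': "z' \<in> c'" unfolding z'_def using m \<theta> by (intro convexD[OF assms(2)]) auto
  have "z - \<epsilon> *\<^sub>R (z - w) \<in> interior c"
    by (rule mem_interior_convex_shrink) (use assms zc \<epsilon> in auto)
  moreover have "z' - (\<epsilon> * \<beta>) *\<^sub>R (z' - w') \<in> interior c'"
    by (rule mem_interior_convex_shrink) (use assms zc' lt pos in auto)
  moreover have "z - \<epsilon> *\<^sub>R (z - w) = z' - (\<epsilon> * \<beta>) *\<^sub>R (z' - w')"
  proof -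
    have w: "w = z + \<alpha> *\<^sub>R (y - x) + \<beta> *\<^sub>R (w' - z)" using \<alpha> by (simp add: u_def algebra_simps)
    have "\<theta> * (1 - \<epsilon> * \<beta>) = \<epsilon> * \<alpha>" using lt by (simp add: \<theta>_def)
    then have th: "(1 - \<epsilon> * \<beta>) *\<^sub>R (\<theta> *\<^sub>R (y - x)) = (\<epsilon> * \<alpha>) *\<^sub>R (y - x)" by (simp add: mult.commute)
    have z': "z' = z + \<theta> *\<^sub>R (y - x)" by (simp add: z_def z'_def algebra_simps)
    have "z' - (\<epsilon> * \<beta>) *\<^sub>R (z' - w') = (1 - \<epsilon> * \<beta>) *\<^sub>R z + (1 - \<epsilon> * \<beta>) *\<^sub>R (\<theta> *\<^sub>R (y - x)) + (\<epsilon> * \<beta>) *\<^sub>R w'"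
      unfolding z' by (simp add: algebra_simps)
    also have "\<dots> = z - \<epsilon> *\<^sub>R (z - w)"
      unfolding th w by (simp add: algebra_simps)
    finally show ?thesis by simp
  qed
  ultimately show ?thesis by auto
qed

section \<open>Parametrized coarse edges and the fine cells along them\<close>

lemma facet_eq_segment:
  fixes K :: "(real^2) set"
  assumes "polytope K" "interior K \<noteq> {}" "E facet_of K"
  shows "\<exists>x y. x \<noteq> y \<and> E = closed_segment x y"
proof -
  have "aff_dim E = 1"
    using assms aff_dim_nonempty_interior[of K] by (simp add: facet_of_def)
  moreover have "polytope E"
    using assms face_of_polytope_polytope by (auto simp: facet_of_def)
  moreover have "E \<noteq> {}" using assms by (simp add: facet_of_def)
  ultimately obtain x y where xy: "E = closed_segment x y"
    using compact_convex_collinear_segment[of E]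
    by (auto simp: collinear_aff_dim intro: polytope_imp_compact polytope_imp_convex)
  moreover have "x \<noteq> y" using xy \<open>aff_dim E = 1\<close> by auto
  ultimately show ?thesis by blast
qed

lemma edge_ends_segment:
  assumes "fe_partition \<Omega> \<T>" "K \<in> \<T>" "E facet_of K"
  shows "E = closed_segment (fst (edge_ends E)) (snd (edge_ends E))"
    "fst (edge_ends E) \<noteq> snd (edge_ends E)"
proof -
  obtain x y where xy: "x \<noteq> y" "E = closed_segment x y"
    using facet_eq_segment fe_partition_elem[OF assms(1,2)] assms(3) by metis
  then have "\<exists>p. case p of (a, b) \<Rightarrow> E = closed_segment a b" by auto
  then have "case edge_ends E of (a, b) \<Rightarrow> E = closed_segment a b"
    unfolding edge_ends_def by (rule someI_ex)
  then show eq: "E = closed_segment (fst (edge_ends E)) (snd (edge_ends E))"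
    by (simp add: case_prod_beta)
  show "fst (edge_ends E) \<noteq> snd (edge_ends E)"
  proof
    assume "fst (edge_ends E) = snd (edge_ends E)"
    then obtain z where "E = {z}" using eq closed_segment_idem by (metis (no_types))
    moreover have "x \<in> E" "y \<in> E" using xy(2) by auto
    ultimately show False using xy(1) by blast
  qed
qed

lemma edge_point_mem:
  assumes "fe_partition \<Omega> \<T>" "K \<in> \<T>" "E facet_of K" "t \<in> {0..1}"
  shows "edge_point E t \<in> E"
  by (subst edge_ends_segment(1)[OF assms(1-3)])
     (use assms(4) in \<open>auto simp: edge_point_def in_segment\<close>)

lemma edge_point_inj:
  assumes "fe_partition \<Omega> \<T>" "K \<in> \<T>" "E facet_of K" "edge_point E s = edge_point E t"
  shows "s = t"
proof -
  have "(s - t) *\<^sub>R (snd (edge_ends E) - fst (edge_ends E)) = edge_point E s - edge_point E t"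
    by (simp add: edge_point_def algebra_simps)
  then show ?thesis using assms(4) edge_ends_segment(2)[OF assms(1-3)] by auto
qed

lemma continuous_on_edge_point: "continuous_on S (edge_point E)"
  unfolding edge_point_def by (intro continuous_intros)

lemma facet_disjoint_interior:
  assumes "fe_partition \<Omega> \<T>" "K \<in> \<T>" "E facet_of K"
  shows "E \<inter> interior K = {}" "E \<subseteq> K"
  using assms facet_of_imp_face_of[OF assms(3)] facet_of_imp_subset[OF assms(3)] 
  by (auto simp: facet_of_def dest: face_of_disjoint_interior)

text \<open>Limits from inside the element are therefore unique, which is what lets the
  \<open>Lim\<close> in \<open>one_sided\<close> return them.\<close>

lemma facet_within_interior_nontrivial:
  assumes "fe_partition \<Omega> \<T>" "K \<in> \<T>" "E facet_of K" "x \<in> E"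
  shows "at x within interior K \<noteq> bot"
proof -
  have "x \<in> closure (interior K)" "x \<notin> interior K"
    using facet_disjoint_interior[OF assms(1-3)] assms(4) fe_partition_elem(7)[OF assms(1,2)] by auto
  then show ?thesis by (auto simp: closure_def trivial_limit_within)
qed

text \<open>Two different cells of \<open>K\<close> share at most one point of the edge: they lie on the same side of it,
  so sharing a segment would make their interiors overlap.\<close>

lemma edge_point_single_cell:
  assumes H: "fe_partition \<Omega> \<T>H" and h: "fine_grid \<Omega> \<T>H \<T>h" and K: "K \<in> \<T>H" "E facet_of K"
  shows "\<exists>N. finite N \<and> (\<forall>t\<in>{0..1} - N. \<exists>c\<in>\<T>h. c \<subseteq> K \<and> edge_point E t \<in> c \<and>
     (\<exists>U. open U \<and> edge_point E t \<in> U \<and> interior K \<inter> U = interior c \<inter> U))"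
proof -
  have hp: "fe_partition \<Omega> \<T>h" using h by (simp add: fine_grid_def)
  define P where "P = {c\<in>\<T>h. c \<subseteq> K}"
  \<comment> \<open>The exceptional parameters: edge points common to two different cells of
    \<open>K\<close>. By \<open>uniq\<close> below, each pair of cells contributes at most
    one.\<close>
  define N where "N = (\<Union>(c, c')\<in>{(c, c') \<in> P \<times> P. c \<noteq> c'}. {t\<in>{0..1}. edge_point E t \<in> c \<inter> c'})"
  have "finite P" using hp by (simp add: P_def fe_partition_def)
  have KP: "K = \<Union>P" using fine_cells_cover[OF H h K(1)] by (simp add: P_def)
  have Pc: "closed c" if "c \<in> P" for c using that fe_partition_elem(6)[OF hp] by (simp add: P_def)
  have "E exposed_face_of K"
    using facet_of_imp_face_of[OF K(2)] fe_partition_elem(1)[OF H K(1)]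
      exposed_face_of_polyhedron polytope_imp_polyhedron by blast
  then obtain a b where ab: "K \<subseteq> {x. a \<bullet> x \<le> b}" "E = K \<inter> {x. a \<bullet> x = b}"
    by (auto simp: exposed_face_of_def)
  have below: "a \<bullet> w < b" if "w \<in> interior K" for w
  proof -
    have "w \<in> K" "w \<notin> E" using that facet_disjoint_interior[OF H K] interior_subset by blast+
    then show ?thesis using ab by force
  qed
  have uniq: "s = t" if cc: "c \<in> P" "c' \<in> P" "c \<noteq> c'" and st: "s \<in> {0..1}" "t \<in> {0..1}"
    "edge_point E s \<in> c \<inter> c'" "edge_point E t \<in> c \<inter> c'" for c c' s t
  proof (rule ccontr)
    assume "s \<noteq> t"
    then have ne: "edge_point E s \<noteq> edge_point E t" using edge_point_inj[OF H K] by blast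
    have mem: "c \<in> \<T>h" "c' \<in> \<T>h" "c \<subseteq> K" "c' \<subseteq> K" using cc by (auto simp: P_def)
    obtain w w' where w: "w \<in> interior c" "w' \<in> interior c'"
      using fe_partition_elem(2)[OF hp mem(1)] fe_partition_elem(2)[OF hp mem(2)] by auto
    have "w \<in> interior K" "w' \<in> interior K" using w interior_mono[OF mem(3)] interior_mono[OF mem(4)] by auto
    moreover have "a \<bullet> edge_point E s = b" "a \<bullet> edge_point E t = b"
      using edge_point_mem[OF H K] st ab(2) by blast+
    ultimately have "interior c \<inter> interior c' \<noteq> {}"
      using st ne below w fe_partition_elem(4)[OF hp mem(1)] fe_partition_elem(4)[OF hp mem(2)]
      by (intro convex_sharing_boundary_segment[of c c' w w' "edge_point E s" "edge_point E t" a b]) auto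
    then obtain x where "x \<in> interior c" "x \<in> interior c'" by blast
    then have "c = c'"
      using fe_partition_interior_disjoint[OF hp mem(1,2), of x] interior_subset[of c] by auto
    then show False using cc by simp
  qed
  have "finite N"
    unfolding N_def
  proof (rule finite_UN_I)
    show "finite {(c, c') \<in> P \<times> P. c \<noteq> c'}"
      by (rule finite_subset[of _ "P \<times> P"]) (use \<open>finite P\<close> in auto)
    have "finite {t\<in>{0..1}. edge_point E t \<in> c \<inter> c'}" if "c \<in> P" "c' \<in> P" "c \<noteq> c'" for c c'
    proof (cases "\<exists>t\<in>{0..1}. edge_point E t \<in> c \<inter> c'")
      case True
      then obtain t where "t \<in> {0..1}" "edge_point E t \<in> c \<inter> c'" by blast
      then have "{t\<in>{0..1}. edge_point E t \<in> c \<inter> c'} \<subseteq> {t}" using uniq[OF that] by blast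
      then show ?thesis by (rule finite_subset) simp
    next
      case False
      then have "{t\<in>{0..1}. edge_point E t \<in> c \<inter> c'} = {}" by blast
      then show ?thesis by (metis finite.emptyI)
    qed
    then show "finite (case x of (c, c') \<Rightarrow> {t\<in>{0..1}. edge_point E t \<in> c \<inter> c'})"
      if "x \<in> {(c, c') \<in> P \<times> P. c \<noteq> c'}" for x using that by auto
  qed
  moreover have "\<exists>c\<in>\<T>h. c \<subseteq> K \<and> edge_point E t \<in> c \<and>
     (\<exists>U. open U \<and> edge_point E t \<in> U \<and> interior K \<inter> U = interior c \<inter> U)" if t: "t \<in> {0..1} - N" for t
  proof -
    have "edge_point E t \<in> K"
      using edge_point_mem[OF H K] facet_disjoint_interior(2)[OF H K] t by blast
    then obtain c where c: "c \<in> P" "edge_point E t \<in> c" using KP by blast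
    \<comment> \<open>Removing the finitely many other closed cells leaves a neighbourhood of the
      edge point in which \<open>K\<close> consists of \<open>c\<close> alone.\<close>
    define U where "U = - \<Union>(P - {c})"
    have "open U" unfolding U_def using \<open>finite P\<close> Pc by (intro open_Compl closed_Union) auto
    moreover have "edge_point E t \<in> U" using t c unfolding U_def N_def by auto
    moreover have "interior K \<inter> U = interior c \<inter> U"
    proof
      have "interior K \<inter> U \<subseteq> c" using interior_subset[of K] KP unfolding U_def by blast
      then have "interior K \<inter> U \<subseteq> interior c" using \<open>open U\<close> by (intro interior_maximal) auto
      then show "interior K \<inter> U \<subseteq> interior c \<inter> U" by blast
      show "interior c \<inter> U \<subseteq> interior K \<inter> U"
        using c(1) interior_mono[of c K] by (auto simp: P_def)
    qed
    ultimately show ?thesis using c by (auto simp: P_def)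
  qed
  ultimately show ?thesis by blast
qed

section \<open>Piecewise smooth functions on a coarse element\<close>

text \<open>Only interior values of \<open>v\<close> enter, because on coarse edges a function of
  \<open>Vh\<close> mixes several summands. The continuous functions \<open>g\<close> on
  \<open>K\<close> and \<open>G\<close> on the closed cells supply the boundary limits of
  \<open>v\<close> and of its gradient.\<close>

definition pw_smooth :: "(real^2) set set \<Rightarrow> (real^2) set \<Rightarrow> (real^2 \<Rightarrow> real) \<Rightarrow> bool" where
  "pw_smooth \<T>h K v \<longleftrightarrow>
     (\<exists>g. continuous_on K g \<and> (\<forall>x\<in>interior K. v x = g x)) \<and>
     (\<forall>c\<in>\<T>h. c \<subseteq> K \<longrightarrow>
        (\<exists>G. continuous_on c G \<and> (\<forall>x\<in>interior c. (v has_derivative (\<lambda>h. G x \<bullet> h)) (at x))))"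

lemma pw_smooth_lincomb:
  assumes v: "pw_smooth \<T>h K v" and w: "pw_smooth \<T>h K w"
  shows "pw_smooth \<T>h K (\<lambda>x. \<alpha> * v x + \<beta> * w x)"
  unfolding pw_smooth_def
proof (intro conjI ballI impI)
  obtain g g' where "continuous_on K g" "\<forall>x\<in>interior K. v x = g x"
      "continuous_on K g'" "\<forall>x\<in>interior K. w x = g' x"
    using v w unfolding pw_smooth_def by blast
  then have "continuous_on K (\<lambda>x. \<alpha> * g x + \<beta> * g' x) \<and>
      (\<forall>x\<in>interior K. \<alpha> * v x + \<beta> * w x = \<alpha> * g x + \<beta> * g' x)"
    by (auto intro!: continuous_intros)
  then show "\<exists>g. continuous_on K g \<and> (\<forall>x\<in>interior K. \<alpha> * v x + \<beta> * w x = g x)" by blast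
next
  fix c assume c: "c \<in> \<T>h" "c \<subseteq> K"
  obtain G where G: "continuous_on c G" "\<forall>x\<in>interior c. (v has_derivative (\<lambda>h. G x \<bullet> h)) (at x)"
    using v c unfolding pw_smooth_def by blast
  obtain G' where G': "continuous_on c G'" "\<forall>x\<in>interior c. (w has_derivative (\<lambda>h. G' x \<bullet> h)) (at x)"
    using w c unfolding pw_smooth_def by blast
  have "continuous_on c (\<lambda>x. \<alpha> *\<^sub>R G x + \<beta> *\<^sub>R G' x)"
    using G(1) G'(1) by (intro continuous_intros)
  moreover have "((\<lambda>x. \<alpha> * v x + \<beta> * w x) has_derivative (\<lambda>h. (\<alpha> *\<^sub>R G x + \<beta> *\<^sub>R G' x) \<bullet> h)) (at x)"
    if "x \<in> interior c" for x
  proof -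
    have "((\<lambda>x. \<alpha> * v x + \<beta> * w x) has_derivative (\<lambda>h. \<alpha> * (G x \<bullet> h) + \<beta> * (G' x \<bullet> h))) (at x)"
      using G(2) G'(2) that by (auto intro!: derivative_intros)
    then show ?thesis by (simp add: inner_add_left)
  qed
  ultimately show "\<exists>G. continuous_on c G \<and>
      (\<forall>x\<in>interior c. ((\<lambda>x. \<alpha> * v x + \<beta> * w x) has_derivative (\<lambda>h. G x \<bullet> h)) (at x))" by blast
qed

lemma grad_eqI: "(v has_derivative (\<lambda>h. g \<bullet> h)) (at x) \<Longrightarrow> grad v x = g"
  using frechet_derivative_at[of v "\<lambda>h. g \<bullet> h" x, symmetric]
  by (simp add: grad_def vec_eq_iff inner_axis)

lemma pw_smooth_gradient:
  assumes "pw_smooth \<T>h K v" "c \<in> \<T>h" "c \<subseteq> K"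
  shows "\<exists>G. continuous_on c G \<and> (\<forall>x\<in>interior c. grad v x = G x \<and> (v has_derivative (\<lambda>h. G x \<bullet> h)) (at x))"
proof -
  obtain G where G: "continuous_on c G" "\<forall>x\<in>interior c. (v has_derivative (\<lambda>h. G x \<bullet> h)) (at x)"
    using assms unfolding pw_smooth_def by blast
  then have "\<forall>x\<in>interior c. grad v x = G x" by (auto intro: grad_eqI)
  then show ?thesis using G by auto
qed

lemma grad_lincomb:
  assumes "pw_smooth \<T>h K v" "pw_smooth \<T>h K w" "c \<in> \<T>h" "c \<subseteq> K" "x \<in> interior c"
  shows "grad (\<lambda>x. \<alpha> * v x + \<beta> * w x) x = \<alpha> *\<^sub>R grad v x + \<beta> *\<^sub>R grad w x"
proof -
  obtain G where G: "grad v x = G x" "(v has_derivative (\<lambda>h. G x \<bullet> h)) (at x)"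
    using pw_smooth_gradient[OF assms(1,3,4)] assms(5) by blast
  obtain G' where G': "grad w x = G' x" "(w has_derivative (\<lambda>h. G' x \<bullet> h)) (at x)"
    using pw_smooth_gradient[OF assms(2,3,4)] assms(5) by blast
  have "((\<lambda>x. \<alpha> * v x + \<beta> * w x) has_derivative (\<lambda>h. \<alpha> * (G x \<bullet> h) + \<beta> * (G' x \<bullet> h))) (at x)"
    using G(2) G'(2) by (auto intro!: derivative_intros)
  then have "((\<lambda>x. \<alpha> * v x + \<beta> * w x) has_derivative (\<lambda>h. (\<alpha> *\<^sub>R G x + \<beta> *\<^sub>R G' x) \<bullet> h)) (at x)"
    by (simp add: inner_add_left)
  from grad_eqI[OF this] show ?thesis by (simp add: G(1) G'(1))
qed

section \<open>Finite element functions, linear combinations and spans\<close>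

lemma Vh_eq_on_interior:
  assumes H: "fe_partition \<Omega> \<T>H" and w: "\<forall>K\<in>\<T>H. w K \<in> Vh_elem \<T>h K"
    and K: "K \<in> \<T>H" "x \<in> interior K"
  shows "(\<Sum>K\<in>\<T>H. w K x) = w K x"
proof -
  have "finite \<T>H" using H by (simp add: fe_partition_def)
  moreover have "w K' x = 0" if K': "K' \<in> \<T>H - {K}" for K'
  proof -
    have "x \<notin> K'" using fe_partition_interior_disjoint[OF H _ K(1) _ K(2), of K'] K' by auto
    then show ?thesis using w K' by (auto simp: Vh_elem_def)
  qed
  ultimately show ?thesis using K(1) by (simp add: sum.remove[of \<T>H K])
qed

lemma Vh_pw_smooth:
  assumes H: "fe_partition \<Omega> \<T>H" and v: "v \<in> Vh \<T>h \<T>H" and K: "K \<in> \<T>H"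
  shows "pw_smooth \<T>h K v"
proof -
  obtain w where w: "\<forall>K\<in>\<T>H. w K \<in> Vh_elem \<T>h K" and ve: "v = (\<lambda>x. \<Sum>K\<in>\<T>H. w K x)"
    using v unfolding Vh_def by blast
  have eq: "w K x = v x" if "x \<in> interior K" for x
    unfolding ve using Vh_eq_on_interior[OF H w K that] by simp
  have wK: "continuous_on K (w K)" "\<And>c. c \<in> \<T>h \<Longrightarrow> c \<subseteq> K \<Longrightarrow> bilinear_elem c (w K)"
    using w K unfolding Vh_elem_def by blast+
  have "\<exists>G. continuous_on c G \<and> (\<forall>x\<in>interior c. (v has_derivative (\<lambda>h. G x \<bullet> h)) (at x))"
    if c: "c \<in> \<T>h" "c \<subseteq> K" for c
  proof -
    obtain G where G: "continuous_on c G" "\<forall>x\<in>interior c. (w K has_derivative (\<lambda>h. G x \<bullet> h)) (at x)"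
      using bilinear_elem_C1[OF wK(2)[OF c]] by blast
    have "(v has_derivative (\<lambda>h. G x \<bullet> h)) (at x)" if x: "x \<in> interior c" for x
      by (rule has_derivative_transform_within_open[OF G(2)[rule_format, OF x] open_interior x])
         (use eq interior_mono[OF c(2)] in blast)
    then show ?thesis using G(1) by blast
  qed
  moreover have "\<forall>x\<in>interior K. v x = w K x" using eq by simp
  ultimately show ?thesis unfolding pw_smooth_def using wK(1) by blast
qed

lemma Vh_elem_lincomb:
  assumes "v \<in> Vh_elem \<T>h K" "w \<in> Vh_elem \<T>h K"
  shows "(\<lambda>x. \<alpha> * v x + \<beta> * w x) \<in> Vh_elem \<T>h K"
  using assms bilinear_elem_lincomb unfolding Vh_elem_def
  by (auto intro!: continuous_intros)

lemma Vh_lincomb: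
  assumes "v \<in> Vh \<T>h \<S>" "w \<in> Vh \<T>h \<S>"
  shows "(\<lambda>x. \<alpha> * v x + \<beta> * w x) \<in> Vh \<T>h \<S>"
proof -
  obtain p where p: "\<forall>K\<in>\<S>. p K \<in> Vh_elem \<T>h K" and v: "v = (\<lambda>x. \<Sum>K\<in>\<S>. p K x)"
    using assms(1) unfolding Vh_def by blast
  obtain q where q: "\<forall>K\<in>\<S>. q K \<in> Vh_elem \<T>h K" and w: "w = (\<lambda>x. \<Sum>K\<in>\<S>. q K x)"
    using assms(2) unfolding Vh_def by blast
  define r where "r K = (\<lambda>x. \<alpha> * p K x + \<beta> * q K x)" for K
  have "\<forall>K\<in>\<S>. r K \<in> Vh_elem \<T>h K" using p q unfolding r_def by (blast intro: Vh_elem_lincomb)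
  moreover have "(\<lambda>x. \<alpha> * v x + \<beta> * w x) = (\<lambda>x. \<Sum>K\<in>\<S>. r K x)"
    by (simp add: v w r_def sum.distrib sum_distrib_left)
  ultimately show ?thesis unfolding Vh_def by blast
qed

lemma zero_in_Vh_elem:
  assumes "fine_grid \<Omega> \<T>H \<T>h"
  shows "(\<lambda>x. 0) \<in> Vh_elem \<T>h K"
proof -
  have "bilinear_elem c (\<lambda>x. 0)" if "c \<in> \<T>h" for c
  proof -
    have "\<exists>p q r s. quadrilateral c p q r s" using assms that by (simp add: fine_grid_def)
    then show ?thesis using bilinear_elem_zero by auto
  qed
  then show ?thesis by (simp add: Vh_elem_def)
qed

text \<open>Zero summands are added on the missing elements. This brings the minimizers, which live
  on patches, into the space on which \<open>a_DG\<close> is coercive.\<close>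

lemma Vh_mono:
  assumes h: "fine_grid \<Omega> \<T>H \<T>h" and S: "\<S> \<subseteq> \<T>" "finite \<T>"
  shows "Vh \<T>h \<S> \<subseteq> Vh \<T>h \<T>"
proof
  fix v assume "v \<in> Vh \<T>h \<S>"
  then obtain p where p: "\<forall>K\<in>\<S>. p K \<in> Vh_elem \<T>h K" and v: "v = (\<lambda>x. \<Sum>K\<in>\<S>. p K x)"
    unfolding Vh_def by blast
  define q where "q K = (if K \<in> \<S> then p K else (\<lambda>x. 0))" for K
  have "\<forall>K\<in>\<T>. q K \<in> Vh_elem \<T>h K" using p zero_in_Vh_elem[OF h] by (simp add: q_def)
  moreover have "v = (\<lambda>x. \<Sum>K\<in>\<T>. q K x)"
  proof
    fix x
    have "(\<Sum>K\<in>\<T>. q K x) = (\<Sum>K\<in>\<S>. q K x)"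
      by (rule sum.mono_neutral_right) (use S in \<open>auto simp: q_def\<close>)
    then show "v x = (\<Sum>K\<in>\<T>. q K x)" by (simp add: v q_def)
  qed
  ultimately show "v \<in> Vh \<T>h \<T>" unfolding Vh_def by blast
qed

lemma patch_subset: "K \<in> \<T> \<Longrightarrow> patch \<T> K m \<subseteq> \<T>"
  by (induction m) auto

lemma lincomb_closed_sum:
  fixes g :: "'i \<Rightarrow> 'a \<Rightarrow> real"
  assumes "finite I" and V: "\<And>v w \<alpha> \<beta>. v \<in> V \<Longrightarrow> w \<in> V \<Longrightarrow> (\<lambda>x. \<alpha> * v x + \<beta> * w x) \<in> V"
    and "(\<lambda>x. 0) \<in> V" "\<And>i. i \<in> I \<Longrightarrow> g i \<in> V"
  shows "(\<lambda>x. \<Sum>i\<in>I. a i * g i x) \<in> V"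
  using assms(1,4)
proof (induction I)
  case empty
  then show ?case using assms(3) by simp
next
  case (insert i I)
  then have "(\<lambda>x. \<Sum>i\<in>I. a i * g i x) \<in> V" "g i \<in> V" by simp_all
  then have "(\<lambda>x. a i * g i x + 1 * (\<Sum>i\<in>I. a i * g i x)) \<in> V" using V by blast
  then show ?case using insert by simp
qed

text \<open>Serves twice: to place the trial space inside \<open>Vh\<close>, and to place the range
  of the projection among the essentially bounded functions.\<close>

lemma span_of_subset:
  assumes "finite \<T>H" and V: "\<And>v w \<alpha> \<beta>. v \<in> V \<Longrightarrow> w \<in> V \<Longrightarrow> (\<lambda>x. \<alpha> * v x + \<beta> * w x) \<in> V"
    and "(\<lambda>x. 0) \<in> V" and g: "\<And>K j. K \<in> \<T>H \<Longrightarrow> j \<in> {1..L K} \<Longrightarrow> g K j \<in> V"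
  shows "span_of \<T>H L g \<subseteq> V"
proof
  fix v assume "v \<in> span_of \<T>H L g"
  then obtain c where v: "v = (\<lambda>x. \<Sum>K\<in>\<T>H. \<Sum>j=1..L K. c K j * g K j x)"
    unfolding span_of_def by blast
  have "(\<lambda>x. \<Sum>j=1..L K. c K j * g K j x) \<in> V" if "K \<in> \<T>H" for K
    by (rule lincomb_closed_sum) (use V assms(3) g that in auto)
  then have "(\<lambda>x. \<Sum>K\<in>\<T>H. 1 * (\<Sum>j=1..L K. c K j * g K j x)) \<in> V"
    by (intro lincomb_closed_sum[of \<T>H V "\<lambda>K x. \<Sum>j=1..L K. c K j * g K j x" "\<lambda>_. 1"])
       (use V assms in auto)
  then show "v \<in> V" by (simp add: v)
qed

lemma span_of_lincomb:
  assumes "v \<in> span_of \<T>H L g" "w \<in> span_of \<T>H L g"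
  shows "(\<lambda>x. \<alpha> * v x + \<beta> * w x) \<in> span_of \<T>H L g"
proof -
  obtain c d where v: "v = (\<lambda>x. \<Sum>K\<in>\<T>H. \<Sum>j=1..L K. c K j * g K j x)"
    and w: "w = (\<lambda>x. \<Sum>K\<in>\<T>H. \<Sum>j=1..L K. d K j * g K j x)"
    using assms unfolding span_of_def by blast
  have "(\<lambda>x. \<alpha> * v x + \<beta> * w x)
      = (\<lambda>x. \<Sum>K\<in>\<T>H. \<Sum>j=1..L K. (\<alpha> * c K j + \<beta> * d K j) * g K j x)"
    by (simp add: v w sum.distrib sum_distrib_left distrib_right mult.assoc)
  then show ?thesis
    unfolding span_of_def by (intro CollectI exI[of _ "\<lambda>K j. \<alpha> * c K j + \<beta> * d K j"]) simp
qed

lemma localized_span_subset_Vh: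
  assumes H: "fe_partition \<Omega> \<T>H" and h: "fine_grid \<Omega> \<T>H \<T>h"
    and psi: "localized_basis \<kappa> \<gamma> \<T>H \<T>h pl L \<phi> m \<psi>"
  shows "span_of \<T>H L \<psi> \<subseteq> Vh \<T>h \<T>H"
proof (rule span_of_subset)
  show fin: "finite \<T>H" using H by (simp add: fe_partition_def)
  show "(\<lambda>x. 0) \<in> Vh \<T>h \<T>H"
    unfolding Vh_def using zero_in_Vh_elem[OF h]
    by (intro CollectI exI[of _ "\<lambda>K x. 0"]) simp
  show "\<psi> K j \<in> Vh \<T>h \<T>H" if "K \<in> \<T>H" "j \<in> {1..L K}" for K j
  proof -
    have "\<psi> K j \<in> Vh \<T>h (patch \<T>H K m)"
      using psi that unfolding localized_basis_def constrained_minimizer_def by blast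
    then show ?thesis using Vh_mono[OF h patch_subset[OF that(1)] fin] by blast
  qed
qed (rule Vh_lincomb)

section \<open>Essentially bounded functions\<close>

text \<open>Preferred to integrability because the class is closed under products, while over a
  finite measure it still implies integrability.\<close>

definition ess_bdd :: "'a measure \<Rightarrow> ('a \<Rightarrow> real) \<Rightarrow> bool" where
  "ess_bdd M f \<longleftrightarrow> f \<in> borel_measurable M \<and> (\<exists>B. AE x in M. \<bar>f x\<bar> \<le> B)"

lemma ess_bddI: "f \<in> borel_measurable M \<Longrightarrow> AE x in M. \<bar>f x\<bar> \<le> B \<Longrightarrow> ess_bdd M f"
  unfolding ess_bdd_def by auto

lemma ess_bdd_const: "ess_bdd M (\<lambda>x. c)"
  by (rule ess_bddI[of _ _ "\<bar>c\<bar>"]) auto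

lemma ess_bdd_add:
  assumes "ess_bdd M f" "ess_bdd M g"
  shows "ess_bdd M (\<lambda>x. f x + g x)"
proof -
  obtain B C where B: "AE x in M. \<bar>f x\<bar> \<le> B" and C: "AE x in M. \<bar>g x\<bar> \<le> C"
    using assms unfolding ess_bdd_def by auto
  have "AE x in M. \<bar>f x + g x\<bar> \<le> B + C"
    using B C by eventually_elim linarith
  then show ?thesis using assms by (intro ess_bddI) (auto simp: ess_bdd_def)
qed

lemma ess_bdd_mult:
  assumes "ess_bdd M f" "ess_bdd M g"
  shows "ess_bdd M (\<lambda>x. f x * g x)"
proof -
  obtain B C where B: "AE x in M. \<bar>f x\<bar> \<le> B" and C: "AE x in M. \<bar>g x\<bar> \<le> C"
    using assms unfolding ess_bdd_def by auto
  have "AE x in M. \<bar>f x * g x\<bar> \<le> \<bar>B\<bar> * \<bar>C\<bar>"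
    using B C
  proof eventually_elim
    case (elim x)
    then have "\<bar>f x\<bar> \<le> \<bar>B\<bar>" "\<bar>g x\<bar> \<le> \<bar>C\<bar>" by linarith+
    then show ?case by (simp add: abs_mult mult_mono)
  qed
  then show ?thesis using assms by (intro ess_bddI) (auto simp: ess_bdd_def)
qed

lemma ess_bdd_cmult: "ess_bdd M f \<Longrightarrow> ess_bdd M (\<lambda>x. c * f x)"
  by (intro ess_bdd_mult ess_bdd_const)

lemma ess_bdd_integrable:
  assumes "finite_measure M" "ess_bdd M f"
  shows "integrable M f"
proof -
  obtain B where B: "AE x in M. norm (f x) \<le> B" using assms(2) unfolding ess_bdd_def by auto
  moreover have "f \<in> borel_measurable M" using assms(2) by (simp add: ess_bdd_def)
  ultimately show ?thesis by (rule finite_measure.integrable_const_bound[OF assms(1)])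
qed

text \<open>The linear relation is asked for almost everywhere only, since gradients on cell
  boundaries and traces at irregular edge points have no meaningful value.\<close>

lemma ess_bdd_integral_lincomb:
  assumes M: "finite_measure M" and f: "ess_bdd M f" "ess_bdd M g" "h \<in> borel_measurable M"
    and eq: "AE x in M. h x = \<alpha> * f x + \<beta> * g x"
  shows "integral\<^sup>L M h = \<alpha> * integral\<^sup>L M f + \<beta> * integral\<^sup>L M g"
proof -
  have i: "integrable M f" "integrable M g" using ess_bdd_integrable[OF M] f by auto
  have "integral\<^sup>L M h = integral\<^sup>L M (\<lambda>x. \<alpha> * f x + \<beta> * g x)"
    using f eq by (intro integral_cong_AE) (auto simp: ess_bdd_def)
  also have "\<dots> = \<alpha> * integral\<^sup>L M f + \<beta> * integral\<^sup>L M g"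
    using i by simp
  finally show ?thesis .
qed

lemma AE_lebesgue_on_negligible:
  assumes "S \<in> sets lebesgue" "negligible (S - A)" "\<And>x. x \<in> A \<Longrightarrow> P x"
  shows "AE x in lebesgue_on S. P x"
proof -
  have "S - A \<in> null_sets lebesgue" using assms(2) negligible_iff_null_sets by blast
  then have "AE x in lebesgue. x \<notin> S - A" by (rule AE_not_in)
  then have "AE x in lebesgue. x \<in> S \<longrightarrow> P x" by eventually_elim (use assms(3) in blast)
  then show ?thesis using assms(1) by (simp add: AE_restrict_space_iff)
qed

text \<open>By completeness of Lebesgue measure the values of \<open>f\<close> on the null set
  \<open>S - A\<close> affect neither measurability nor the essential bound.\<close>

lemma ess_bdd_lebesgue_on:
  fixes f :: "'a::euclidean_space \<Rightarrow> real"
  assumes S: "S \<in> sets lebesgue" "A \<subseteq> S" "negligible (S - A)"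
    and f: "f \<in> borel_measurable (lebesgue_on A)" "\<And>x. x \<in> A \<Longrightarrow> \<bar>f x\<bar> \<le> B"
  shows "ess_bdd (lebesgue_on S) f"
proof -
  have N: "S - A \<in> sets lebesgue" using S(3) by (rule negligible_imp_sets)
  have "A = S - (S - A)" using S(2) by blast
  then have A: "A \<in> sets lebesgue" using S(1) N by (metis sets.Diff)
  have "(\<lambda>x. if x \<in> A then f x else 0) \<in> borel_measurable lebesgue"
    using borel_measurable_if_I[OF f(1) A] .
  moreover have "AE x in lebesgue. (if x \<in> A then f x else 0) = (if x \<in> S then f x else 0)"
  proof -
    have "S - A \<in> null_sets lebesgue" using S(3) negligible_iff_null_sets by blast
    then have "AE x in lebesgue. x \<notin> S - A" by (rule AE_not_in)
    then show ?thesis by eventually_elim (use S(2) in auto)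
  qed
  ultimately have "(\<lambda>x. if x \<in> S then f x else 0) \<in> borel_measurable lebesgue"
    by (rule borel_measurable_AE)
  then have "f \<in> borel_measurable (lebesgue_on S)" by (rule borel_measurable_if_D)
  moreover have "AE x in lebesgue_on S. \<bar>f x\<bar> \<le> B"
    using S(1,3) f(2) by (rule AE_lebesgue_on_negligible)
  ultimately show ?thesis by (rule ess_bddI)
qed

text \<open>Near \<open>x\<close> all values of \<open>g\<close> on \<open>A\<close> are close to
  \<open>T x\<close>. If \<open>x'\<close> is near \<open>x\<close>, then \<open>T x'\<close> is a
  limit of such values, so it is close to \<open>T x\<close> too. This yields measurable traces
  although \<open>g\<close> itself may be discontinuous.\<close>

lemma continuous_on_limit_trace:
  fixes g :: "'a::metric_space \<Rightarrow> real"
  assumes lim: "\<And>x. x \<in> D \<Longrightarrow> (g \<longlongrightarrow> T x) (at x within A)"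
    and nt: "\<And>x. x \<in> D \<Longrightarrow> at x within A \<noteq> bot"
  shows "continuous_on D T"
  unfolding continuous_on_iff
proof (intro ballI allI impI)
  fix x and e :: real assume x: "x \<in> D" and e: "0 < e"
  have "\<forall>\<^sub>F y in at x within A. dist (g y) (T x) < e / 2"
    by (rule tendstoD[OF lim[OF x]]) (use e in simp)
  then obtain d where d: "0 < d" "\<And>y. y \<in> A \<Longrightarrow> y \<noteq> x \<Longrightarrow> dist y x < d \<Longrightarrow> dist (g y) (T x) < e / 2"
    unfolding eventually_at by auto
  show "\<exists>d>0. \<forall>x'\<in>D. dist x' x < d \<longrightarrow> dist (T x') (T x) < e"
  proof (intro exI[of _ d] conjI ballI impI)
    fix x' assume x': "x' \<in> D" "dist x' x < d"
    show "dist (T x') (T x) < e"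
    proof (cases "x' = x")
      case False
      \<comment> \<open>The first bound keeps \<open>y\<close> within distance \<open>d\<close> of
        \<open>x\<close>. The second keeps \<open>y\<close> different from \<open>x\<close>, where
        the punctured limit gives no control.\<close>
      define r where "r = min (d - dist x' x) (dist x' x)"
      have "0 < r" using x' False by (simp add: r_def)
      have "\<forall>\<^sub>F y in at x' within A. \<bar>g y - T x\<bar> \<le> e / 2"
        unfolding eventually_at
      proof (intro exI[of _ r] conjI ballI impI)
        fix y assume y: "y \<in> A" "y \<noteq> x' \<and> dist y x' < r"
        have "dist y x < d" using y dist_triangle[of y x x'] by (simp add: r_def)
        moreover have "y \<noteq> x" using y by (auto simp: r_def dist_commute)
        ultimately show "\<bar>g y - T x\<bar> \<le> e / 2" using d(2)[OF y(1)] by (simp add: dist_real_def)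
      qed (use \<open>0 < r\<close> in auto)
      moreover have "((\<lambda>y. \<bar>g y - T x\<bar>) \<longlongrightarrow> \<bar>T x' - T x\<bar>) (at x' within A)"
        using lim[OF x'(1)] by (intro tendsto_intros)
      ultimately have "\<bar>T x' - T x\<bar> \<le> e / 2"
        using tendsto_upperbound nt[OF x'(1)] by blast
      then show ?thesis using e by (simp add: dist_real_def)
    qed (use e in simp)
  qed (use d in simp)
qed

section \<open>Bilinearity of the interior penalty form\<close>

locale dg_grid =
  fixes \<Omega> :: "(real^2) set" and \<kappa> :: "real^2 \<Rightarrow> real" and \<kappa>0 \<kappa>1 :: real
    and \<T>H \<T>h :: "(real^2) set set" and pl :: "(real^2) set \<Rightarrow> (real^2) set"
  assumes H: "fe_partition \<Omega> \<T>H" and h: "fine_grid \<Omega> \<T>H \<T>h"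
    and orient: "edge_orientation \<T>H pl" and kedge: "has_edge_values \<T>H \<kappa>"
    and coeff: "coefficient_field \<Omega> \<kappa> \<kappa>0 \<kappa>1"
begin

abbreviation smooth :: "(real^2 \<Rightarrow> real) \<Rightarrow> bool" where
  "smooth v \<equiv> \<forall>K\<in>\<T>H. pw_smooth \<T>h K v"

lemma smooth_lincomb: "smooth v \<Longrightarrow> smooth w \<Longrightarrow> smooth (\<lambda>x. \<alpha> * v x + \<beta> * w x)"
  using pw_smooth_lincomb by auto

lemma kappa_bound: "K \<in> \<T>H \<Longrightarrow> x \<in> interior K \<Longrightarrow> \<bar>\<kappa> x\<bar> \<le> \<kappa>1"
  using coeff fe_partition_elem(3)[OF H] unfolding coefficient_field_def by fastforce

lemma fine_partition: "fe_partition \<Omega> \<T>h"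
  using h by (simp add: fine_grid_def)

lemma finite_grids: "finite \<T>H" "finite \<T>h"
  using H fine_partition by (auto simp: fe_partition_def)

text \<open>The finitely many open cell interiors exhaust \<open>K\<close> up to a null set, so
  measurability and bounds can be glued together whatever \<open>f\<close> does on the fine
  skeleton.\<close>

lemma ess_bdd_cellwise:
  assumes K: "K \<in> \<T>H"
    and f: "\<And>c. c \<in> \<T>h \<Longrightarrow> c \<subseteq> K \<Longrightarrow> f \<in> borel_measurable (lebesgue_on (interior c))"
    and B: "\<And>c. c \<in> \<T>h \<Longrightarrow> c \<subseteq> K \<Longrightarrow> \<exists>B. \<forall>x\<in>interior c. \<bar>f x\<bar> \<le> B"
  shows "ess_bdd (lebesgue_on K) f"
proof -
  define P where "P = {c\<in>\<T>h. c \<subseteq> K}"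
  have finP: "finite P" using finite_grids by (simp add: P_def)
  define A where "A = \<Union>(interior ` P)"
  have "\<forall>c\<in>P. \<exists>B. \<forall>x\<in>interior c. \<bar>f x\<bar> \<le> B" using B by (simp add: P_def)
  then obtain b where b: "\<forall>c\<in>P. \<forall>x\<in>interior c. \<bar>f x\<bar> \<le> b c" by metis
  have bd: "\<bar>f x\<bar> \<le> (\<Sum>c\<in>P. \<bar>b c\<bar>)" if x: "x \<in> A" for x
  proof -
    obtain c where c: "c \<in> P" "x \<in> interior c" using x unfolding A_def by auto
    have "\<bar>f x\<bar> \<le> \<bar>b c\<bar>" using b c by force
    also have "\<dots> \<le> (\<Sum>c\<in>P. \<bar>b c\<bar>)" using finP c by (intro member_le_sum) auto
    finally show ?thesis .
  qed
  have openA: "open A" by (auto simp: A_def)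
  have fm: "f \<in> borel_measurable (lebesgue_on A)"
  proof (rule measurable_piecewise_restrict[where C = "interior ` P"])
    show "countable (interior ` P)" using finP by (simp add: countable_finite)
    have m: "S \<in> sets lebesgue" if "open S" for S :: "(real^2) set" using that by auto
    show "S \<inter> space (lebesgue_on A) \<in> sets (lebesgue_on A)" if "S \<in> interior ` P" for S
      using that m openA by (auto simp: sets_restrict_space)
    show "space (lebesgue_on A) \<subseteq> \<Union>(interior ` P)" by (simp add: A_def)
    show "f \<in> borel_measurable (restrict_space (lebesgue_on A) S)" if S: "S \<in> interior ` P" for S
    proof -
      have "A \<inter> S = S" using S by (auto simp: A_def)
      moreover have "open S" using S by auto
      ultimately have "restrict_space (lebesgue_on A) S = lebesgue_on S"
        using m openA restrict_restrict_space[of A lebesgue S] by auto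
      then show ?thesis using S f by (auto simp: P_def)
    qed
  qed
  have "closed K" using fe_partition_elem(6)[OF H K] .
  then have "K \<in> sets lebesgue" by auto
  moreover have "A \<subseteq> K" using interior_subset by (fastforce simp: A_def P_def)
  moreover have "negligible (K - A)" using negligible_fine_skeleton[OF H h K] by (simp add: A_def P_def)
  ultimately show ?thesis using ess_bdd_lebesgue_on fm bd by blast
qed

lemma kappa_measurable:
  assumes "K \<in> \<T>H" "c \<subseteq> K"
  shows "\<kappa> \<in> borel_measurable (lebesgue_on (interior c))"
proof -
  have "interior c \<subseteq> \<Omega>"
    using interior_mono[OF assms(2)] fe_partition_elem(3)[OF H assms(1)] by blast
  then show ?thesis
    using coeff measurable_restrict_mono unfolding coefficient_field_def by blast
qed

lemma energy_density_ess_bdd: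
  assumes K: "K \<in> \<T>H" and v: "smooth v" and w: "smooth w"
  shows "ess_bdd (lebesgue_on K) (\<lambda>x. \<kappa> x * (grad v x \<bullet> grad w x))"
proof (rule ess_bdd_cellwise[OF K])
  fix c assume c: "c \<in> \<T>h" "c \<subseteq> K"
  obtain G where G: "continuous_on c G" "\<forall>x\<in>interior c. grad v x = G x"
    using pw_smooth_gradient[OF v[rule_format, OF K] c] by auto
  obtain G' where G': "continuous_on c G'" "\<forall>x\<in>interior c. grad w x = G' x"
    using pw_smooth_gradient[OF w[rule_format, OF K] c] by auto
  have cont: "continuous_on c (\<lambda>x. G x \<bullet> G' x)"
    using G(1) G'(1) by (intro continuous_intros)
  have "continuous_on (interior c) (\<lambda>x. G x \<bullet> G' x)"
    by (rule continuous_on_subset[OF cont interior_subset])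
  then have "(\<lambda>x. G x \<bullet> G' x) \<in> borel_measurable (lebesgue_on (interior c))"
    by (rule continuous_imp_measurable_on_sets_lebesgue) auto
  then have m: "(\<lambda>x. \<kappa> x * (G x \<bullet> G' x)) \<in> borel_measurable (lebesgue_on (interior c))"
    using kappa_measurable[OF K c(2)] by simp
  have eq: "\<kappa> x * (grad v x \<bullet> grad w x) = \<kappa> x * (G x \<bullet> G' x)" if "x \<in> interior c" for x
    using G(2) G'(2) that by simp
  show "(\<lambda>x. \<kappa> x * (grad v x \<bullet> grad w x)) \<in> borel_measurable (lebesgue_on (interior c))"
    using m measurable_cong[of "lebesgue_on (interior c)" "\<lambda>x. \<kappa> x * (grad v x \<bullet> grad w x)"
        "\<lambda>x. \<kappa> x * (G x \<bullet> G' x)" borel] eq by simp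
  have "compact ((\<lambda>x. G x \<bullet> G' x) ` c)"
    by (rule compact_continuous_image[OF cont fe_partition_elem(5)[OF fine_partition c(1)]])
  then obtain B where B: "\<forall>x\<in>c. \<bar>G x \<bullet> G' x\<bar> \<le> B"
    using compact_imp_bounded bounded_iff by (metis (no_types, lifting) image_eqI real_norm_def)
  have "\<bar>\<kappa> x * (grad v x \<bullet> grad w x)\<bar> \<le> \<kappa>1 * B" if x: "x \<in> interior c" for x
  proof -
    have "\<bar>\<kappa> x\<bar> \<le> \<kappa>1" using kappa_bound[OF K] interior_mono[OF c(2)] x by blast
    moreover have "\<bar>G x \<bullet> G' x\<bar> \<le> B" using B interior_subset[of c] x by blast
    ultimately show ?thesis unfolding eq[OF x] by (simp add: abs_mult mult_mono)
  qed
  then show "\<exists>B. \<forall>x\<in>interior c. \<bar>\<kappa> x * (grad v x \<bullet> grad w x)\<bar> \<le> B" by blast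
qed

lemma elem_energy_lincomb:
  assumes K: "K \<in> \<T>H" and v: "smooth v" "smooth v'" and w: "smooth w"
  shows "elem_energy \<kappa> K (\<lambda>x. \<alpha> * v x + \<beta> * v' x) w
    = \<alpha> * elem_energy \<kappa> K v w + \<beta> * elem_energy \<kappa> K v' w"
  unfolding elem_energy_def
proof (rule ess_bdd_integral_lincomb)
  have K': "compact K" using fe_partition_elem(5)[OF H K] .
  show "finite_measure (lebesgue_on K)"
    using K' by (intro finite_measure_lebesgue_on lmeasurable_compact)
  show "ess_bdd (lebesgue_on K) (\<lambda>x. \<kappa> x * (grad v x \<bullet> grad w x))"
    "ess_bdd (lebesgue_on K) (\<lambda>x. \<kappa> x * (grad v' x \<bullet> grad w x))"
    using energy_density_ess_bdd K v w by auto
  show "(\<lambda>x. \<kappa> x * (grad (\<lambda>x. \<alpha> * v x + \<beta> * v' x) x \<bullet> grad w x)) \<in> borel_measurable (lebesgue_on K)"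
    using energy_density_ess_bdd[OF K smooth_lincomb[OF v] w] by (simp add: ess_bdd_def)
  have "\<kappa> x * (grad (\<lambda>x. \<alpha> * v x + \<beta> * v' x) x \<bullet> grad w x)
      = \<alpha> * (\<kappa> x * (grad v x \<bullet> grad w x)) + \<beta> * (\<kappa> x * (grad v' x \<bullet> grad w x))"
    if x: "x \<in> \<Union>(interior ` {c\<in>\<T>h. c \<subseteq> K})" for x
  proof -
    obtain c where c: "c \<in> \<T>h" "c \<subseteq> K" "x \<in> interior c" using x by auto
    have "grad (\<lambda>x. \<alpha> * v x + \<beta> * v' x) x = \<alpha> *\<^sub>R grad v x + \<beta> *\<^sub>R grad v' x"
      by (rule grad_lincomb[OF v(1)[rule_format, OF K] v(2)[rule_format, OF K] c])
    then show ?thesis by (simp add: inner_add_left algebra_simps)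
  qed
  moreover have "K \<in> sets lebesgue" using K' lmeasurable_compact by auto
  ultimately show "AE x in lebesgue_on K. \<kappa> x * (grad (\<lambda>x. \<alpha> * v x + \<beta> * v' x) x \<bullet> grad w x)
      = \<alpha> * (\<kappa> x * (grad v x \<bullet> grad w x)) + \<beta> * (\<kappa> x * (grad v' x \<bullet> grad w x))"
    using negligible_fine_skeleton[OF H h K] by (intro AE_lebesgue_on_negligible)
qed

end

section \<open>One-sided traces of the flux\<close>

lemma one_sided_eq:
  assumes "at x within interior K \<noteq> bot" "(g \<longlongrightarrow> l) (at x within interior K)"
  shows "one_sided K g x = l"
  unfolding one_sided_def by (rule tendsto_Lim[OF assms])

lemma tendsto_one_sided:
  assumes "at x within interior K \<noteq> bot" "(g \<longlongrightarrow> l) (at x within interior K)"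
  shows "(g \<longlongrightarrow> one_sided K g x) (at x within interior K)"
  using assms(2) unfolding one_sided_eq[OF assms] .

context dg_grid
begin

text \<open>The cell condition is an equality of filters, so that a limit taken inside one smooth
  cell is literally a limit taken inside \<open>K\<close>.\<close>

definition regular_points :: "(real^2) set \<Rightarrow> (real^2) set \<Rightarrow> real set" where
  "regular_points K E = {t\<in>{0..1}.
     (\<exists>l. (\<kappa> \<longlongrightarrow> l) (at (edge_point E t) within interior K)) \<and>
     (\<exists>c\<in>\<T>h. c \<subseteq> K \<and> edge_point E t \<in> c \<and>
        at (edge_point E t) within interior K = at (edge_point E t) within interior c)}"

text \<open>The exceptions are the finitely many junctions of cells along the edge and the null set
  on which the coefficient has no one-sided limit.\<close>

lemma negligible_irregular_points:
  assumes K: "K \<in> \<T>H" "E facet_of K"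
  shows "negligible ({0..1} - regular_points K E)"
proof -
  obtain N where N: "finite N" "\<forall>t\<in>{0..1} - N. \<exists>c\<in>\<T>h. c \<subseteq> K \<and> edge_point E t \<in> c \<and>
     (\<exists>U. open U \<and> edge_point E t \<in> U \<and> interior K \<inter> U = interior c \<inter> U)"
    using edge_point_single_cell[OF H h K] by auto
  define R where "R t \<longleftrightarrow> (\<exists>l. (\<kappa> \<longlongrightarrow> l) (at (edge_point E t) within interior K))" for t
  have "AE t in lebesgue_on {0..1}. R t"
    using kedge K unfolding has_edge_values_def R_def by auto
  then have "AE t in lebesgue. t \<in> {0..1} \<longrightarrow> R t"
    by (simp add: AE_restrict_space_iff)
  then obtain M where M: "M \<in> null_sets lebesgue" "{t. \<not> (t \<in> {0..1} \<longrightarrow> R t)} \<subseteq> M"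
    by (auto simp: eventually_ae_filter)
  have "negligible (N \<union> M)"
    using negligible_finite[OF N(1)] M(1) negligible_iff_null_sets[of M] by simp
  moreover have "t \<in> regular_points K E" if t: "t \<in> {0..1}" "t \<notin> N" "t \<notin> M" for t
  proof -
    obtain c U where c: "c \<in> \<T>h" "c \<subseteq> K" "edge_point E t \<in> c" 
      and U: "open U" "edge_point E t \<in> U" "interior K \<inter> U = interior c \<inter> U"
      using bspec[OF N(2), of t] t by auto
    have eq: "at (edge_point E t) within interior K = at (edge_point E t) within interior c"
      by (rule at_within_nhd[OF U(2,1)]) (simp only: U(3))
    have "\<exists>c\<in>\<T>h. c \<subseteq> K \<and> edge_point E t \<in> c \<and>
        at (edge_point E t) within interior K = at (edge_point E t) within interior c"
      by (intro bexI[of _ c] conjI c eq)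
    moreover have "R t" using t M(2) by auto
    ultimately show ?thesis using t(1) unfolding regular_points_def R_def by (intro CollectI conjI)
  qed
  then have "{0..1} - regular_points K E \<subseteq> N \<union> M" by blast
  ultimately show ?thesis by (rule negligible_subset)
qed

lemma regular_points_subset: "regular_points K E \<subseteq> {0..1}"
  by (auto simp: regular_points_def)

lemma regular_points_coeff_limit:
  "t \<in> regular_points K E \<Longrightarrow> \<exists>l. (\<kappa> \<longlongrightarrow> l) (at (edge_point E t) within interior K)"
  by (simp add: regular_points_def)

lemma regular_points_cell:
  "t \<in> regular_points K E \<Longrightarrow> \<exists>c\<in>\<T>h. c \<subseteq> K \<and> edge_point E t \<in> c \<and>
     at (edge_point E t) within interior K = at (edge_point E t) within interior c"
  by (simp add: regular_points_def)

lemma flux_bounded: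
  assumes K: "K \<in> \<T>H" and v: "smooth v"
  shows "\<exists>B. \<forall>c\<in>\<T>h. c \<subseteq> K \<longrightarrow> (\<forall>x\<in>interior c. \<bar>\<kappa> x * (grad v x \<bullet> n)\<bar> \<le> B)"
proof -
  have "\<exists>B. \<forall>x\<in>interior c. \<bar>\<kappa> x * (grad v x \<bullet> n)\<bar> \<le> B" if c: "c \<in> \<T>h" "c \<subseteq> K" for c
  proof -
    obtain G where G: "continuous_on c G" "\<forall>x\<in>interior c. grad v x = G x"
      using pw_smooth_gradient[OF v[rule_format, OF K] c] by auto
    have "compact ((\<lambda>x. G x \<bullet> n) ` c)"
      by (rule compact_continuous_image[OF _ fe_partition_elem(5)[OF fine_partition c(1)]])
         (intro continuous_intros G)
    then obtain B where B: "\<forall>x\<in>c. \<bar>G x \<bullet> n\<bar> \<le> B"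
      using compact_imp_bounded bounded_iff by (metis (no_types, lifting) image_eqI real_norm_def)
    have "\<bar>\<kappa> x * (grad v x \<bullet> n)\<bar> \<le> \<kappa>1 * B" if x: "x \<in> interior c" for x
    proof -
      have "\<bar>\<kappa> x\<bar> \<le> \<kappa>1" using kappa_bound[OF K] interior_mono[OF c(2)] x by blast
      moreover have "\<bar>grad v x \<bullet> n\<bar> \<le> B" using B G(2) interior_subset[of c] x by auto
      ultimately show ?thesis by (simp add: abs_mult mult_mono)
    qed
    then show ?thesis by blast
  qed
  then have "\<forall>c\<in>{c\<in>\<T>h. c \<subseteq> K}. \<exists>B. \<forall>x\<in>interior c. \<bar>\<kappa> x * (grad v x \<bullet> n)\<bar> \<le> B" by simp
  from bchoice[OF this] obtain b
    where b: "\<forall>c\<in>{c\<in>\<T>h. c \<subseteq> K}. \<forall>x\<in>interior c. \<bar>\<kappa> x * (grad v x \<bullet> n)\<bar> \<le> b c" ..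
  have "\<bar>\<kappa> x * (grad v x \<bullet> n)\<bar> \<le> (\<Sum>c\<in>\<T>h. \<bar>b c\<bar>)" if "c \<in> \<T>h" "c \<subseteq> K" "x \<in> interior c" for c x
  proof -
    have "\<bar>\<kappa> x * (grad v x \<bullet> n)\<bar> \<le> \<bar>b c\<bar>" using b that by force
    also have "\<dots> \<le> (\<Sum>c\<in>\<T>h. \<bar>b c\<bar>)" using finite_grids that by (intro member_le_sum) auto
    finally show ?thesis .
  qed
  then show ?thesis by blast
qed

lemma eventually_in_within: "\<forall>\<^sub>F y in at x within S. y \<in> S"
  by (simp add: eventually_at_filter)

lemma regular_points_nontrivial:
  assumes K: "K \<in> \<T>H" "E facet_of K" and t: "t \<in> regular_points K E"
  shows "at (edge_point E t) within interior K \<noteq> bot"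
proof -
  have "t \<in> {0..1}" using t regular_points_subset by blast
  then show ?thesis
    using facet_within_interior_nontrivial[OF H K] edge_point_mem[OF H K] by simp
qed

text \<open>Inside the selected cell the gradient has a continuous extension and the coefficient has
  a limit, so the product converges. The limit is written as \<open>one_sided\<close> to match the
  form needed by \<open>continuous_on_limit_trace\<close>.\<close>

lemma flux_tendsto:
  assumes K: "K \<in> \<T>H" "E facet_of K" and v: "smooth v" and t: "t \<in> regular_points K E"
  shows "((\<lambda>x. \<kappa> x * (grad v x \<bullet> n)) \<longlongrightarrow> one_sided K (\<lambda>x. \<kappa> x * (grad v x \<bullet> n)) (edge_point E t))
        (at (edge_point E t) within interior K)"
proof -
  define x where "x = edge_point E t"
  obtain c where c: "c \<in> \<T>h" "c \<subseteq> K" "x \<in> c" "at x within interior K = at x within interior c"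
    using regular_points_cell[OF t] unfolding x_def by auto
  obtain l where l: "(\<kappa> \<longlongrightarrow> l) (at x within interior c)"
    using regular_points_coeff_limit[OF t] c(4) unfolding x_def by auto
  obtain G where G: "continuous_on c G" "\<forall>x\<in>interior c. grad v x = G x"
    using pw_smooth_gradient[OF v[rule_format, OF K(1)] c(1,2)] by auto
  have "(G \<longlongrightarrow> G x) (at x within c)" using G(1) c(3) by (simp add: continuous_on)
  then have "(G \<longlongrightarrow> G x) (at x within interior c)"
    by (rule tendsto_within_subset[OF _ interior_subset])
  then have "((\<lambda>y. \<kappa> y * (G y \<bullet> n)) \<longlongrightarrow> l * (G x \<bullet> n)) (at x within interior c)"
    using l by (intro tendsto_intros)
  moreover have "\<forall>\<^sub>F y in at x within interior c. \<kappa> y * (G y \<bullet> n) = \<kappa> y * (grad v y \<bullet> n)"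
    using eventually_in_within[of "interior c" x] by eventually_elim (use G(2) in simp)
  ultimately have "((\<lambda>y. \<kappa> y * (grad v y \<bullet> n)) \<longlongrightarrow> l * (G x \<bullet> n)) (at x within interior K)"
    unfolding c(4) by (rule Lim_transform_eventually)
  then show ?thesis
    unfolding x_def by (rule tendsto_one_sided[OF regular_points_nontrivial[OF K t]])
qed

lemma flux_trace_lincomb:
  assumes K: "K \<in> \<T>H" "E facet_of K" and v: "smooth v" and w: "smooth w"
    and t: "t \<in> regular_points K E"
  shows "one_sided K (\<lambda>x. \<kappa> x * (grad (\<lambda>x. \<alpha> * v x + \<beta> * w x) x \<bullet> n)) (edge_point E t) =
      \<alpha> * one_sided K (\<lambda>x. \<kappa> x * (grad v x \<bullet> n)) (edge_point E t) +
      \<beta> * one_sided K (\<lambda>x. \<kappa> x * (grad w x \<bullet> n)) (edge_point E t)"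
proof -
  define x where "x = edge_point E t"
  obtain c where c: "c \<in> \<T>h" "c \<subseteq> K" "x \<in> c" "at x within interior K = at x within interior c"
    using regular_points_cell[OF t] unfolding x_def by auto
  have "\<forall>\<^sub>F y in at x within interior K. \<alpha> * (\<kappa> y * (grad v y \<bullet> n)) + \<beta> * (\<kappa> y * (grad w y \<bullet> n))
      = \<kappa> y * (grad (\<lambda>x. \<alpha> * v x + \<beta> * w x) y \<bullet> n)"
    unfolding c(4) using eventually_in_within[of "interior c" x]
  proof eventually_elim
    case (elim y)
    show ?case
      using grad_lincomb[OF v[rule_format, OF K(1)] w[rule_format, OF K(1)] c(1,2) elim]
      by (simp add: inner_add_left algebra_simps)
  qed
  moreover have "((\<lambda>y. \<alpha> * (\<kappa> y * (grad v y \<bullet> n)) + \<beta> * (\<kappa> y * (grad w y \<bullet> n))) \<longlongrightarrow>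
    \<alpha> * one_sided K (\<lambda>x. \<kappa> x * (grad v x \<bullet> n)) x + \<beta> * one_sided K (\<lambda>x. \<kappa> x * (grad w x \<bullet> n)) x)
    (at x within interior K)"
    using flux_tendsto[OF K v t] flux_tendsto[OF K w t] unfolding x_def by (intro tendsto_intros)
  ultimately have "((\<lambda>y. \<kappa> y * (grad (\<lambda>x. \<alpha> * v x + \<beta> * w x) y \<bullet> n)) \<longlongrightarrow>
    \<alpha> * one_sided K (\<lambda>x. \<kappa> x * (grad v x \<bullet> n)) x + \<beta> * one_sided K (\<lambda>x. \<kappa> x * (grad w x \<bullet> n)) x)
    (at x within interior K)"
    by (rule Lim_transform_eventually[rotated])
  then show ?thesis
    unfolding x_def by (rule one_sided_eq[OF regular_points_nontrivial[OF K t]])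
qed

lemma flux_trace_bounded:
  assumes K: "K \<in> \<T>H" "E facet_of K" and v: "smooth v"
  shows "\<exists>B. \<forall>t\<in>regular_points K E. \<bar>one_sided K (\<lambda>x. \<kappa> x * (grad v x \<bullet> n)) (edge_point E t)\<bar> \<le> B"
proof -
  obtain B where B: "\<forall>c\<in>\<T>h. c \<subseteq> K \<longrightarrow> (\<forall>x\<in>interior c. \<bar>\<kappa> x * (grad v x \<bullet> n)\<bar> \<le> B)"
    using flux_bounded[OF K(1) v, of n] ..
  have "\<bar>one_sided K (\<lambda>x. \<kappa> x * (grad v x \<bullet> n)) (edge_point E t)\<bar> \<le> B" if t: "t \<in> regular_points K E" for t
  proof (rule tendsto_upperbound[OF tendsto_rabs[OF flux_tendsto[OF K v t]] _ regular_points_nontrivial[OF K t]])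
    obtain c where c: "c \<in> \<T>h" "c \<subseteq> K"
      "at (edge_point E t) within interior K = at (edge_point E t) within interior c"
      using regular_points_cell[OF t] by auto
    show "\<forall>\<^sub>F y in at (edge_point E t) within interior K. \<bar>\<kappa> y * (grad v y \<bullet> n)\<bar> \<le> B"
      unfolding c(3) using eventually_in_within[of "interior c" _]
      by eventually_elim (use B c in auto)
  qed
  then show ?thesis by blast
qed

lemma flux_trace_ess_bdd:
  assumes K: "K \<in> \<T>H" "E facet_of K" and v: "smooth v"
  shows "ess_bdd (lebesgue_on {0..1}) (\<lambda>t. one_sided K (\<lambda>x. \<kappa> x * (grad v x \<bullet> n)) (edge_point E t))"
proof -
  define S where "S = regular_points K E"
  have S: "S \<subseteq> {0..1}" "negligible ({0..1} - S)"
    using regular_points_subset negligible_irregular_points[OF K] by (simp_all add: S_def)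
  obtain B where B: "\<And>t. t \<in> S \<Longrightarrow> \<bar>one_sided K (\<lambda>x. \<kappa> x * (grad v x \<bullet> n)) (edge_point E t)\<bar> \<le> B"
    using flux_trace_bounded[OF K v, of n] unfolding S_def by auto
  have "continuous_on (edge_point E ` S) (one_sided K (\<lambda>x. \<kappa> x * (grad v x \<bullet> n)))"
  proof (rule continuous_on_limit_trace)
    fix x assume x: "x \<in> edge_point E ` S"
    then show "((\<lambda>x. \<kappa> x * (grad v x \<bullet> n)) \<longlongrightarrow> one_sided K (\<lambda>x. \<kappa> x * (grad v x \<bullet> n)) x)
        (at x within interior K)" using flux_tendsto[OF K v] by (auto simp: S_def)
    show "at x within interior K \<noteq> bot"
      using regular_points_nontrivial[OF K] x by (auto simp: S_def)
  qed
  then have "continuous_on S (\<lambda>t. one_sided K (\<lambda>x. \<kappa> x * (grad v x \<bullet> n)) (edge_point E t))"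
    by (rule continuous_on_compose2[OF _ continuous_on_edge_point]) simp
  \<comment> \<open>The definition of the regular points does not show this; it holds because their
    complement in the unit interval is null.\<close>
  moreover have "S \<in> sets lebesgue"
  proof -
    have "S = {0..1} - ({0..1} - S)" using S(1) by blast
    moreover have "{0..1} - S \<in> sets lebesgue" using S(2) by (rule negligible_imp_sets)
    ultimately show ?thesis by (metis sets.Diff atLeastAtMost_borel sets_completionI_sets sets_lborel)
  qed
  ultimately have "(\<lambda>t. one_sided K (\<lambda>x. \<kappa> x * (grad v x \<bullet> n)) (edge_point E t))
      \<in> borel_measurable (lebesgue_on S)"
    by (rule continuous_imp_measurable_on_sets_lebesgue)
  then show ?thesis by (intro ess_bdd_lebesgue_on[OF _ S _ B]) auto
qed

section \<open>One-sided traces of function values\<close>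

lemma value_trace:
  assumes K: "K \<in> \<T>H" "E facet_of K" and v: "smooth v"
  shows "\<exists>g. continuous_on K g \<and> (\<forall>x\<in>E. one_sided K v x = g x) \<and>
    (\<forall>x\<in>E. (v \<longlongrightarrow> g x) (at x within interior K))"
proof -
  obtain g where g: "continuous_on K g" "\<forall>x\<in>interior K. v x = g x"
    using v K(1) unfolding pw_smooth_def by blast
  have lim: "(v \<longlongrightarrow> g x) (at x within interior K)" if x: "x \<in> E" for x
  proof -
    have "x \<in> K" using facet_disjoint_interior(2)[OF H K] x by blast
    then have "(g \<longlongrightarrow> g x) (at x within K)" using g(1) by (simp add: continuous_on)
    then have "(g \<longlongrightarrow> g x) (at x within interior K)"
      by (rule tendsto_within_subset[OF _ interior_subset])
    moreover have "\<forall>\<^sub>F y in at x within interior K. g y = v y"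
      using eventually_in_within[of "interior K" x] by (rule eventually_mono) (simp add: g(2))
    ultimately show ?thesis by (rule Lim_transform_eventually)
  qed
  moreover have "one_sided K v x = g x" if x: "x \<in> E" for x
    using facet_within_interior_nontrivial[OF H K x] lim[OF x] by (rule one_sided_eq)
  ultimately show ?thesis using g(1) by blast
qed

lemma value_trace_lincomb:
  assumes K: "K \<in> \<T>H" "E facet_of K" and v: "smooth v" "smooth w" and x: "x \<in> E"
  shows "one_sided K (\<lambda>x. \<alpha> * v x + \<beta> * w x) x = \<alpha> * one_sided K v x + \<beta> * one_sided K w x"
proof -
  obtain g where g: "one_sided K v x = g x" "(v \<longlongrightarrow> g x) (at x within interior K)"
    using value_trace[OF K v(1)] x by auto
  obtain g' where g': "one_sided K w x = g' x" "(w \<longlongrightarrow> g' x) (at x within interior K)"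
    using value_trace[OF K v(2)] x by auto
  have "((\<lambda>x. \<alpha> * v x + \<beta> * w x) \<longlongrightarrow> \<alpha> * g x + \<beta> * g' x) (at x within interior K)"
    using g(2) g'(2) by (intro tendsto_intros)
  then show ?thesis
    unfolding g(1) g'(1) by (rule one_sided_eq[OF facet_within_interior_nontrivial[OF H K x]])
qed

lemma value_trace_ess_bdd:
  assumes K: "K \<in> \<T>H" "E facet_of K" and v: "smooth v"
  shows "ess_bdd (lebesgue_on {0..1}) (\<lambda>t. one_sided K v (edge_point E t))"
proof -
  obtain g where g: "continuous_on K g" "\<forall>x\<in>E. one_sided K v x = g x"
    using value_trace[OF K v] by auto
  have mem: "edge_point E t \<in> E" if "t \<in> {0..1}" for t using edge_point_mem[OF H K that] .
  have "continuous_on {0..1} (\<lambda>t. g (edge_point E t))"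
    by (rule continuous_on_compose2[OF g(1) continuous_on_edge_point])
       (use mem facet_disjoint_interior(2)[OF H K] in blast)
  then have cont: "continuous_on {0..1} (\<lambda>t. one_sided K v (edge_point E t))"
    by (rule continuous_on_eq) (use g(2) mem in simp)
  then have m: "(\<lambda>t. one_sided K v (edge_point E t)) \<in> borel_measurable (lebesgue_on {0..1})"
    by (rule continuous_imp_measurable_on_sets_lebesgue) auto
  have "bounded ((\<lambda>t. one_sided K v (edge_point E t)) ` {0..1})"
    by (rule compact_imp_bounded[OF compact_continuous_image[OF cont compact_Icc]])
  then obtain B where "\<forall>t\<in>{0..1}. \<bar>one_sided K v (edge_point E t)\<bar> \<le> B"
    by (auto simp: bounded_iff)
  then show ?thesis by (intro ess_bdd_lebesgue_on[OF _ _ _ m, of _ B]) auto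
qed

text \<open>For the minus side, cardinality two together with membership of \<open>pl E\<close>
  gives the unique existence behind the description in \<open>minus_elem\<close>.\<close>

lemma edge_sides:
  assumes E: "E \<in> coarse_edges \<T>H"
  shows "pl E \<in> \<T>H" "E facet_of pl E"
    "interior_edge \<T>H E \<Longrightarrow> minus_elem \<T>H pl E \<in> \<T>H \<and> E facet_of minus_elem \<T>H pl E"
proof -
  show p: "pl E \<in> \<T>H" "E facet_of pl E" using orient E by (auto simp: edge_orientation_def)
  assume "interior_edge \<T>H E"
  then obtain K K' where KK: "{K\<in>\<T>H. E facet_of K} = {K, K'}" "K \<noteq> K'"
    by (auto simp: interior_edge_def card_2_iff)
  have iff: "X \<in> \<T>H \<and> E facet_of X \<longleftrightarrow> X = K \<or> X = K'" for X
  proof -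
    have "X \<in> {K\<in>\<T>H. E facet_of K} \<longleftrightarrow> X \<in> {K, K'}" by (simp only: KK(1))
    then show ?thesis by simp
  qed
  have "X \<in> \<T>H \<and> E facet_of X \<and> X \<noteq> pl E \<longleftrightarrow> X = (if pl E = K then K' else K)" for X
    using iff[of X] iff[of "pl E"] p KK(2) by auto
  then have "\<exists>!K. K \<in> \<T>H \<and> E facet_of K \<and> K \<noteq> pl E" by simp
  from theI'[OF this] show "minus_elem \<T>H pl E \<in> \<T>H \<and> E facet_of minus_elem \<T>H pl E"
    unfolding minus_elem_def by blast
qed

section \<open>Averages and jumps along a coarse edge\<close>

lemma flux_trace_lincomb_AE:
  assumes K: "K \<in> \<T>H" "E facet_of K" and v: "smooth v" "smooth w"
  shows "AE t in lebesgue_on {0..1}.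
      one_sided K (\<lambda>x. \<kappa> x * (grad (\<lambda>x. \<alpha> * v x + \<beta> * w x) x \<bullet> n)) (edge_point E t) =
      \<alpha> * one_sided K (\<lambda>x. \<kappa> x * (grad v x \<bullet> n)) (edge_point E t) +
      \<beta> * one_sided K (\<lambda>x. \<kappa> x * (grad w x \<bullet> n)) (edge_point E t)"
  by (rule AE_lebesgue_on_negligible[OF _ negligible_irregular_points[OF K]])
     (auto intro: flux_trace_lincomb[OF K v])

lemma normal_flux_eq: "normal_flux \<kappa> pl E v = (\<lambda>x. \<kappa> x * (grad v x \<bullet> outward_normal (pl E) E))"
  by (rule ext) (simp add: normal_flux_def)

lemma avg_flux_ess_bdd:
  assumes E: "E \<in> coarse_edges \<T>H" and v: "smooth v"
  shows "ess_bdd (lebesgue_on {0..1}) (\<lambda>t. avg \<T>H pl E (normal_flux \<kappa> pl E v) (edge_point E t))"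
proof (cases "interior_edge \<T>H E")
  case True
  have m: "minus_elem \<T>H pl E \<in> \<T>H" "E facet_of minus_elem \<T>H pl E"
    using edge_sides(3)[OF E True] by auto
  show ?thesis
    unfolding avg_def normal_flux_eq
    using True ess_bdd_cmult[OF ess_bdd_add[OF flux_trace_ess_bdd[OF edge_sides(1,2)[OF E] v]
        flux_trace_ess_bdd[OF m v]], of "1/2"] by simp
next
  case False
  then show ?thesis
    unfolding avg_def normal_flux_eq using flux_trace_ess_bdd[OF edge_sides(1,2)[OF E] v] by simp
qed

lemma avg_flux_lincomb:
  assumes E: "E \<in> coarse_edges \<T>H" and v: "smooth v" "smooth w"
  shows "AE t in lebesgue_on {0..1}.
    avg \<T>H pl E (normal_flux \<kappa> pl E (\<lambda>x. \<alpha> * v x + \<beta> * w x)) (edge_point E t) =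
    \<alpha> * avg \<T>H pl E (normal_flux \<kappa> pl E v) (edge_point E t) +
    \<beta> * avg \<T>H pl E (normal_flux \<kappa> pl E w) (edge_point E t)"
proof (cases "interior_edge \<T>H E")
  case True
  have m: "minus_elem \<T>H pl E \<in> \<T>H" "E facet_of minus_elem \<T>H pl E"
    using edge_sides(3)[OF E True] by auto
  show ?thesis
    unfolding avg_def normal_flux_eq if_P[OF True]
    using flux_trace_lincomb_AE[OF edge_sides(1,2)[OF E] v, of \<alpha> \<beta> "outward_normal (pl E) E"]
      flux_trace_lincomb_AE[OF m v, of \<alpha> \<beta> "outward_normal (pl E) E"]
    by eventually_elim (simp add: field_simps)
next
  case False
  show ?thesis
    unfolding avg_def normal_flux_eq if_not_P[OF False]
    by (rule flux_trace_lincomb_AE[OF edge_sides(1,2)[OF E] v])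
qed

lemma jump_ess_bdd:
  assumes E: "E \<in> coarse_edges \<T>H" and v: "smooth v"
  shows "ess_bdd (lebesgue_on {0..1}) (\<lambda>t. jump \<T>H pl E v (edge_point E t))"
proof (cases "interior_edge \<T>H E")
  case True
  have m: "minus_elem \<T>H pl E \<in> \<T>H" "E facet_of minus_elem \<T>H pl E"
    using edge_sides(3)[OF E True] by auto
  show ?thesis
    unfolding jump_def
    using True ess_bdd_add[OF value_trace_ess_bdd[OF edge_sides(1,2)[OF E] v]
        ess_bdd_cmult[OF value_trace_ess_bdd[OF m v], of "-1"]] by simp
next
  case False
  then show ?thesis
    unfolding jump_def using value_trace_ess_bdd[OF edge_sides(1,2)[OF E] v] by simp
qed

lemma jump_lincomb:
  assumes E: "E \<in> coarse_edges \<T>H" and v: "smooth v" "smooth w" and x: "x \<in> E"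
  shows "jump \<T>H pl E (\<lambda>x. \<alpha> * v x + \<beta> * w x) x = \<alpha> * jump \<T>H pl E v x + \<beta> * jump \<T>H pl E w x"
proof (cases "interior_edge \<T>H E")
  case True
  have m: "minus_elem \<T>H pl E \<in> \<T>H" "E facet_of minus_elem \<T>H pl E"
    using edge_sides(3)[OF E True] by auto
  show ?thesis
    unfolding jump_def if_P[OF True] value_trace_lincomb[OF edge_sides(1,2)[OF E] v x]
      value_trace_lincomb[OF m v x] by (simp add: algebra_simps)
next
  case False
  show ?thesis
    unfolding jump_def if_not_P[OF False] by (rule value_trace_lincomb[OF edge_sides(1,2)[OF E] v x])
qed

section \<open>Linearity of the edge terms and of the whole form\<close>

lemma edge_integral_lincomb:
  assumes f: "ess_bdd (lebesgue_on {0..1}) (\<lambda>t. f (edge_point E t))"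
      "ess_bdd (lebesgue_on {0..1}) (\<lambda>t. g (edge_point E t))"
      "ess_bdd (lebesgue_on {0..1}) (\<lambda>t. k (edge_point E t))"
    and eq: "AE t in lebesgue_on {0..1}. k (edge_point E t)
      = \<alpha> * f (edge_point E t) + \<beta> * g (edge_point E t)"
  shows "edge_integral E k = \<alpha> * edge_integral E f + \<beta> * edge_integral E g"
proof -
  have "finite_measure (lebesgue_on {0..1::real})"
    by (rule finite_measure_lebesgue_on) simp
  then have "integral\<^sup>L (lebesgue_on {0..1}) (\<lambda>t. k (edge_point E t)) =
      \<alpha> * integral\<^sup>L (lebesgue_on {0..1}) (\<lambda>t. f (edge_point E t)) +
      \<beta> * integral\<^sup>L (lebesgue_on {0..1}) (\<lambda>t. g (edge_point E t))"
    by (rule ess_bdd_integral_lincomb) (use f eq in \<open>auto simp: ess_bdd_def\<close>)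
  then show ?thesis by (simp add: edge_integral_def algebra_simps)
qed

lemma edge_point_mem_AE: 
  assumes E: "E \<in> coarse_edges \<T>H"
  shows "AE t in lebesgue_on {0..1}. edge_point E t \<in> E"
  using edge_point_mem[OF H edge_sides(1,2)[OF E]] by (intro AE_I2) simp

lemma edge_consistency_lincomb:
  assumes E: "E \<in> coarse_edges \<T>H" and v: "smooth v" "smooth v'" and w: "smooth w"
  shows "edge_integral E (\<lambda>x. avg \<T>H pl E (normal_flux \<kappa> pl E (\<lambda>x. \<alpha> * v x + \<beta> * v' x)) x * jump \<T>H pl E w x)
    = \<alpha> * edge_integral E (\<lambda>x. avg \<T>H pl E (normal_flux \<kappa> pl E v) x * jump \<T>H pl E w x)
    + \<beta> * edge_integral E (\<lambda>x. avg \<T>H pl E (normal_flux \<kappa> pl E v') x * jump \<T>H pl E w x)"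
proof (rule edge_integral_lincomb)
  show "AE t in lebesgue_on {0..1}.
    avg \<T>H pl E (normal_flux \<kappa> pl E (\<lambda>x. \<alpha> * v x + \<beta> * v' x)) (edge_point E t) * jump \<T>H pl E w (edge_point E t) =
    \<alpha> * (avg \<T>H pl E (normal_flux \<kappa> pl E v) (edge_point E t) * jump \<T>H pl E w (edge_point E t)) +
    \<beta> * (avg \<T>H pl E (normal_flux \<kappa> pl E v') (edge_point E t) * jump \<T>H pl E w (edge_point E t))"
    using avg_flux_lincomb[OF E v, of \<alpha> \<beta>] by eventually_elim (simp add: algebra_simps)
qed (intro ess_bdd_mult avg_flux_ess_bdd[OF E] jump_ess_bdd[OF E] smooth_lincomb v w)+

lemma edge_consistency_lincomb':
  assumes E: "E \<in> coarse_edges \<T>H" and v: "smooth v" "smooth v'" and w: "smooth w"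
  shows "edge_integral E (\<lambda>x. avg \<T>H pl E (normal_flux \<kappa> pl E w) x * jump \<T>H pl E (\<lambda>x. \<alpha> * v x + \<beta> * v' x) x)
    = \<alpha> * edge_integral E (\<lambda>x. avg \<T>H pl E (normal_flux \<kappa> pl E w) x * jump \<T>H pl E v x)
    + \<beta> * edge_integral E (\<lambda>x. avg \<T>H pl E (normal_flux \<kappa> pl E w) x * jump \<T>H pl E v' x)"
proof (rule edge_integral_lincomb)
  show "AE t in lebesgue_on {0..1}.
    avg \<T>H pl E (normal_flux \<kappa> pl E w) (edge_point E t) * jump \<T>H pl E (\<lambda>x. \<alpha> * v x + \<beta> * v' x) (edge_point E t) =
    \<alpha> * (avg \<T>H pl E (normal_flux \<kappa> pl E w) (edge_point E t) * jump \<T>H pl E v (edge_point E t)) +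
    \<beta> * (avg \<T>H pl E (normal_flux \<kappa> pl E w) (edge_point E t) * jump \<T>H pl E v' (edge_point E t))"
    using edge_point_mem_AE[OF E]
    by eventually_elim (simp add: jump_lincomb[OF E v] algebra_simps)
qed (intro ess_bdd_mult avg_flux_ess_bdd[OF E] jump_ess_bdd[OF E] smooth_lincomb v w)+

lemma edge_penalty_lincomb:
  assumes E: "E \<in> coarse_edges \<T>H" and v: "smooth v" "smooth v'" and w: "smooth w"
  shows "edge_integral E (\<lambda>x. k * jump \<T>H pl E (\<lambda>x. \<alpha> * v x + \<beta> * v' x) x * jump \<T>H pl E w x)
    = \<alpha> * edge_integral E (\<lambda>x. k * jump \<T>H pl E v x * jump \<T>H pl E w x)
    + \<beta> * edge_integral E (\<lambda>x. k * jump \<T>H pl E v' x * jump \<T>H pl E w x)"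
proof (rule edge_integral_lincomb)
  show "AE t in lebesgue_on {0..1}.
    k * jump \<T>H pl E (\<lambda>x. \<alpha> * v x + \<beta> * v' x) (edge_point E t) * jump \<T>H pl E w (edge_point E t) =
    \<alpha> * (k * jump \<T>H pl E v (edge_point E t) * jump \<T>H pl E w (edge_point E t)) +
    \<beta> * (k * jump \<T>H pl E v' (edge_point E t) * jump \<T>H pl E w (edge_point E t))"
    using edge_point_mem_AE[OF E]
    by eventually_elim (simp add: jump_lincomb[OF E v] algebra_simps)
qed (intro ess_bdd_mult ess_bdd_const jump_ess_bdd[OF E] smooth_lincomb v w)+

text \<open>The four sums are linear in \<open>v\<close> one by one. In the two consistency sums
  \<open>v\<close> enters once through the flux, linear almost everywhere, and once through the
  jump, linear at every edge point.\<close>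

lemma a_DG_lincomb:
  assumes v: "smooth v" "smooth v'" and w: "smooth w"
  shows "a_DG \<kappa> \<gamma> \<T>H \<T>h pl (\<lambda>x. \<alpha> * v x + \<beta> * v' x) w
    = \<alpha> * a_DG \<kappa> \<gamma> \<T>H \<T>h pl v w + \<beta> * a_DG \<kappa> \<gamma> \<T>H \<T>h pl v' w"
proof -
  have lin: "sum p I = \<alpha> * sum q I + \<beta> * sum r I" if "\<And>i. i \<in> I \<Longrightarrow> p i = \<alpha> * q i + \<beta> * r i"
    for p q r :: "(real^2) set \<Rightarrow> real" and I
    using that by (simp add: sum.distrib sum_distrib_left)
  have s1: "(\<Sum>K\<in>\<T>H. elem_energy \<kappa> K (\<lambda>x. \<alpha> * v x + \<beta> * v' x) w)
      = \<alpha> * (\<Sum>K\<in>\<T>H. elem_energy \<kappa> K v w)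
      + \<beta> * (\<Sum>K\<in>\<T>H. elem_energy \<kappa> K v' w)"
    by (rule lin) (rule elem_energy_lincomb[OF _ v w])
  have s2: "(\<Sum>E\<in>coarse_edges \<T>H. edge_integral E (\<lambda>x. avg \<T>H pl E (normal_flux \<kappa> pl E (\<lambda>x. \<alpha> * v x + \<beta> * v' x)) x * jump \<T>H pl E w x))
      = \<alpha> * (\<Sum>E\<in>coarse_edges \<T>H. edge_integral E (\<lambda>x. avg \<T>H pl E (normal_flux \<kappa> pl E v) x * jump \<T>H pl E w x))
      + \<beta> * (\<Sum>E\<in>coarse_edges \<T>H. edge_integral E (\<lambda>x. avg \<T>H pl E (normal_flux \<kappa> pl E v') x * jump \<T>H pl E w x))"
    by (rule lin) (rule edge_consistency_lincomb[OF _ v w])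
  have s3: "(\<Sum>E\<in>coarse_edges \<T>H. edge_integral E (\<lambda>x. avg \<T>H pl E (normal_flux \<kappa> pl E w) x * jump \<T>H pl E (\<lambda>x. \<alpha> * v x + \<beta> * v' x) x))
      = \<alpha> * (\<Sum>E\<in>coarse_edges \<T>H. edge_integral E (\<lambda>x. avg \<T>H pl E (normal_flux \<kappa> pl E w) x * jump \<T>H pl E v x))
      + \<beta> * (\<Sum>E\<in>coarse_edges \<T>H. edge_integral E (\<lambda>x. avg \<T>H pl E (normal_flux \<kappa> pl E w) x * jump \<T>H pl E v' x))"
    by (rule lin) (rule edge_consistency_lincomb'[OF _ v w])
  have s4: "(\<Sum>E\<in>coarse_edges \<T>H. edge_integral E (\<lambda>x. coeff_avg \<kappa> \<T>H pl E * jump \<T>H pl E (\<lambda>x. \<alpha> * v x + \<beta> * v' x) x * jump \<T>H pl E w x))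
      = \<alpha> * (\<Sum>E\<in>coarse_edges \<T>H. edge_integral E (\<lambda>x. coeff_avg \<kappa> \<T>H pl E * jump \<T>H pl E v x * jump \<T>H pl E w x))
      + \<beta> * (\<Sum>E\<in>coarse_edges \<T>H. edge_integral E (\<lambda>x. coeff_avg \<kappa> \<T>H pl E * jump \<T>H pl E v' x * jump \<T>H pl E w x))"
    by (rule lin) (rule edge_penalty_lincomb[OF _ v w])
  show ?thesis
    unfolding a_DG_def s1 s2 s3 s4 by (simp add: algebra_simps add_divide_distrib)
qed

end

text \<open>Exchanging the arguments swaps the two consistency sums, so this is an identity for
  arbitrary functions.\<close>

lemma a_DG_commute: "a_DG \<kappa> \<gamma> \<T>H \<T>h pl v w = a_DG \<kappa> \<gamma> \<T>H \<T>h pl w v"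
  unfolding a_DG_def elem_energy_def by (simp add: inner_commute mult_ac)

section \<open>Energy estimate for the leapfrog recursion\<close>

text \<open>The increments are linear in \<open>x\<close> while the energy controls its square.
  Summing against the maximum \<open>M\<close> gives a bound linear in \<open>M\<close>; at an index
  where \<open>M\<close> is attained, the lower bound is quadratic in \<open>M\<close> and absorbs
  it.\<close>

lemma leapfrog_gronwall:
  fixes e x \<phi> :: "nat \<Rightarrow> real"
  assumes s: "0 < s" and \<tau>: "0 \<le> \<tau>" and x: "\<And>k. 0 \<le> x k" and \<phi>: "\<And>k. 0 \<le> \<phi> k"
    and step: "\<And>k. k \<in> {1..n} \<Longrightarrow> e k \<le> e (k - 1) + \<tau> / 2 * (\<phi> k * (x k + x (k - 1)))"
    and low: "\<And>k. k \<le> n \<Longrightarrow> s / 2 * (x k)\<^sup>2 \<le> e k"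
  shows "e n \<le> 2 * e 0 + 2 * \<tau>\<^sup>2 * (\<Sum>k=1..n. \<phi> k)\<^sup>2 / s"
proof -
  define M where "M = Max (x ` {..n})"
  define S where "S = (\<Sum>k=1..n. \<phi> k)"
  have xM: "x k \<le> M" if "k \<le> n" for k using that by (simp add: M_def)
  then have M0: "0 \<le> M" using x[of 0] by force
  have sum: "e j \<le> e 0 + \<tau> * M * (\<Sum>k=1..j. \<phi> k)" if "j \<le> n" for j
    using that
  proof (induction j)
    case (Suc j)
    have "\<phi> (Suc j) * (x (Suc j) + x j) \<le> \<phi> (Suc j) * (2 * M)"
      using xM[of "Suc j"] xM[of j] Suc.prems \<phi> by (intro mult_left_mono) auto
    then have "\<tau> / 2 * (\<phi> (Suc j) * (x (Suc j) + x j)) \<le> \<tau> / 2 * (\<phi> (Suc j) * (2 * M))"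
      by (rule mult_left_mono) (use \<tau> in simp)
    moreover have "e (Suc j) \<le> e j + \<tau> / 2 * (\<phi> (Suc j) * (x (Suc j) + x j))"
      using step[of "Suc j"] Suc.prems by simp
    ultimately show ?case using Suc by (simp add: algebra_simps)
  qed simp
  have bound: "e j \<le> e 0 + \<tau> * M * S" if "j \<le> n" for j
  proof -
    have "(\<Sum>k=1..j. \<phi> k) \<le> S" unfolding S_def using that \<phi> by (intro sum_mono2) auto
    then have "\<tau> * M * (\<Sum>k=1..j. \<phi> k) \<le> \<tau> * M * S" by (rule mult_left_mono) (use \<tau> M0 in simp)
    then show ?thesis using sum[OF that] by linarith
  qed
  have "M \<in> x ` {..n}" unfolding M_def by (rule Max_in) auto
  then obtain j where j: "j \<le> n" "x j = M" by auto
  have 1: "s / 2 * M\<^sup>2 \<le> e 0 + \<tau> * M * S" using low[OF j(1)] bound[OF j(1)] j(2) by simp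
  \<comment> \<open>Young's inequality, weighted so that the quadratic term
    \<open>s / 4 * M\<^sup>2\<close> is at most half of \<open>e 0 + \<tau> * M * S\<close> by fact
    \<open>1\<close>. Moving that half to the left doubles the rest.\<close>
  have "0 \<le> (s / 2 * M - \<tau> * S)\<^sup>2 / s" using s by simp
  also have "\<dots> = s / 4 * M\<^sup>2 - \<tau> * M * S + \<tau>\<^sup>2 * S\<^sup>2 / s"
    using s by (simp add: power2_eq_square field_simps)
  finally have "e 0 + \<tau> * M * S \<le> 2 * e 0 + 2 * (\<tau>\<^sup>2 * S\<^sup>2 / s)" using 1 by linarith
  then show ?thesis using bound[of n] by (simp add: S_def)
qed

text \<open>Relative to a set \<open>V\<close>, since for \<open>a_DG\<close> bilinearity is
  established for piecewise smooth functions. The form is merely semidefinite, because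
  \<open>b_form\<close> sees a function only through its projection.\<close>

locale bilinear_form_on =
  fixes V :: "('a \<Rightarrow> real) set" and a :: "('a \<Rightarrow> real) \<Rightarrow> ('a \<Rightarrow> real) \<Rightarrow> real"
  assumes lincomb_closed: "v \<in> V \<Longrightarrow> w \<in> V \<Longrightarrow> (\<lambda>x. \<alpha> * v x + \<beta> * w x) \<in> V"
    and lincomb_left: "v \<in> V \<Longrightarrow> v' \<in> V \<Longrightarrow> w \<in> V \<Longrightarrow>
      a (\<lambda>x. \<alpha> * v x + \<beta> * v' x) w = \<alpha> * a v w + \<beta> * a v' w"
    and commute: "v \<in> V \<Longrightarrow> w \<in> V \<Longrightarrow> a v w = a w v"
    and nonneg: "v \<in> V \<Longrightarrow> 0 \<le> a v v"
begin

lemma lincomb_right: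
  assumes "v \<in> V" "w \<in> V" "w' \<in> V"
  shows "a v (\<lambda>x. \<alpha> * w x + \<beta> * w' x) = \<alpha> * a v w + \<beta> * a v w'"
  using lincomb_left[OF assms(2,3,1), of \<alpha> \<beta>] commute[OF assms(1) lincomb_closed[OF assms(2,3)], of \<alpha> \<beta>]
    commute[OF assms(1,2)] commute[OF assms(1,3)] by simp

lemma lincomb_square:
  assumes "v \<in> V" "w \<in> V"
  shows "a (\<lambda>x. \<alpha> * v x + \<beta> * w x) (\<lambda>x. \<alpha> * v x + \<beta> * w x)
    = \<alpha>\<^sup>2 * a v v + 2 * \<alpha> * \<beta> * a v w + \<beta>\<^sup>2 * a w w"
  using commute[OF assms]
  by (simp add: lincomb_left lincomb_right lincomb_closed assms algebra_simps power2_eq_square)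

lemma Cauchy_Schwarz:
  assumes "v \<in> V" "w \<in> V"
  shows "\<bar>a v w\<bar> \<le> sqrt (a v v) * sqrt (a w w)"
proof -
  have q: "0 \<le> \<alpha>\<^sup>2 * a v v + 2 * \<alpha> * \<beta> * a v w + \<beta>\<^sup>2 * a w w" for \<alpha> \<beta>
    using nonneg[OF lincomb_closed[OF assms]] lincomb_square[OF assms] by simp
  have "(a v w)\<^sup>2 \<le> a v v * a w w"
  proof (cases "a w w = 0")
    case True
    have "a v w = 0"
    proof (rule ccontr)
      assume n: "a v w \<noteq> 0"
      \<comment> \<open>With \<open>a w w = 0\<close> the quadratic expression is affine in its
        second coefficient; this choice makes its value -1.\<close>
      show False using q[of 1 "- (a v v + 1) / (2 * a v w)"] n True by (simp add: field_simps)
    qed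
    then show ?thesis using True by simp
  next
    case False
    then have pos: "0 < a w w" using nonneg[OF assms(2)] by simp
    \<comment> \<open>The usual minimizing combination, multiplied by \<open>a w w\<close> to avoid
      a division.\<close>
    have "0 \<le> a w w * (a v v * a w w - (a v w)\<^sup>2)"
      using q[of "a w w" "- a v w"] by (simp add: power2_eq_square algebra_simps)
    then show ?thesis using pos by (simp add: zero_le_mult_iff)
  qed
  then show ?thesis by (metis real_sqrt_abs real_sqrt_le_mono real_sqrt_mult)
qed

end

text \<open>\<open>inverse_ineq\<close> merges the inverse inequality of the trial space with the
  stability condition, so no mesh data enter the time stepping argument. \<open>F n\<close> is the
  load at step \<open>n\<close> and \<open>\<phi> n\<close> bounds it in the seminorm of
  \<open>b\<close>.\<close>

locale leapfrog = a: bilinear_form_on V a + b: bilinear_form_on V b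
  for V :: "('a \<Rightarrow> real) set" and a b +
  fixes \<tau> :: real and N :: nat and u :: "nat \<Rightarrow> 'a \<Rightarrow> real" and \<rho> :: real
    and F :: "nat \<Rightarrow> ('a \<Rightarrow> real) \<Rightarrow> real" and \<phi> :: "nat \<Rightarrow> real"
  assumes tau: "0 < \<tau>" and rho: "0 \<le> \<rho>" "\<rho> < 1"
    and u: "n \<le> N \<Longrightarrow> u n \<in> V"
    and inverse_ineq: "v \<in> V \<Longrightarrow> \<tau>\<^sup>2 / 4 * a v v \<le> \<rho>\<^sup>2 * b v v"
    and scheme: "n \<in> {1..N - 1} \<Longrightarrow> w \<in> V \<Longrightarrow>
      b (\<lambda>x. (u (n + 1) x - 2 * u n x + u (n - 1) x) / \<tau>\<^sup>2) w + a (u n) w = F n w"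
    and load: "n \<in> {1..N - 1} \<Longrightarrow> w \<in> V \<Longrightarrow> F n w \<le> \<phi> n * sqrt (b w w)" "0 \<le> \<phi> n"
begin

definition vel :: "nat \<Rightarrow> 'a \<Rightarrow> real" where "vel n = (\<lambda>x. (u (n + 1) x - u n x) / \<tau>)"
definition mid :: "nat \<Rightarrow> 'a \<Rightarrow> real" where "mid n = (\<lambda>x. (u (n + 1) x + u n x) / 2)"
definition en :: "nat \<Rightarrow> real" where
  "en n = 1/2 * b (vel n) (vel n) - \<tau>\<^sup>2 / 8 * a (vel n) (vel n) + 1/2 * a (mid n) (mid n)"

lemma vel_lincomb: "vel n = (\<lambda>x. (1 / \<tau>) * u (n + 1) x + (- (1 / \<tau>)) * u n x)"
  by (simp add: vel_def fun_eq_iff diff_divide_distrib)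

lemma mid_lincomb: "mid n = (\<lambda>x. (1 / 2) * u (n + 1) x + (1 / 2) * u n x)"
  by (simp add: mid_def fun_eq_iff add_divide_distrib)

lemma vel_mem: "n < N \<Longrightarrow> vel n \<in> V"
  unfolding vel_lincomb by (intro a.lincomb_closed u) auto

lemma mid_mem: "n < N \<Longrightarrow> mid n \<in> V"
  unfolding mid_lincomb by (intro a.lincomb_closed u) auto

lemma en_eq:
  assumes "n < N"
  shows "en n = 1/2 * b (vel n) (vel n) + 1/2 * a (u (n + 1)) (u n)"
proof -
  have m: "u (n + 1) \<in> V" "u n \<in> V" using u assms by auto
  have "\<tau>\<^sup>2 / 8 * a (vel n) (vel n)
      = (a (u (n + 1)) (u (n + 1)) - 2 * a (u (n + 1)) (u n) + a (u n) (u n)) / 8"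
    unfolding vel_lincomb a.lincomb_square[OF m] using tau by (simp add: field_simps power2_eq_square)
  moreover have "1/2 * a (mid n) (mid n)
      = (a (u (n + 1)) (u (n + 1)) + 2 * a (u (n + 1)) (u n) + a (u n) (u n)) / 8"
    unfolding mid_lincomb a.lincomb_square[OF m] by (simp add: field_simps power2_eq_square)
  ultimately show ?thesis unfolding en_def by (simp add: field_simps)
qed

lemma en_step_eq:
  assumes n: "n \<in> {1..N - 1}"
  shows "en n = en (n - 1) + \<tau> / 2 * (F n (vel n) + F n (vel (n - 1)))"
proof -
  have nN: "n < N" using n by auto
  obtain k where k: "n = Suc k" using n by (cases n) auto
  define p q r where "p = u (n + 1)" and "q = u n" and "r = u (n - 1)"
  have m: "p \<in> V" "q \<in> V" "r \<in> V" using u n by (auto simp: p_def q_def r_def)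
  have v: "vel n = (\<lambda>x. (1 / \<tau>) * p x + (- (1 / \<tau>)) * q x)"
    "vel (n - 1) = (\<lambda>x. (1 / \<tau>) * q x + (- (1 / \<tau>)) * r x)"
    unfolding vel_lincomb p_def q_def r_def k by simp_all
  have acc: "(\<lambda>x. (u (n + 1) x - 2 * u n x + u (n - 1) x) / \<tau>\<^sup>2)
      = (\<lambda>x. (1 / \<tau>) * vel n x + (- (1 / \<tau>)) * vel (n - 1) x)"
    unfolding v p_def q_def r_def using tau by (auto simp: fun_eq_iff field_simps power2_eq_square)
  have vm: "vel n \<in> V" "vel (n - 1) \<in> V" using n by (auto intro: vel_mem)
  have 1: "(b (vel n) (vel n) - b (vel (n - 1)) (vel n)) / \<tau> + a q (vel n) = F n (vel n)"
    using scheme[OF n vm(1)] unfolding acc b.lincomb_left[OF vm vm(1)]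
    by (simp add: q_def diff_divide_distrib)
  have 2: "(b (vel n) (vel (n - 1)) - b (vel (n - 1)) (vel (n - 1))) / \<tau> + a q (vel (n - 1))
      = F n (vel (n - 1))"
    using scheme[OF n vm(2)] unfolding acc b.lincomb_left[OF vm vm(2)]
    by (simp add: q_def diff_divide_distrib)
  have 3: "a q (vel n) = (a q p - a q q) / \<tau>" "a q (vel (n - 1)) = (a q q - a q r) / \<tau>"
    unfolding v a.lincomb_right[OF m(2,1,2)] a.lincomb_right[OF m(2,2,3)]
    by (simp_all add: diff_divide_distrib)
  \<comment> \<open>The mixed products of the two velocities cancel by symmetry of \<open>b\<close>,
    and the two occurrences of \<open>a q q\<close> cancel as well.\<close>
  have "\<tau> * (F n (vel n) + F n (vel (n - 1)))
      = b (vel n) (vel n) - b (vel (n - 1)) (vel (n - 1)) + a q p - a q r"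
    unfolding 1[symmetric] 2[symmetric] 3 using tau b.commute[OF vm] by (simp add: field_simps)
  moreover have "en n = 1/2 * b (vel n) (vel n) + 1/2 * a q p"
    using en_eq[OF nN] a.commute[OF m(1,2)] by (simp add: p_def q_def)
  moreover have "en (n - 1) = 1/2 * b (vel (n - 1)) (vel (n - 1)) + 1/2 * a q r"
    using en_eq[of "n - 1"] n by (simp add: q_def r_def k)
  ultimately show ?thesis by (simp add: field_simps)
qed

lemma en_lower:
  assumes "n < N"
  shows "(1 - \<rho>\<^sup>2) / 2 * b (vel n) (vel n) + 1/2 * a (mid n) (mid n) \<le> en n"
  using inverse_ineq[OF vel_mem[OF assms]] unfolding en_def by (simp add: field_simps)

lemma leapfrog_energy_estimate:
  assumes n: "n \<in> {1..N - 1}"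
  shows "b (vel n) (vel n) + a (mid n) (mid n)
    \<le> 4 / (1 - \<rho>\<^sup>2)\<^sup>2 * (en 0 + \<tau>\<^sup>2 * (\<Sum>k=1..n. \<phi> k)\<^sup>2)"
proof -
  define s where "s = 1 - \<rho>\<^sup>2"
  have s: "0 < s" "s \<le> 1" using rho by (simp_all add: s_def abs_square_less_1)
  define Z where "Z = \<tau>\<^sup>2 * (\<Sum>k=1..n. \<phi> k)\<^sup>2"
  have Z: "0 \<le> Z" by (simp add: Z_def)
  have low: "s / 2 * b (vel k) (vel k) + 1/2 * a (mid k) (mid k) \<le> en k" if "k < N" for k
    using en_lower[OF that] by (simp add: s_def)
  have pos: "0 \<le> b (vel k) (vel k)" "0 \<le> a (mid k) (mid k)" if "k < N" for k
    using b.nonneg[OF vel_mem[OF that]] a.nonneg[OF mid_mem[OF that]] by auto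
  \<comment> \<open>Set to zero from \<open>N\<close> on, where \<open>vel k\<close> need not lie in
    \<open>V\<close>, because \<open>leapfrog_gronwall\<close> asks for nonnegativity at every
    index.\<close>
  define y where "y k = (if k < N then sqrt (b (vel k) (vel k)) else 0)" for k
  have yk: "(y k)\<^sup>2 = b (vel k) (vel k)" "y k = sqrt (b (vel k) (vel k))" if "k < N" for k
    using that pos by (auto simp: y_def)
  have "en n \<le> 2 * en 0 + 2 * \<tau>\<^sup>2 * (\<Sum>k=1..n. \<phi> k)\<^sup>2 / s"
  proof (rule leapfrog_gronwall[where x = y])
    show "0 \<le> y k" for k using pos by (auto simp: y_def)
    show "s / 2 * (y k)\<^sup>2 \<le> en k" if "k \<le> n" for k
    proof -
      have "k < N" using that n by auto
      then show ?thesis using low[of k] pos[of k] yk[of k] by simp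
    qed
    show "en k \<le> en (k - 1) + \<tau> / 2 * (\<phi> k * (y k + y (k - 1)))" if k: "k \<in> {1..n}" for k
    proof -
      have kN: "k \<in> {1..N - 1}" "k < N" "k - 1 < N" using k n by auto
      have "F k (vel k) + F k (vel (k - 1)) \<le> \<phi> k * (y k + y (k - 1))"
        using load(1)[OF kN(1) vel_mem[OF kN(2)]] load(1)[OF kN(1) vel_mem[OF kN(3)]] yk(2)[OF kN(2)] yk(2)[OF kN(3)]
        by (simp add: distrib_left)
      then have "\<tau> / 2 * (F k (vel k) + F k (vel (k - 1))) \<le> \<tau> / 2 * (\<phi> k * (y k + y (k - 1)))"
        by (rule mult_left_mono) (use tau in simp)
      then show ?thesis using en_step_eq[OF kN(1)] by linarith
    qed
  qed (use s tau load(2) in auto)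
  then have 1: "en n \<le> 2 * en 0 + 2 * Z / s" by (simp add: Z_def)
  have N0: "0 < N" using n by auto
  \<comment> \<open>Nonnegativity of \<open>en 0\<close> is what permits enlarging it to
    \<open>en 0 / s\<close> below.\<close>
  have "0 \<le> s / 2 * b (vel 0) (vel 0)" using s pos(1)[OF N0] by simp
  then have e0: "0 \<le> en 0" using low[OF N0] pos(2)[OF N0] by linarith
  have nN: "n < N" using n by auto
  \<comment> \<open>The lower bound carries the factor \<open>s\<close> on the kinetic term only; as
    \<open>s \<le> 1\<close>, it may be put before the potential term too. Dividing by it at the end
    gives the second factor \<open>1 / s\<close>.\<close>
  have "s * (b (vel n) (vel n) + a (mid n) (mid n)) \<le> s * b (vel n) (vel n) + a (mid n) (mid n)"
    using mult_right_mono[OF s(2) pos(2)[OF nN]] by (simp add: distrib_left)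
  also have "\<dots> \<le> 2 * en n" using low[OF nN] by simp
  also have "\<dots> \<le> 4 * (en 0 + Z / s)" using 1 by simp
  also have "\<dots> \<le> 4 * (en 0 / s + Z / s)"
    using e0 s by (simp add: le_divide_eq mult_left_le)
  finally have "b (vel n) (vel n) + a (mid n) (mid n) \<le> 4 * (en 0 / s + Z / s) / s"
    using s(1) by (simp add: le_divide_eq mult.commute)
  also have "\<dots> = 4 / s\<^sup>2 * (en 0 + Z)" by (simp add: power2_eq_square add_divide_distrib algebra_simps)
  finally show ?thesis by (simp add: s_def Z_def)
qed

end

section \<open>The projection onto the test space\<close>

lemma L2_inner_commute: "L2_inner S v w = L2_inner S w v"
  by (simp add: L2_inner_def mult.commute)

lemma L2_inner_nonneg: "0 \<le> L2_inner S v v"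
  unfolding L2_inner_def by (rule Bochner_Integration.integral_nonneg) simp

lemma L2_norm_square: "(L2_norm S v)\<^sup>2 = L2_inner S v v"
  using L2_inner_nonneg by (simp add: L2_norm_def)

lemma ess_bdd_lincomb: "ess_bdd M v \<Longrightarrow> ess_bdd M w \<Longrightarrow> ess_bdd M (\<lambda>x. \<alpha> * v x + \<beta> * w x)"
  by (intro ess_bdd_add ess_bdd_cmult)

lemma L2_inner_lincomb:
  assumes "finite_measure (lebesgue_on S)"
    and "ess_bdd (lebesgue_on S) v" "ess_bdd (lebesgue_on S) v'" "ess_bdd (lebesgue_on S) w"
  shows "L2_inner S (\<lambda>x. \<alpha> * v x + \<beta> * v' x) w = \<alpha> * L2_inner S v w + \<beta> * L2_inner S v' w"
proof -
  have 1: "ess_bdd (lebesgue_on S) (\<lambda>x. v x * w x)" "ess_bdd (lebesgue_on S) (\<lambda>x. v' x * w x)"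
    using assms ess_bdd_mult by auto
  have "(\<lambda>x. (\<alpha> * v x + \<beta> * v' x) * w x) \<in> borel_measurable (lebesgue_on S)"
    using ess_bdd_mult[OF ess_bdd_lincomb[OF assms(2,3)] assms(4)] by (simp add: ess_bdd_def)
  then show ?thesis
    unfolding L2_inner_def
    by (rule ess_bdd_integral_lincomb[OF assms(1) 1]) (simp add: algebra_simps)
qed

lemma bilinear_form_on_L2_inner:
  assumes "finite_measure (lebesgue_on S)"
  shows "bilinear_form_on {v. ess_bdd (lebesgue_on S) v} (L2_inner S)"
proof
  show "L2_inner S v w = L2_inner S w v" for v w by (rule L2_inner_commute)
qed (auto simp: ess_bdd_lincomb L2_inner_lincomb[OF assms] L2_inner_nonneg)

lemma mesh_size_pos:
  assumes "fe_partition \<Omega> \<T>" "\<Omega> \<noteq> {}"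
  shows "0 < mesh_size \<T>"
proof -
  have "closure \<Omega> \<noteq> {}" using assms(2) by simp
  then have "\<Union>\<T> \<noteq> {}" using assms(1) unfolding fe_partition_def by simp
  then obtain K where K: "K \<in> \<T>" by blast
  obtain x where "x \<in> interior K" using fe_partition_elem(2)[OF assms(1) K] by blast
  then obtain e where e: "0 < e" "ball x e \<subseteq> K" by (auto simp: mem_interior)
  have "bounded K" using fe_partition_elem(5)[OF assms(1) K] by (rule compact_imp_bounded)
  then have "diameter (ball x e) \<le> diameter K" using e(2) by (intro diameter_subset)
  moreover have "diameter (ball x e) = 2 * e" using e(1) by (simp add: diameter_ball)
  moreover have "diameter K \<le> mesh_size \<T>"
    unfolding mesh_size_def using assms(1) K by (intro Max_ge) (auto simp: fe_partition_def)
  ultimately show ?thesis using e(1) by linarith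
qed

section \<open>Linearity of the projection and the estimate on a given grid\<close>

context dg_grid
begin

lemma finite_measure_element: "K \<in> \<T>H \<Longrightarrow> finite_measure (lebesgue_on K)"
  using fe_partition_elem(5)[OF H] by (intro finite_measure_lebesgue_on lmeasurable_compact)

lemma smooth_ess_bdd:
  assumes K: "K \<in> \<T>H" and v: "smooth v"
  shows "ess_bdd (lebesgue_on K) v"
proof -
  obtain g where g: "continuous_on K g" "\<forall>x\<in>interior K. v x = g x"
    using v K unfolding pw_smooth_def by blast
  have "continuous_on (interior K) g" by (rule continuous_on_subset[OF g(1) interior_subset])
  then have "continuous_on (interior K) v" by (rule continuous_on_eq) (use g(2) in simp)
  then have m: "v \<in> borel_measurable (lebesgue_on (interior K))"
    by (rule continuous_imp_measurable_on_sets_lebesgue) auto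
  have c: "compact K" "closed K" "convex K" using fe_partition_elem[OF H K] by auto
  have "bounded (g ` K)" by (rule compact_imp_bounded[OF compact_continuous_image[OF g(1) c(1)]])
  then obtain B where "\<forall>x\<in>K. \<bar>g x\<bar> \<le> B" by (auto simp: bounded_iff)
  then have B: "\<bar>v x\<bar> \<le> B" if "x \<in> interior K" for x
    using that g(2) interior_subset[of K] by auto
  have "negligible (K - interior K)"
    using negligible_convex_frontier[OF c(3)] c(2) by (simp add: frontier_def)
  moreover have "K \<in> sets lebesgue" using c(2) by auto
  ultimately show ?thesis using ess_bdd_lebesgue_on[OF _ interior_subset _ m B] by blast
qed

text \<open>The set \<open>S\<close> is free because eigenfunctions, extended by zero, are paired
  over single elements in the coefficients of the projection and over the whole domain in
  \<open>b_form\<close>.\<close>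

lemma Vh_elem_ess_bdd:
  assumes K: "K \<in> \<T>H" and w: "w \<in> Vh_elem \<T>h K" and S: "S \<in> sets lebesgue"
  shows "ess_bdd (lebesgue_on S) w"
proof -
  have wK: "continuous_on K w" "\<And>x. x \<notin> K \<Longrightarrow> w x = 0" using w by (auto simp: Vh_elem_def)
  have c: "compact K" "closed K" using fe_partition_elem[OF H K] by auto
  have Ks: "K \<in> sets lebesgue" using c(2) by auto
  have "(\<lambda>x. if x \<in> K then w x else 0) \<in> borel_measurable lebesgue"
    using continuous_imp_measurable_on_sets_lebesgue[OF wK(1) Ks] Ks by (rule borel_measurable_if_I)
  moreover have "(\<lambda>x. if x \<in> K then w x else 0) = w" using wK(2) by auto
  ultimately have "w \<in> borel_measurable (lebesgue_on S)" by (simp add: measurable_restrict_space1)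
  moreover have "bounded (w ` K)"
    by (rule compact_imp_bounded[OF compact_continuous_image[OF wK(1) c(1)]])
  then obtain B where B: "\<forall>x\<in>K. \<bar>w x\<bar> \<le> B" by (auto simp: bounded_iff)
  have "\<bar>w x\<bar> \<le> \<bar>B\<bar>" for x using B wK(2)[of x] by (cases "x \<in> K") force+
  ultimately show ?thesis by (intro ess_bddI[of _ _ "\<bar>B\<bar>"]) simp_all
qed

text \<open>Smoothness ensures that the coefficient integrals exist; the integral of a function that
  is not integrable has a default value and need not be additive.\<close>

lemma pi_proj_lincomb:
  assumes \<phi>: "\<And>K j. K \<in> \<T>H \<Longrightarrow> j \<in> {1..L K} \<Longrightarrow> \<phi> K j \<in> Vh_elem \<T>h K"
    and v: "smooth v" "smooth w"
  shows "pi_proj \<T>H L \<phi> (\<lambda>x. \<alpha> * v x + \<beta> * w x)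
    = (\<lambda>x. \<alpha> * pi_proj \<T>H L \<phi> v x + \<beta> * pi_proj \<T>H L \<phi> w x)"
proof
  fix x
  have e: "L2_inner K (\<lambda>x. \<alpha> * v x + \<beta> * w x) (\<phi> K j)
      = \<alpha> * L2_inner K v (\<phi> K j) + \<beta> * L2_inner K w (\<phi> K j)"
    if K: "K \<in> \<T>H" "j \<in> {1..L K}" for K j
  proof (rule L2_inner_lincomb[OF finite_measure_element[OF K(1)]
        smooth_ess_bdd[OF K(1) v(1)] smooth_ess_bdd[OF K(1) v(2)]])
    have "closed K" using fe_partition_elem(6)[OF H K(1)] .
    then have "K \<in> sets lebesgue" by auto
    then show "ess_bdd (lebesgue_on K) (\<phi> K j)" by (rule Vh_elem_ess_bdd[OF K(1) \<phi>[OF K]])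
  qed
  have "pi_proj \<T>H L \<phi> (\<lambda>x. \<alpha> * v x + \<beta> * w x) x
      = (\<Sum>K\<in>\<T>H. \<Sum>j=1..L K. (\<alpha> * L2_inner K v (\<phi> K j) + \<beta> * L2_inner K w (\<phi> K j)) * \<phi> K j x)"
    unfolding pi_proj_def by (intro sum.cong refl) (simp add: e)
  also have "\<dots> = \<alpha> * pi_proj \<T>H L \<phi> v x + \<beta> * pi_proj \<T>H L \<phi> w x"
    unfolding pi_proj_def by (simp add: sum.distrib sum_distrib_left distrib_right mult.assoc)
  finally show "pi_proj \<T>H L \<phi> (\<lambda>x. \<alpha> * v x + \<beta> * w x) x
      = \<alpha> * pi_proj \<T>H L \<phi> v x + \<beta> * pi_proj \<T>H L \<phi> w x" .
qed

text \<open>No condition on \<open>v\<close>: whatever its coefficients are, the result is a finite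
  combination of bounded eigenfunctions. So it also covers the projected source term.\<close>

lemma pi_proj_ess_bdd:
  assumes \<phi>: "\<And>K j. K \<in> \<T>H \<Longrightarrow> j \<in> {1..L K} \<Longrightarrow> \<phi> K j \<in> Vh_elem \<T>h K"
    and S: "S \<in> sets lebesgue"
  shows "ess_bdd (lebesgue_on S) (pi_proj \<T>H L \<phi> v)"
proof -
  have "span_of \<T>H L \<phi> \<subseteq> {v. ess_bdd (lebesgue_on S) v}"
    using Vh_elem_ess_bdd[OF _ \<phi> S] finite_grids(1)
    by (intro span_of_subset) (auto simp: ess_bdd_lincomb ess_bdd_const)
  moreover have "pi_proj \<T>H L \<phi> v \<in> span_of \<T>H L \<phi>"
    unfolding pi_proj_def span_of_def
    by (intro CollectI exI[of _ "\<lambda>K j. L2_inner K v (\<phi> K j)"]) simp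
  ultimately show ?thesis by blast
qed

lemma stability_estimate:
  assumes dom: "bounded_domain \<Omega>" and par: "0 < \<beta>" "0 < \<tau>" "\<rho> < 1"
    and \<rho>: "\<rho> = sqrt \<kappa>1 * \<tau> / (2 * sqrt \<beta> * mesh_size \<T>H)"
    and coercive: "bounded_coercive \<kappa> \<gamma> \<T>H \<T>h pl"
    and spectral: "spectral_test_space \<kappa> \<T>H \<T>h L lam \<phi>"
    and basis: "localized_basis \<kappa> \<gamma> \<T>H \<T>h pl L \<phi> m \<psi>"
    and inv: "\<And>v. v \<in> span_of \<T>H L \<psi> \<Longrightarrow>
      (L2_norm \<Omega> (pi_proj \<T>H L \<phi> v))\<^sup>2 \<ge> \<beta> / \<kappa>1 * (mesh_size \<T>H)\<^sup>2 * a_DG \<kappa> \<gamma> \<T>H \<T>h pl v v"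
    and sol: "scheme_solution \<Omega> (a_DG \<kappa> \<gamma> \<T>H \<T>h pl) (pi_proj \<T>H L \<phi>) (span_of \<T>H L \<psi>) \<tau> N f u0 v0 uh0 u"
    and n: "n \<in> {1..N - 1}"
  shows "(L2_norm \<Omega> (pi_proj \<T>H L \<phi> (\<lambda>x. (u (n + 1) x - u n x) / \<tau>)))\<^sup>2
      + a_DG \<kappa> \<gamma> \<T>H \<T>h pl (\<lambda>x. (u (n + 1) x + u n x) / 2) (\<lambda>x. (u (n + 1) x + u n x) / 2)
    \<le> 4 / (1 - \<rho>\<^sup>2)\<^sup>2 * (energy \<Omega> (a_DG \<kappa> \<gamma> \<T>H \<T>h pl) (pi_proj \<T>H L \<phi>) \<tau> u 0
        + \<tau>\<^sup>2 * (\<Sum>k=1..n. L2_norm \<Omega> (pi_proj \<T>H L \<phi> (f (real k * \<tau>))))\<^sup>2)"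
proof -
  define a where "a = a_DG \<kappa> \<gamma> \<T>H \<T>h pl"
  define P where "P = pi_proj \<T>H L \<phi>"
  define V where "V = span_of \<T>H L \<psi>"
  \<comment> \<open>Here \<open>h\<close> denotes the coarse mesh size.\<close>
  define h where "h = mesh_size \<T>H"
  have hpos: "0 < h" using mesh_size_pos[OF H] dom by (simp add: h_def bounded_domain_def)
  obtain x where "x \<in> \<Omega>" using dom by (auto simp: bounded_domain_def)
  then have kpos: "0 < \<kappa>1" using coeff unfolding coefficient_field_def by force
  have V_Vh: "V \<subseteq> Vh \<T>h \<T>H"
    unfolding V_def by (rule localized_span_subset_Vh[OF H h basis])
  have smooth: "smooth v" if "v \<in> V" for v
    using Vh_pw_smooth[OF H] that V_Vh by blast
  have \<phi>: "\<phi> K j \<in> Vh_elem \<T>h K" if K: "K \<in> \<T>H" "j \<in> {1..L K}" for K j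
  proof -
    obtain M where M: "L K + 1 \<le> M" "eigenpairs \<kappa> (mesh_size \<T>H) \<T>h K M (lam K) (\<phi> K)"
      using spectral K(1) unfolding spectral_test_space_def by blast
    have "j \<in> {1..M}" using K(2) M(1) by auto
    then show ?thesis using M(2) unfolding eigenpairs_def by blast
  qed
  have dom': "open \<Omega>" "bounded \<Omega>" using dom by (auto simp: bounded_domain_def)
  then have Om: "\<Omega> \<in> sets lebesgue" "finite_measure (lebesgue_on \<Omega>)"
    by (auto intro: finite_measure_lebesgue_on lmeasurable_open)
  have PW: "ess_bdd (lebesgue_on \<Omega>) (P v)" for v
    unfolding P_def by (rule pi_proj_ess_bdd[OF \<phi> Om(1)])
  have Plin: "P (\<lambda>x. \<alpha> * v x + \<beta> * w x) = (\<lambda>x. \<alpha> * P v x + \<beta> * P w x)"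
    if "v \<in> V" "w \<in> V" for v w \<alpha> \<beta>
    unfolding P_def using smooth that by (intro pi_proj_lincomb \<phi>)
  interpret L2: bilinear_form_on "{v. ess_bdd (lebesgue_on \<Omega>) v}" "L2_inner \<Omega>"
    by (rule bilinear_form_on_L2_inner[OF Om(2)])
  have closed: "(\<lambda>x. \<alpha> * v x + \<beta> * w x) \<in> V" if "v \<in> V" "w \<in> V" for v w \<alpha> \<beta>
    using that unfolding V_def by (rule span_of_lincomb)
  have a: "bilinear_form_on V a"
  proof
    show "a (\<lambda>x. \<alpha> * v x + \<beta> * v' x) w = \<alpha> * a v w + \<beta> * a v' w"
      if "v \<in> V" "v' \<in> V" "w \<in> V" for v v' w \<alpha> \<beta>
      unfolding a_def by (rule a_DG_lincomb) (use smooth that in auto)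
    show "a v w = a w v" for v w unfolding a_def by (rule a_DG_commute)
    show "0 \<le> a v v" if "v \<in> V" for v
    proof -
      have "1/2 * (norm_a \<kappa> \<gamma> \<T>H \<T>h pl v)\<^sup>2 \<le> a v v"
        using coercive that V_Vh unfolding bounded_coercive_def a_def by blast
      moreover have "0 \<le> 1/2 * (norm_a \<kappa> \<gamma> \<T>H \<T>h pl v)\<^sup>2" by simp
      ultimately show ?thesis by linarith
    qed
  qed (rule closed)
  have b: "bilinear_form_on V (b_form \<Omega> P)"
  proof
    show "b_form \<Omega> P (\<lambda>x. \<alpha> * v x + \<beta> * v' x) w = \<alpha> * b_form \<Omega> P v w + \<beta> * b_form \<Omega> P v' w"
      if "v \<in> V" "v' \<in> V" for v v' w \<alpha> \<beta>
      unfolding b_form_def Plin[OF that] by (rule L2.lincomb_left) (simp_all add: PW)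
    show "b_form \<Omega> P v w = b_form \<Omega> P w v" for v w
      unfolding b_form_def by (rule L2_inner_commute)
  qed (auto simp: closed b_form_def L2_inner_nonneg)
  define load where "load k = L2_norm \<Omega> (P (f (real k * \<tau>)))" for k
  have bP: "b_form \<Omega> P v v = (L2_norm \<Omega> (P v))\<^sup>2" for v
    by (simp add: b_form_def L2_norm_square)
  have r0: "0 \<le> \<rho>" using \<rho> par kpos hpos by (simp add: h_def)
  \<comment> \<open>In this form \<rho>^2 times the factor
    \<open>\<beta> / \<kappa>1 * h\<^sup>2\<close> of the inverse inequality is exactly
    \<open>\<tau>\<^sup>2 / 4\<close>, which gives the assumption \<open>inverse_ineq\<close> of the
    locale.\<close>
  have r2: "\<rho>\<^sup>2 = \<kappa>1 * \<tau>\<^sup>2 / (4 * \<beta> * h\<^sup>2)"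
    using \<rho> par kpos by (simp add: h_def power_divide power_mult_distrib)
  interpret leapfrog V a "b_form \<Omega> P" \<tau> N u \<rho> "\<lambda>n. b_form \<Omega> P (f (real n * \<tau>))" load
  proof (intro leapfrog.intro leapfrog_axioms.intro a b)
    show "0 < \<tau>" "0 \<le> \<rho>" "\<rho> < 1" using par r0 by auto
    show "u n \<in> V" if "n \<le> N" for n
      using sol that unfolding scheme_solution_def V_def by blast
    show "\<tau>\<^sup>2 / 4 * a v v \<le> \<rho>\<^sup>2 * b_form \<Omega> P v v" if "v \<in> V" for v
    proof -
      have "\<tau>\<^sup>2 / 4 * a v v = \<rho>\<^sup>2 * (\<beta> / \<kappa>1 * h\<^sup>2 * a v v)"
        using par kpos hpos unfolding r2 by (simp add: field_simps)
      also have "\<dots> \<le> \<rho>\<^sup>2 * b_form \<Omega> P v v"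
        unfolding bP unfolding a_def P_def h_def
        by (rule mult_left_mono) (use inv[of v] that in \<open>simp_all add: V_def\<close>)
      finally show ?thesis .
    qed
    show "b_form \<Omega> P (\<lambda>x. (u (n + 1) x - 2 * u n x + u (n - 1) x) / \<tau>\<^sup>2) w + a (u n) w
        = b_form \<Omega> P (f (real n * \<tau>)) w" if "n \<in> {1..N - 1}" "w \<in> V" for n w
      using sol that unfolding scheme_solution_def V_def a_def P_def by blast
    show "b_form \<Omega> P (f (real n * \<tau>)) w \<le> load n * sqrt (b_form \<Omega> P w w)" for n w
      using L2.Cauchy_Schwarz[of "P (f (real n * \<tau>))" "P w"] PW
      by (simp add: b_form_def load_def L2_norm_def)
    show "0 \<le> load n" for n by (simp add: load_def L2_norm_def L2_inner_nonneg)
  qed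
  show ?thesis
    using leapfrog_energy_estimate[OF n]
    unfolding en_def vel_def mid_def bP energy_def load_def unfolding a_def P_def .
qed

end

text \<open>The order of quantifiers expresses the independence of the constant: it is fixed from
  the domain, the coefficient and the parameters including \<rho>, before grids, \<open>m\<close>,
  the number of time steps and the solution are chosen. The stability condition then links \<rho> to
  the grid.\<close>

theorem theorem6:
  fixes \<Omega> :: "(real^2) set" and \<kappa> :: "real^2 \<Rightarrow> real"
    and \<kappa>0 \<kappa>1 \<gamma> D \<beta> T \<rho> :: real
  assumes "bounded_domain \<Omega>" and "coefficient_field \<Omega> \<kappa> \<kappa>0 \<kappa>1"
    and "0 < \<gamma>" and "0 < D" and "0 < \<beta>" and "0 < T" and "\<rho> < 1"
  shows "\<exists>C>0. \<forall>\<T>H \<T>h pl L lam \<phi> m \<psi> NT f u0 v0 uh0 u.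
    (let H = mesh_size \<T>H; \<tau> = T / real NT; a = a_DG \<kappa> \<gamma> \<T>H \<T>h pl;
         P = pi_proj \<T>H L \<phi>; VHm = span_of \<T>H L \<psi>
     in
      fe_partition \<Omega> \<T>H \<longrightarrow> fine_grid \<Omega> \<T>H \<T>h \<longrightarrow> edge_orientation \<T>H pl \<longrightarrow>
      has_edge_values \<T>H \<kappa> \<longrightarrow>
      bounded_coercive \<kappa> \<gamma> \<T>H \<T>h pl \<longrightarrow>
      spectral_test_space \<kappa> \<T>H \<T>h L lam \<phi> \<longrightarrow>
      stable_lifting \<Omega> \<kappa> \<kappa>1 \<gamma> D \<T>H \<T>h pl L \<phi> \<longrightarrow>
      1 \<le> m \<longrightarrow> localized_basis \<kappa> \<gamma> \<T>H \<T>h pl L \<phi> m \<psi> \<longrightarrow>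
      (\<forall>v\<in>VHm. (L2_norm \<Omega> (P v))\<^sup>2 \<ge> \<beta> / \<kappa>1 * H\<^sup>2 * a v v) \<longrightarrow>
      1 \<le> NT \<longrightarrow> \<rho> = sqrt \<kappa>1 * \<tau> / (2 * sqrt \<beta> * H) \<longrightarrow>
      (\<forall>n\<le>NT. square_integrable \<Omega> (f (real n * \<tau>))) \<longrightarrow>
      square_integrable \<Omega> u0 \<longrightarrow> square_integrable \<Omega> v0 \<longrightarrow>
      L2_projection \<Omega> (Vh \<T>h \<T>H) u0 uh0 \<longrightarrow>
      scheme_solution \<Omega> a P VHm \<tau> NT f u0 v0 uh0 u \<longrightarrow>
      (\<forall>n\<in>{1..NT - 1}.
         (L2_norm \<Omega> (P (\<lambda>x. (u (n + 1) x - u n x) / \<tau>)))\<^sup>2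
         + a (\<lambda>x. (u (n + 1) x + u n x) / 2) (\<lambda>x. (u (n + 1) x + u n x) / 2)
         \<le> C * (energy \<Omega> a P \<tau> u 0
                + \<tau>\<^sup>2 * (\<Sum>k=1..n. L2_norm \<Omega> (P (f (real k * \<tau>))))\<^sup>2)))"
proof (intro exI[of _ "if 0 \<le> \<rho> then 4 / (1 - \<rho>\<^sup>2)\<^sup>2 else 1"] conjI allI)
  \<comment> \<open>The case distinction keeps the witness positive when \<rho> is negative, in
    particular at \<rho> = -1, where the quotient is 0 by division by zero. The formula for \<rho>
    in terms of the grid later excludes negative values.\<close>
  have "1 - \<rho>\<^sup>2 \<noteq> 0" if "0 \<le> \<rho>"
    using that assms(7) abs_square_less_1[of \<rho>] by auto
  then show "0 < (if 0 \<le> \<rho> then 4 / (1 - \<rho>\<^sup>2)\<^sup>2 else 1)" by simp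
next
  fix \<T>H \<T>h pl L lam \<phi> m \<psi> NT f u0 v0 uh0 u
  show "let H = mesh_size \<T>H; \<tau> = T / real NT; a = a_DG \<kappa> \<gamma> \<T>H \<T>h pl;
         P = pi_proj \<T>H L \<phi>; VHm = span_of \<T>H L \<psi>
     in
      fe_partition \<Omega> \<T>H \<longrightarrow> fine_grid \<Omega> \<T>H \<T>h \<longrightarrow> edge_orientation \<T>H pl \<longrightarrow>
      has_edge_values \<T>H \<kappa> \<longrightarrow>
      bounded_coercive \<kappa> \<gamma> \<T>H \<T>h pl \<longrightarrow>
      spectral_test_space \<kappa> \<T>H \<T>h L lam \<phi> \<longrightarrow>
      stable_lifting \<Omega> \<kappa> \<kappa>1 \<gamma> D \<T>H \<T>h pl L \<phi> \<longrightarrow>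
      1 \<le> m \<longrightarrow> localized_basis \<kappa> \<gamma> \<T>H \<T>h pl L \<phi> m \<psi> \<longrightarrow>
      (\<forall>v\<in>VHm. (L2_norm \<Omega> (P v))\<^sup>2 \<ge> \<beta> / \<kappa>1 * H\<^sup>2 * a v v) \<longrightarrow>
      1 \<le> NT \<longrightarrow> \<rho> = sqrt \<kappa>1 * \<tau> / (2 * sqrt \<beta> * H) \<longrightarrow>
      (\<forall>n\<le>NT. square_integrable \<Omega> (f (real n * \<tau>))) \<longrightarrow>
      square_integrable \<Omega> u0 \<longrightarrow> square_integrable \<Omega> v0 \<longrightarrow>
      L2_projection \<Omega> (Vh \<T>h \<T>H) u0 uh0 \<longrightarrow>
      scheme_solution \<Omega> a P VHm \<tau> NT f u0 v0 uh0 u \<longrightarrow>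
      (\<forall>n\<in>{1..NT - 1}.
         (L2_norm \<Omega> (P (\<lambda>x. (u (n + 1) x - u n x) / \<tau>)))\<^sup>2
         + a (\<lambda>x. (u (n + 1) x + u n x) / 2) (\<lambda>x. (u (n + 1) x + u n x) / 2)
         \<le> (if 0 \<le> \<rho> then 4 / (1 - \<rho>\<^sup>2)\<^sup>2 else 1) * (energy \<Omega> a P \<tau> u 0
                + \<tau>\<^sup>2 * (\<Sum>k=1..n. L2_norm \<Omega> (P (f (real k * \<tau>))))\<^sup>2))"
    unfolding Let_def
  proof (intro impI ballI)
    fix n
    assume grid: "fe_partition \<Omega> \<T>H" "fine_grid \<Omega> \<T>H \<T>h" "edge_orientation \<T>H pl"
        "has_edge_values \<T>H \<kappa>"
      and coercive: "bounded_coercive \<kappa> \<gamma> \<T>H \<T>h pl"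
      and spectral: "spectral_test_space \<kappa> \<T>H \<T>h L lam \<phi>"
      and basis: "localized_basis \<kappa> \<gamma> \<T>H \<T>h pl L \<phi> m \<psi>"
      and inv: "\<forall>v\<in>span_of \<T>H L \<psi>. \<beta> / \<kappa>1 * (mesh_size \<T>H)\<^sup>2 * a_DG \<kappa> \<gamma> \<T>H \<T>h pl v v
        \<le> (L2_norm \<Omega> (pi_proj \<T>H L \<phi> v))\<^sup>2"
      and NT: "1 \<le> NT" and \<rho>: "\<rho> = sqrt \<kappa>1 * (T / real NT) / (2 * sqrt \<beta> * mesh_size \<T>H)"
      and sol: "scheme_solution \<Omega> (a_DG \<kappa> \<gamma> \<T>H \<T>h pl) (pi_proj \<T>H L \<phi>) (span_of \<T>H L \<psi>)
        (T / real NT) NT f u0 v0 uh0 u"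
      and n: "n \<in> {1..NT - 1}"
    interpret dg_grid \<Omega> \<kappa> \<kappa>0 \<kappa>1 \<T>H \<T>h pl
      using grid assms(2) by unfold_locales
    have \<tau>: "0 < T / real NT" using assms(6) NT by simp
    obtain x where "x \<in> \<Omega>" using assms(1) by (auto simp: bounded_domain_def)
    then have "0 < \<kappa>1" using assms(2) unfolding coefficient_field_def by force
    moreover have "0 < mesh_size \<T>H"
      using mesh_size_pos[OF grid(1)] assms(1) by (simp add: bounded_domain_def)
    ultimately have "0 \<le> \<rho>"
      unfolding \<rho> using assms(5,6)
      by (intro divide_nonneg_nonneg mult_nonneg_nonneg) (auto intro: less_imp_le)
    then have C: "(if 0 \<le> \<rho> then 4 / (1 - \<rho>\<^sup>2)\<^sup>2 else 1) = 4 / (1 - \<rho>\<^sup>2)\<^sup>2" by simp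
    show "(L2_norm \<Omega> (pi_proj \<T>H L \<phi> (\<lambda>x. (u (n + 1) x - u n x) / (T / real NT))))\<^sup>2
        + a_DG \<kappa> \<gamma> \<T>H \<T>h pl (\<lambda>x. (u (n + 1) x + u n x) / 2) (\<lambda>x. (u (n + 1) x + u n x) / 2)
      \<le> (if 0 \<le> \<rho> then 4 / (1 - \<rho>\<^sup>2)\<^sup>2 else 1) *
        (energy \<Omega> (a_DG \<kappa> \<gamma> \<T>H \<T>h pl) (pi_proj \<T>H L \<phi>) (T / real NT) u 0
          + (T / real NT)\<^sup>2 *
            (\<Sum>k=1..n. L2_norm \<Omega> (pi_proj \<T>H L \<phi> (f (real k * (T / real NT)))))\<^sup>2)"
      unfolding C
      by (rule stability_estimate[OF assms(1,5) \<tau> assms(7) \<rho> coercive spectral basis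
            bspec[OF inv] sol n])
  qed
qed

end
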